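(* Let $d\ge2$, $k\in\{0,\ldots,d-2\}$ and let $F$ be a self-similar set in $\mathbb{R}^d$, generated by similarities $S_1,\ldots,S_N$, satisfying the open set condition OSC and the regularity condition RC. Then the following condition SCBC implies the curvature bound condition CBC (for the index $k$): There is a constant $d_k$ and a null set $\mathcal{N}$ such that for all $\varepsilon\in(0,R)\setminus\mathcal{N}$ and all $i,j\in\{1,\ldots,N\}$ with $i\ne j$, $$C_k^{\mathrm{var}}\big(F_\varepsilon,\,(S_iF)_\varepsilon\cap(S_jF)_\varepsilon\big)\le d_k\varepsilon^k.$$
   Context: Parallel sets and curvature measures. For $K\subset\mathbb{R}^d$ and $\varepsilon\ge0$ put $K_\varepsilon:=\{x\in\mathbb{R}^d:\mathrm{dist}(x,K)\le\varepsilon\}$. For compact $K$, let $\widetilde{K}$ be the closure of the complement of $K$. A distance $\varepsilon\ge 0$ is called regular for the compact set $K$ if $\widetilde{K_\varepsilon}$ has positive reach in the sense of Federer and the boundary $\partial K_\varepsilon$ is a Lipschitz manifold. For regular $\varepsilon$ and $k\in\{0,\ldots,d-1\}$ define the signed measure $C_k(K_\varepsilon,\cdot):=(-1)^{d-1-k}C_k(\widetilde{K_\varepsilon},\cdot)$, where on the right $C_k$ denotes Federer's $k$-th (Lipschitz-Killing) curvature measure of a set of positive reach. $C_k^{\mathrm{var}}(K_\varepsilon,\cdot)$ is the total variation measure of $C_k(K_\varepsilon,\cdot)$. Self-similar sets. $F$ is the unique nonempty compact set with $F=\bigcup_{i=1}^N S_iF$, where $S_1,\ldots,S_N:\mathbb{R}^d\to\mathbb{R}^d$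 are contracting similarities with ratios $r_i\in(0,1)$; write $\mathbf{S}(A):=\bigcup_{i=1}^N S_i(A)$. OSC: there is a nonempty bounded open set $O$ with $\bigcup_iS_iO\subseteq O$ and $S_iO\cap S_jO=\emptyset$ for $i\ne j$. SOSC: there is such an $O$ with additionally $O\cap F\neq\emptyset$ (in $\mathbb{R}^d$, OSC and SOSC are equivalent). RC: almost all $\varepsilon\in(0,\sqrt2\,\mathrm{diam}F)$ are regular for $F$. (There are no irregular values $\varepsilon\ge\sqrt2\,\mathrm{diam}F$.) Let $\mathcal{M}$ be the Lebesgue null set of irregular values of $F$. Words. $\Sigma^*:=\bigcup_{j\ge0}\{1,\ldots,N\}^j$; for $\omega=\omega_1\cdots\omega_n\in\Sigma^*$, $|\omega|=n$, $\omega|m=\omega_1\cdots\omega_m$ for $m\le n$, $r_\omega=r_{\omega_1}\cdots r_{\omega_n}$, $S_\omega=S_{\omega_1}\circ\cdots\circ S_{\omega_n}$ (with $r_\emptyset=1$). Fix a constant $R>\sqrt2\,\mathrm{diam}F$ and an open set $O$ as in SOSC (both otherwise arbitrary). For $0<\varepsilon\le R$ let $\Sigma(\varepsilon)$ be the set of all words $\omega\in\Sigma^*$ (of length at least $1$) with $Rr_\omega<\varepsilon\le Rr_{\omega|(|\omega|-1)}$, and $\Sigma_b(\varepsilon):=\{\omega\in\Sigma(\varepsilon):(S_\omega F)_\varepsilon\cap((\mathbf{S}O)^c)_\varepsilon\ne\emptyset\}$, where $(\mathbf{S}O)^c$ is the complement of $\mathbf{S}O$. CBC (for the index $k$): there is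 a constant $c_k$ such that for almost all $\varepsilon\in(0,R)$ and all $\sigma\in\Sigma_b(\varepsilon)$ $$C_k^{\mathrm{var}}\Big(F_\varepsilon,\ \partial(S_\sigma F)_\varepsilon\cap\partial\bigcup_{\sigma'\in\Sigma(\varepsilon)\setminus\{\sigma\}}(S_{\sigma'}F)_\varepsilon\Big)\le c_k\varepsilon^k.$$ Convention: "null set" means Lebesgue null subset of $(0,R)$, and an exceptional null set $\mathcal{N}$ is always assumed to satisfy $\mathcal{M}\subseteq\mathcal{N}$ (so that all the curvature measures of $F_\varepsilon$ are defined for $\varepsilon\notin\mathcal{N}$) and $r_\sigma\mathcal{N}\subset\mathcal{N}$ for all $\sigma\in\Sigma^*$. *)

theory Defs
  imports "HOL-Analysis.Analysis"
begin

section \<open>Parallel sets and regular distances\<close>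

text \<open>The guard is needed because \<^term>\<open>infdist x {} = 0\<close>, whereas the distance to the empty
  set should be infinite.\<close>

definition parallel_set :: "'a::metric_space set \<Rightarrow> real \<Rightarrow> 'a set" where
  "parallel_set K \<epsilon> = {x. K \<noteq> {} \<and> infdist x K \<le> \<epsilon>}"

definition closed_complement :: "'a::topological_space set \<Rightarrow> 'a set" where
  "closed_complement K = closure (- K)"

text \<open>Federer's sets of positive reach: \<open>unp A\<close> is the set of points with a unique nearest
  point in \<open>A\<close>.\<close>

definition unp :: "'a::metric_space set \<Rightarrow> 'a set" where
  "unp A = {x. \<exists>!a. a \<in> A \<and> dist x a = infdist x A}"

definition reach_at :: "'a::metric_space set \<Rightarrow> 'a \<Rightarrow> ereal" where
  "reach_at A a = (SUP s\<in>{s::real. ball a s \<subseteq> unp A}. ereal s)"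

definition reach :: "'a::metric_space set \<Rightarrow> ereal" where
  "reach A = (INF a\<in>A. reach_at A a)"

text \<open>An \<open>m\<close>-dimensional Lipschitz manifold: every point has a relatively open neighbourhood
  that is bi-Lipschitz homeomorphic to an open subset of an \<open>m\<close>-dimensional linear space. The
  model space \<open>H\<close> is taken to be a subspace of the ambient space in order to have
  dimension \<open>DIM('a) - 1\<close> available.\<close>

definition lipschitz_manifold :: "nat \<Rightarrow> 'a::euclidean_space set \<Rightarrow> bool" where
  "lipschitz_manifold m M \<longleftrightarrow>
     (\<forall>x\<in>M. \<exists>(U::'a set) (V::'a set) (H::'a set) f g L L'.
        openin (top_of_set M) U \<and> x \<in> U \<and>
        subspace H \<and> dim H = m \<and> openin (top_of_set H) V \<and>
        homeomorphism U V f g \<and> L-lipschitz_on U f \<and> L'-lipschitz_on V g)"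

definition regular_distance :: "'a::euclidean_space set \<Rightarrow> real \<Rightarrow> bool" where
  "regular_distance K \<epsilon> \<longleftrightarrow>
     0 \<le> \<epsilon> \<and> 0 < reach (closed_complement (parallel_set K \<epsilon>)) \<and>
     lipschitz_manifold (DIM('a) - 1) (frontier (parallel_set K \<epsilon>))"

text \<open>The value \<open>0\<close> is excluded: exceptional sets are subsets of an interval \<open>(0,R)\<close>.\<close>

definition irregular_values :: "'a::euclidean_space set \<Rightarrow> real set" where
  "irregular_values K = {\<epsilon>. 0 < \<epsilon> \<and> \<not> regular_distance K \<epsilon>}"


section \<open>Curvature measures\<close>

text \<open>\<open>steiner_coeffs X B \<phi>\<close>: the local Steiner formula for \<open>X\<close> and \<open>B\<close> holds with the
  coefficients \<open>\<phi>\<close>. For radii below the reach of the closed set \<open>X\<close>, \<^const>\<open>closest_point\<close> is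
  Federer's metric projection onto \<open>X\<close>.\<close>

definition steiner_coeffs :: "'a::euclidean_space set \<Rightarrow> 'a set \<Rightarrow> (nat \<Rightarrow> real) \<Rightarrow> bool" where
  "steiner_coeffs X B \<phi> \<longleftrightarrow>
     (\<forall>s. 0 \<le> s \<and> ereal s < reach X \<longrightarrow>
        measure lebesgue {x. infdist x X \<le> s \<and> closest_point X x \<in> B} =
        (\<Sum>i\<le>DIM('a). s ^ (DIM('a) - i) * unit_ball_vol (real (DIM('a) - i)) * \<phi> i))"

text \<open>Federer's curvature measures of a set of positive reach, evaluated on bounded Borel sets
  \<open>B\<close>: the coefficients in the local Steiner formula. For \<open>k \<le> DIM('a)\<close> the \<open>k\<close>-th coefficient
  is unique, a polynomial being determined by its values on an interval.\<close>

definition federer_curvature :: "nat \<Rightarrow> 'a::euclidean_space set \<Rightarrow> 'a set \<Rightarrow> real" where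
  "federer_curvature k X B = (THE c. \<exists>\<phi>. steiner_coeffs X B \<phi> \<and> \<phi> k = c)"

text \<open>The signed measure \<open>C\<^sub>k(K\<^sub>\<epsilon>, \<cdot>)\<close> for regular \<open>\<epsilon>\<close> and \<open>k \<le> d - 1\<close>.\<close>

definition parallel_curvature ::
    "nat \<Rightarrow> 'a::euclidean_space set \<Rightarrow> real \<Rightarrow> 'a set \<Rightarrow> real" where
  "parallel_curvature k K \<epsilon> B =
     (-1) ^ (DIM('a) - 1 - k) * federer_curvature k (closed_complement (parallel_set K \<epsilon>)) B"

definition total_variation :: "('a::topological_space set \<Rightarrow> real) \<Rightarrow> 'a set \<Rightarrow> ennreal" where
  "total_variation \<mu> A =
     (SUP E\<in>{E :: nat \<Rightarrow> 'a set. range E \<subseteq> sets borel \<and> disjoint_family E \<and> (\<Union>n. E n) = A}.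
        \<Sum>n. ennreal \<bar>\<mu> (E n)\<bar>)"

definition parallel_curvature_var ::
    "nat \<Rightarrow> 'a::euclidean_space set \<Rightarrow> real \<Rightarrow> 'a set \<Rightarrow> ennreal" where
  "parallel_curvature_var k K \<epsilon> = total_variation (parallel_curvature k K \<epsilon>)"


section \<open>Self-similar sets\<close>

definition similarities :: "nat \<Rightarrow> (nat \<Rightarrow> 'a::metric_space \<Rightarrow> 'a) \<Rightarrow> (nat \<Rightarrow> real) \<Rightarrow> bool" where
  "similarities N S r \<longleftrightarrow>
     (\<forall>i\<in>{1..N}. 0 < r i \<and> r i < 1 \<and> (\<forall>x y. dist (S i x) (S i y) = r i * dist x y))"

definition hutchinson :: "nat \<Rightarrow> (nat \<Rightarrow> 'a \<Rightarrow> 'a) \<Rightarrow> 'a set \<Rightarrow> 'a set" where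
  "hutchinson N S A = (\<Union>i\<in>{1..N}. S i ` A)"

definition self_similar_set ::
    "nat \<Rightarrow> (nat \<Rightarrow> 'a::metric_space \<Rightarrow> 'a) \<Rightarrow> (nat \<Rightarrow> real) \<Rightarrow> 'a set \<Rightarrow> bool" where
  "self_similar_set N S r F \<longleftrightarrow>
     similarities N S r \<and> F \<noteq> {} \<and> compact F \<and> F = hutchinson N S F"

definition osc_set :: "nat \<Rightarrow> (nat \<Rightarrow> 'a::metric_space \<Rightarrow> 'a) \<Rightarrow> 'a set \<Rightarrow> bool" where
  "osc_set N S U \<longleftrightarrow>
     U \<noteq> {} \<and> bounded U \<and> open U \<and> hutchinson N S U \<subseteq> U \<and>
     (\<forall>i\<in>{1..N}. \<forall>j\<in>{1..N}. i \<noteq> j \<longrightarrow> S i ` U \<inter> S j ` U = {})"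

definition OSC :: "nat \<Rightarrow> (nat \<Rightarrow> 'a::metric_space \<Rightarrow> 'a) \<Rightarrow> bool" where
  "OSC N S \<longleftrightarrow> (\<exists>U. osc_set N S U)"

definition sosc_set :: "nat \<Rightarrow> (nat \<Rightarrow> 'a::metric_space \<Rightarrow> 'a) \<Rightarrow> 'a set \<Rightarrow> 'a set \<Rightarrow> bool" where
  "sosc_set N S F U \<longleftrightarrow> osc_set N S U \<and> U \<inter> F \<noteq> {}"

definition RC :: "'a::euclidean_space set \<Rightarrow> bool" where
  "RC F \<longleftrightarrow> (AE \<epsilon> in lebesgue. \<epsilon> \<in> {0<..<sqrt 2 * diameter F} \<longrightarrow> regular_distance F \<epsilon>)"


section \<open>Words\<close>

definition words :: "nat \<Rightarrow> nat list set" where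
  "words N = {\<omega>. set \<omega> \<subseteq> {1..N}}"

definition word_ratio :: "(nat \<Rightarrow> real) \<Rightarrow> nat list \<Rightarrow> real" where
  "word_ratio r \<omega> = prod_list (map r \<omega>)"

definition word_map :: "(nat \<Rightarrow> 'a \<Rightarrow> 'a) \<Rightarrow> nat list \<Rightarrow> 'a \<Rightarrow> 'a" where
  "word_map S \<omega> = foldr (\<lambda>i f. S i \<circ> f) \<omega> id"

definition scale_words :: "nat \<Rightarrow> (nat \<Rightarrow> real) \<Rightarrow> real \<Rightarrow> real \<Rightarrow> nat list set" where
  "scale_words N r R \<epsilon> =
     {\<omega> \<in> words N. \<omega> \<noteq> [] \<and> R * word_ratio r \<omega> < \<epsilon> \<and> \<epsilon> \<le> R * word_ratio r (butlast \<omega>)}"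

definition boundary_words ::
    "nat \<Rightarrow> (nat \<Rightarrow> 'a::metric_space \<Rightarrow> 'a) \<Rightarrow> (nat \<Rightarrow> real) \<Rightarrow> 'a set \<Rightarrow> 'a set \<Rightarrow> real \<Rightarrow> real
      \<Rightarrow> nat list set" where
  "boundary_words N S r F U R \<epsilon> =
     {\<omega> \<in> scale_words N r R \<epsilon>.
        parallel_set (word_map S \<omega> ` F) \<epsilon> \<inter> parallel_set (- hutchinson N S U) \<epsilon> \<noteq> {}}"


section \<open>The curvature bound conditions\<close>

definition exceptional_set ::
    "nat \<Rightarrow> (nat \<Rightarrow> real) \<Rightarrow> 'a::euclidean_space set \<Rightarrow> real \<Rightarrow> real set \<Rightarrow> bool" where
  "exceptional_set N r F R Null \<longleftrightarrow>
     Null \<subseteq> {0<..<R} \<and> Null \<in> null_sets lebesgue \<and> irregular_values F \<subseteq> Null \<and>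
     (\<forall>\<sigma>\<in>words N. (\<lambda>\<epsilon>. word_ratio r \<sigma> * \<epsilon>) ` Null \<subseteq> Null)"

definition CBC ::
    "nat \<Rightarrow> nat \<Rightarrow> (nat \<Rightarrow> 'a::euclidean_space \<Rightarrow> 'a) \<Rightarrow> (nat \<Rightarrow> real) \<Rightarrow> 'a set \<Rightarrow> 'a set \<Rightarrow> real
      \<Rightarrow> bool" where
  "CBC k N S r F U R \<longleftrightarrow>
     (\<exists>c::real. AE \<epsilon> in lebesgue. \<epsilon> \<in> {0<..<R} \<longrightarrow>
        (\<forall>\<sigma>\<in>boundary_words N S r F U R \<epsilon>.
           parallel_curvature_var k F \<epsilon>
             (frontier (parallel_set (word_map S \<sigma> ` F) \<epsilon>) \<inter>
              frontier (\<Union>\<sigma>'\<in>scale_words N r R \<epsilon> - {\<sigma>}. parallel_set (word_map S \<sigma>' ` F) \<epsilon>))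
           \<le> ennreal (c * \<epsilon> ^ k)))"

definition SCBC ::
    "nat \<Rightarrow> nat \<Rightarrow> (nat \<Rightarrow> 'a::euclidean_space \<Rightarrow> 'a) \<Rightarrow> (nat \<Rightarrow> real) \<Rightarrow> 'a set \<Rightarrow> real
      \<Rightarrow> bool" where
  "SCBC k N S r F R \<longleftrightarrow>
     (\<exists>(c::real) Null. exceptional_set N r F R Null \<and>
        (\<forall>\<epsilon>\<in>{0<..<R} - Null. \<forall>i\<in>{1..N}. \<forall>j\<in>{1..N}. i \<noteq> j \<longrightarrow>
           parallel_curvature_var k F \<epsilon>
             (parallel_set (S i ` F) \<epsilon> \<inter> parallel_set (S j ` F) \<epsilon>)
           \<le> ennreal (c * \<epsilon> ^ k)))"

end

theory Submission
  imports Defs "HOL-Computational_Algebra.Polynomial" "HOL-Library.Sublist"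
begin

text \<open>Two facts about the curvature measures carry the proof: they are countably additive and local, and
  they scale under similarities. Both rest on the local Steiner formula, that is, on Federer's theorem that
  the volume of \<open>{x. infdist x X \<le> s \<and> \<xi> x \<in> B}\<close> is a polynomial in \<open>s\<close> below the reach of \<open>X\<close>, where \<open>\<xi>\<close> is
  the metric projection. The homotheties \<open>T\<^sub>l = l id + (1 - l) \<xi>\<close> shrink such a tube to the tube of
  radius \<open>l s\<close>, and where \<open>\<xi>\<close> is smooth the volume of the image is the integral of \<open>det (l I + (1 - l) D\<xi>)\<close>,
  a polynomial in \<open>l\<close>. Since \<open>\<xi>\<close> is only Lipschitz, it is approximated by the smooth monotone maps sending
  \<open>x\<close> to a Gaussian average of finitely many points of \<open>X\<close>.

  For the theorem itself, group the points \<open>x\<close> of the boundary set by the collection \<open>T\<close> of words of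
  \<open>\<Sigma>(\<epsilon>)\<close> whose parallel cells contain \<open>x\<close>. By the open set condition the number of groups is bounded
  independently of \<open>\<epsilon>\<close>. If \<open>\<omega>\<close> is the longest common prefix of \<open>T\<close>, then near \<open>x\<close> the sets \<open>F\<^sub>\<epsilon>\<close> and
  \<open>(S\<^sub>\<omega> F)\<^sub>\<epsilon>\<close> coincide, and \<open>x\<close> lies in the parallel sets of two different cells \<open>S\<^sub>\<omega> S\<^sub>i F\<close> and \<open>S\<^sub>\<omega> S\<^sub>j F\<close>;
  scaling back by \<open>S\<^sub>\<omega>\<close>, the hypothesis at distance \<open>\<epsilon> / r\<^sub>\<omega>\<close> bounds the curvature of the group.\<close>

section \<open>Polynomials and interpolation\<close>

text \<open>\<open>federer_curvature\<close> is a definite description, so its value is out of reach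
  until Steiner coefficients are known to exist and to be unique. What makes the approximation of
  the projection work is monotonicity: it keeps the maps T_l injective and their Jacobians positive,
  and it is shared by the projection and the Gaussian averages. Polynomiality is expressed by
  interpolation at finitely many nodes, because such identities pass to pointwise limits, series and
  integrals. They also exhibit a curvature as a fixed linear combination of tube volumes, from which
  additivity and locality are read off.

  In the geometric part the scaled distance must be admissible in the hypothesis. The null set is
  stable under multiplication by the ratios, so the scaled distance avoids it whenever \<epsilon>
  does; the countably many \<epsilon> for which some scaled distance would be R itself are discarded
  as well. There are at most \<open>2 ^ M\<close> groups, with \<open>M\<close> from a volume
  comparison of disjoint balls, and \<open>2 ^ M\<close> is the factor by which the constant
  grows.\<close>

definition lagrange_basis :: "(nat \<Rightarrow> real) \<Rightarrow> nat \<Rightarrow> nat \<Rightarrow> real poly" where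
  "lagrange_basis t n j = (\<Prod>i\<in>{..n} - {j}. smult (1 / (t j - t i)) [:- t i, 1:])"

lemma degree_lagrange_basis: "j \<le> n \<Longrightarrow> degree (lagrange_basis t n j) \<le> n"
proof -
  assume j: "j \<le> n"
  have "degree (lagrange_basis t n j) \<le> (\<Sum>i\<in>{..n} - {j}. degree (smult (1 / (t j - t i)) [:- t i, 1:]))"
    unfolding lagrange_basis_def by (rule degree_prod_sum_le[unfolded o_def]) simp
  also have "\<dots> \<le> (\<Sum>i\<in>{..n} - {j}. 1)"
    by (intro sum_mono) simp
  also have "\<dots> = n"
    using j by simp
  finally show ?thesis .
qed

lemma poly_lagrange_basis:
  assumes "inj_on t {..n}" "i \<le> n" "j \<le> n"
  shows "poly (lagrange_basis t n j) (t i) = of_bool (i = j)"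
proof (cases "i = j")
  case True
  have "poly (lagrange_basis t n j) (t j) = (\<Prod>l\<in>{..n} - {j}. 1)"
    unfolding lagrange_basis_def poly_prod
    using assms by (intro prod.cong refl) (auto simp: inj_on_eq_iff diff_divide_distrib[symmetric])
  then show ?thesis
    using True by simp
next
  case False
  then have "\<exists>l\<in>{..n} - {j}. poly (smult (1 / (t j - t l)) [:- t l, 1:]) (t i) = 0"
    using assms by (intro bexI[of _ i]) auto
  then show ?thesis
    using False unfolding lagrange_basis_def poly_prod by (simp add: prod_zero_iff)
qed

lemma lagrange_interpolation:
  assumes "degree p \<le> n" "inj_on t {..n}"
  shows "p = (\<Sum>j\<le>n. smult (poly p (t j)) (lagrange_basis t n j))"
proof (rule poly_eqI_degree)
  show "poly p x = poly (\<Sum>j\<le>n. smult (poly p (t j)) (lagrange_basis t n j)) x" if "x \<in> t ` {..n}" for x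
  proof -
    obtain i where "i \<le> n" "x = t i"
      using \<open>x \<in> t ` {..n}\<close> by auto
    then have "poly (\<Sum>j\<le>n. smult (poly p (t j)) (lagrange_basis t n j)) x =
        (\<Sum>j\<le>n. poly p (t j) * of_bool (i = j))"
      using assms(2) by (simp add: poly_sum poly_lagrange_basis)
    also have "\<dots> = poly p x"
      using \<open>i \<le> n\<close> \<open>x = t i\<close> by (simp add: of_bool_def if_distrib cong: if_cong)
    finally show ?thesis
      by simp
  qed
  show "degree p < card (t ` {..n})"
    using assms by (simp add: card_image)
  have "degree (\<Sum>j\<le>n. smult (poly p (t j)) (lagrange_basis t n j)) \<le> n"
    by (intro degree_sum_le) (auto intro!: order_trans[OF degree_smult_le] degree_lagrange_basis)
  then show "degree (\<Sum>j\<le>n. smult (poly p (t j)) (lagrange_basis t n j)) < card (t ` {..n})"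
    using assms by (simp add: card_image)
qed

definition polynomial_on :: "nat \<Rightarrow> real set \<Rightarrow> (real \<Rightarrow> real) \<Rightarrow> bool" where
  "polynomial_on n I f \<longleftrightarrow> (\<exists>p. degree p \<le> n \<and> (\<forall>x\<in>I. f x = poly p x))"

text \<open>Once the nodes are fixed, belonging to the class is a family of identities linear in the
  values of \<open>f\<close>. Pointwise limits, series and integrals preserve such identities
  without any uniformity in the argument.\<close>

lemma polynomial_on_iff_interpolation:
  assumes "inj_on t {..n}" "t ` {..n} \<subseteq> I"
  shows "polynomial_on n I f \<longleftrightarrow> (\<forall>x\<in>I. f x = (\<Sum>j\<le>n. f (t j) * poly (lagrange_basis t n j) x))"
    (is "_ \<longleftrightarrow> ?R")
proof
  assume "polynomial_on n I f"
  then obtain p where p: "degree p \<le> n" "\<And>x. x \<in> I \<Longrightarrow> f x = poly p x"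
    by (auto simp: polynomial_on_def)
  show ?R
  proof
    fix x assume "x \<in> I"
    have "poly p x = poly (\<Sum>j\<le>n. smult (poly p (t j)) (lagrange_basis t n j)) x"
      using lagrange_interpolation[OF p(1) assms(1)] by (rule arg_cong)
    also have "\<dots> = (\<Sum>j\<le>n. poly p (t j) * poly (lagrange_basis t n j) x)"
      by (simp add: poly_sum)
    finally have "poly p x = (\<Sum>j\<le>n. poly p (t j) * poly (lagrange_basis t n j) x)" .
    then show "f x = (\<Sum>j\<le>n. f (t j) * poly (lagrange_basis t n j) x)"
      using p(2) assms(2) \<open>x \<in> I\<close> by (simp add: image_subset_iff)
  qed
next
  assume ?R
  moreover have "degree (\<Sum>j\<le>n. smult (f (t j)) (lagrange_basis t n j)) \<le> n"
    by (intro degree_sum_le) (auto intro!: order_trans[OF degree_smult_le] degree_lagrange_basis)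
  ultimately show "polynomial_on n I f"
    unfolding polynomial_on_def
    by (intro exI[of _ "\<Sum>j\<le>n. smult (f (t j)) (lagrange_basis t n j)"]) (simp add: poly_sum)
qed

lemma infinite_obtain_nodes:
  assumes "infinite (I :: real set)"
  obtains t :: "nat \<Rightarrow> real" where "inj_on t {..n}" "t ` {..n} \<subseteq> I"
proof -
  obtain t :: "nat \<Rightarrow> real" where "inj t" "range t \<subseteq> I"
    using infinite_countable_subset[OF assms] by blast
  then show ?thesis
    using that[of t] by (auto intro: inj_on_subset)
qed

lemma polynomial_on_cong:
  "(\<And>x. x \<in> I \<Longrightarrow> f x = g x) \<Longrightarrow> polynomial_on n I f \<longleftrightarrow> polynomial_on n I g"
  by (simp add: polynomial_on_def)

lemma polynomial_on_add:
  "polynomial_on n I f \<Longrightarrow> polynomial_on n I g \<Longrightarrow> polynomial_on n I (\<lambda>x. f x + g x)"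
  unfolding polynomial_on_def
proof (elim exE conjE)
  fix p q :: "real poly"
  assume "degree p \<le> n" "\<forall>x\<in>I. f x = poly p x" "degree q \<le> n" "\<forall>x\<in>I. g x = poly q x"
  then show "\<exists>p. degree p \<le> n \<and> (\<forall>x\<in>I. f x + g x = poly p x)"
    by (intro exI[of _ "p + q"]) (simp add: degree_add_le)
qed

lemma polynomial_on_cmult: "polynomial_on n I f \<Longrightarrow> polynomial_on n I (\<lambda>x. c * f x)"
  unfolding polynomial_on_def
proof (elim exE conjE)
  fix p :: "real poly"
  assume "degree p \<le> n" "\<forall>x\<in>I. f x = poly p x"
  then show "\<exists>p. degree p \<le> n \<and> (\<forall>x\<in>I. c * f x = poly p x)"
    by (intro exI[of _ "smult c p"]) (auto intro: order_trans[OF degree_smult_le])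
qed

lemma polynomial_on_diff:
  assumes "polynomial_on n I f" "polynomial_on n I g"
  shows "polynomial_on n I (\<lambda>x. f x - g x)"
  using polynomial_on_add[OF assms(1) polynomial_on_cmult[OF assms(2), of "- 1"]] by simp

lemma polynomial_on_const: "polynomial_on n I (\<lambda>x. c)"
  unfolding polynomial_on_def by (intro exI[of _ "[:c:]"]) simp

lemma polynomial_on_sum:
  "finite J \<Longrightarrow> (\<And>j. j \<in> J \<Longrightarrow> polynomial_on n I (f j)) \<Longrightarrow> polynomial_on n I (\<lambda>x. \<Sum>j\<in>J. f j x)"
  by (induction rule: finite_induct) (auto intro: polynomial_on_add polynomial_on_const)

lemma polynomial_on_limit:
  assumes "infinite I" and f: "\<And>m. polynomial_on n I (f m)"
    and lim: "\<And>x. x \<in> I \<Longrightarrow> (\<lambda>m::nat. f m x) \<longlonglongrightarrow> g x"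
  shows "polynomial_on n I g"
proof -
  obtain t where t: "inj_on t {..n}" "t ` {..n} \<subseteq> I"
    using infinite_obtain_nodes[OF assms(1)] .
  show ?thesis
    unfolding polynomial_on_iff_interpolation[OF t]
  proof
    fix x assume x: "x \<in> I"
    have "(\<lambda>m. \<Sum>j\<le>n. f m (t j) * poly (lagrange_basis t n j) x) \<longlonglongrightarrow>
        (\<Sum>j\<le>n. g (t j) * poly (lagrange_basis t n j) x)"
      using t(2) by (intro tendsto_sum tendsto_mult lim tendsto_const) auto
    moreover have "(\<Sum>j\<le>n. f m (t j) * poly (lagrange_basis t n j) x) = f m x" for m
      using f[of m] x unfolding polynomial_on_iff_interpolation[OF t] by simp
    ultimately show "g x = (\<Sum>j\<le>n. g (t j) * poly (lagrange_basis t n j) x)"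
      using LIMSEQ_unique[OF lim[OF x]] by simp
  qed
qed

lemma polynomial_on_sums:
  assumes "infinite I" "\<And>m. polynomial_on n I (f m)" "\<And>x. x \<in> I \<Longrightarrow> (\<lambda>m. f m x) sums g x"
  shows "polynomial_on n I g"
proof (rule polynomial_on_limit[OF assms(1)])
  show "polynomial_on n I (\<lambda>x. \<Sum>i<m. f i x)" for m
    by (intro polynomial_on_sum assms(2)) simp
  show "(\<lambda>m. \<Sum>i<m. f i x) \<longlonglongrightarrow> g x" if "x \<in> I" for x
    using assms(3)[OF that] by (simp add: sums_def)
qed

lemma polynomial_on_integral:
  fixes f :: "real \<Rightarrow> 'b::euclidean_space \<Rightarrow> real"
  assumes "infinite I" and f: "\<And>x. x \<in> A \<Longrightarrow> polynomial_on n I (\<lambda>l. f l x)"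
    and int: "\<And>l. l \<in> I \<Longrightarrow> f l integrable_on A"
  shows "polynomial_on n I (\<lambda>l. integral A (f l))"
proof -
  obtain t where t: "inj_on t {..n}" "t ` {..n} \<subseteq> I"
    using infinite_obtain_nodes[OF assms(1)] .
  show ?thesis
    unfolding polynomial_on_iff_interpolation[OF t]
  proof
    fix l assume l: "l \<in> I"
    have "integral A (f l) = integral A (\<lambda>x. \<Sum>j\<le>n. f (t j) x * poly (lagrange_basis t n j) l)"
      using f l unfolding polynomial_on_iff_interpolation[OF t]
      by (intro Henstock_Kurzweil_Integration.integral_cong) blast
    also have "\<dots> = (\<Sum>j\<le>n. integral A (\<lambda>x. f (t j) x * poly (lagrange_basis t n j) l))"
      using t(2) by (intro integral_sum integrable_on_mult_left int) auto
    finally show "integral A (f l) = (\<Sum>j\<le>n. integral A (f (t j)) * poly (lagrange_basis t n j) l)"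
      by simp
  qed
qed

lemma polynomial_on_prod_linear:
  assumes "finite J"
  shows "polynomial_on (card J) I (\<lambda>l. \<Prod>j\<in>J. a j + l * b j)"
proof -
  have "degree (\<Prod>j\<in>J. [:a j, b j:]) \<le> (\<Sum>j\<in>J. degree [:a j, b j:])"
    using degree_prod_sum_le[OF assms, of "\<lambda>j. [:a j, b j:]"] by (simp add: o_def)
  also have "\<dots> \<le> (\<Sum>j\<in>J. 1)"
    by (intro sum_mono) simp
  finally show ?thesis
    unfolding polynomial_on_def by (intro exI[of _ "\<Prod>j\<in>J. [:a j, b j:]"]) (simp add: poly_prod)
qed

lemma polynomial_on_det:
  fixes M :: "real^'n^'n"
  shows "polynomial_on CARD('n) I (\<lambda>l. det (l *\<^sub>R mat 1 + (1 - l) *\<^sub>R M))"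
proof -
  \<comment> \<open>The entries are affine in \<open>l\<close>, so each product in the Leibniz
    formula has degree at most \<open>CARD('n)\<close>.\<close>
  have "(\<Prod>i\<in>UNIV. (l *\<^sub>R mat 1 + (1 - l) *\<^sub>R M) $ i $ p i) =
      (\<Prod>i\<in>UNIV. M $ i $ p i + l * ((mat 1 :: real^'n^'n) $ i $ p i - M $ i $ p i))" for l p
    by (intro prod.cong refl) (simp add: algebra_simps)
  then show ?thesis
    unfolding det_def
    by (simp only:) (intro polynomial_on_sum polynomial_on_cmult polynomial_on_prod_linear finite_permutations finite)
qed

lemma polynomial_on_unique:
  assumes "infinite I" "\<And>x. x \<in> I \<Longrightarrow> poly p x = poly q x"
  shows "p = (q :: real poly)"
proof (rule ccontr)
  assume "p \<noteq> q"
  then have "finite {x. poly (p - q) x = 0}"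
    by (intro poly_roots_finite) simp
  moreover have "I \<subseteq> {x. poly (p - q) x = 0}"
    using assms(2) by auto
  ultimately show False
    using assms(1) finite_subset by blast
qed

section \<open>Coordinates\<close>

text \<open>The library's change of variables theorem is about \<open>real^'n\<close> with a finite, well-ordered index type;
  this one has cardinality \<open>DIM('a)\<close>.\<close>

typedef (overloaded) ('a::euclidean_space) basis_index = "{..<DIM('a)}"
  by (rule exI[of _ 0]) simp

instantiation basis_index :: (euclidean_space) wellorder
begin

definition less_eq_basis_index :: "'a basis_index \<Rightarrow> 'a basis_index \<Rightarrow> bool" where
  "less_eq_basis_index i j \<longleftrightarrow> Rep_basis_index i \<le> Rep_basis_index j"

definition less_basis_index :: "'a basis_index \<Rightarrow> 'a basis_index \<Rightarrow> bool" where
  "less_basis_index i j \<longleftrightarrow> Rep_basis_index i < Rep_basis_index j"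

instance
proof
  fix P :: "'a basis_index \<Rightarrow> bool" and i
  assume *: "\<And>i. (\<And>j. j < i \<Longrightarrow> P j) \<Longrightarrow> P i"
  show "P i"
  proof (induction "Rep_basis_index i" arbitrary: i rule: less_induct)
    case less
    show ?case
      by (rule *) (rule less, simp add: less_basis_index_def)
  qed
qed (auto simp: less_eq_basis_index_def less_basis_index_def Rep_basis_index_inject)

end

lemma bij_betw_Rep_basis_index:
  "bij_betw (Rep_basis_index :: 'a::euclidean_space basis_index \<Rightarrow> nat) UNIV {..<DIM('a)}"
  using type_definition.Rep_range[OF type_definition_basis_index]
    type_definition.Rep_inject[OF type_definition_basis_index]
  by (auto simp: bij_betw_def inj_on_def)

instance basis_index :: (euclidean_space) finite
  by standard (use bij_betw_finite[OF bij_betw_Rep_basis_index] in simp)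

lemma CARD_basis_index: "CARD('a::euclidean_space basis_index) = DIM('a)"
  using bij_betw_same_card[OF bij_betw_Rep_basis_index[where 'a = 'a]] by simp

definition coord_basis :: "'a::euclidean_space basis_index \<Rightarrow> 'a" where
  "coord_basis = (SOME e. bij_betw e UNIV Basis)"

lemma bij_betw_coord_basis: "bij_betw coord_basis UNIV (Basis :: 'a::euclidean_space set)"
proof -
  have "\<exists>e. bij_betw e (UNIV :: 'a basis_index set) (Basis :: 'a set)"
    by (rule finite_same_card_bij) (simp_all add: CARD_basis_index)
  then show ?thesis
    unfolding coord_basis_def by (rule someI_ex)
qed

definition coord :: "'a::euclidean_space \<Rightarrow> real^'a basis_index" where
  "coord x = (\<chi> i. x \<bullet> coord_basis i)"

definition from_coord :: "real^'a basis_index \<Rightarrow> 'a::euclidean_space" where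
  "from_coord v = (\<Sum>i\<in>UNIV. v $ i *\<^sub>R coord_basis i)"

lemma linear_coord: "linear coord"
  by (rule linearI) (simp_all add: coord_def vec_eq_iff inner_add_left)

lemma linear_from_coord: "linear from_coord"
  by (rule linearI) (simp_all add: from_coord_def scaleR_add_left sum.distrib scaleR_sum_right)

lemma from_coord_coord [simp]: "from_coord (coord x) = x"
proof -
  have "from_coord (coord x) = (\<Sum>b\<in>Basis. (x \<bullet> b) *\<^sub>R b)"
    unfolding from_coord_def coord_def
    using sum.reindex_bij_betw[OF bij_betw_coord_basis, of "\<lambda>b. (x \<bullet> b) *\<^sub>R b"] by simp
  then show ?thesis
    by (simp add: euclidean_representation)
qed

lemma coord_inner [simp]: "coord x \<bullet> coord y = x \<bullet> y"
proof -
  have "coord x \<bullet> coord y = (\<Sum>b\<in>Basis. (x \<bullet> b) * (y \<bullet> b))"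
    unfolding coord_def inner_vec_def
    using sum.reindex_bij_betw[OF bij_betw_coord_basis, of "\<lambda>b. (x \<bullet> b) * (y \<bullet> b)"] by simp
  then show ?thesis
    by (simp add: euclidean_inner[of x y])
qed

lemma coord_from_coord [simp]: "coord (from_coord v) = v"
proof -
  have "coord_basis i \<bullet> coord_basis j = (if j = i then 1 else 0)" for i j :: "'a basis_index"
    using bij_betw_coord_basis[where 'a = 'a]
    by (auto simp: bij_betw_def inj_on_def inner_Basis image_subset_iff set_eq_subset)
  then have "(\<Sum>i\<in>UNIV. v $ i * (coord_basis i \<bullet> coord_basis j)) = (\<Sum>i\<in>UNIV. if j = i then v $ i else 0)" for j
    by (intro sum.cong) auto
  then show ?thesis
    by (simp add: coord_def from_coord_def vec_eq_iff inner_sum_left)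
qed

lemma from_coord_inner [simp]: "from_coord v \<bullet> from_coord w = v \<bullet> w"
  using coord_inner[of "from_coord v" "from_coord w"] by simp

lemma continuous_on_coord: "continuous_on A coord"
  using linear_coord by (intro linear_continuous_on) (simp add: linear_conv_bounded_linear)

lemma continuous_on_from_coord: "continuous_on A from_coord"
  using linear_from_coord by (intro linear_continuous_on) (simp add: linear_conv_bounded_linear)

lemma coord_image_eq_vimage: "coord ` A = from_coord -` A"
proof safe
  fix v assume "from_coord v \<in> A"
  then show "v \<in> coord ` A"
    by (intro image_eqI[of _ _ "from_coord v"]) simp_all
qed simp

text \<open>Boxes determine Lebesgue measure, and since \<open>coord_basis\<close> enumerates
  \<open>Basis\<close>, the preimage of a box is again a box with the same side lengths.\<close>

lemma distr_lborel_from_coord: "distr lborel borel from_coord = (lborel :: 'a::euclidean_space measure)"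
proof (rule lborel_eqI[symmetric])
  fix l u :: 'a
  assume lu: "\<And>b. b \<in> Basis \<Longrightarrow> l \<bullet> b \<le> u \<bullet> b"
  have meas: "(from_coord :: real^'a basis_index \<Rightarrow> 'a) \<in> borel_measurable lborel"
    using borel_measurable_continuous_onI[OF continuous_on_from_coord] by simp
  have range: "range coord_basis = (Basis :: 'a set)"
    using bij_betw_coord_basis by (auto simp: bij_betw_def)
  have ball_Basis: "(\<forall>b\<in>Basis. Q b) \<longleftrightarrow> (\<forall>i. Q (coord_basis i))" for Q :: "'a \<Rightarrow> bool"
    unfolding range[symmetric] by simp
  have fc: "from_coord v \<bullet> coord_basis i = v $ i" for v :: "real^'a basis_index" and i
  proof -
    have "coord (from_coord v) $ i = v $ i"
      by simp
    then show ?thesis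
      by (simp only: coord_def vec_lambda_beta)
  qed
  have eq: "from_coord -` box l u = box (coord l) (coord u)"
  proof -
    have "from_coord v \<in> box l u \<longleftrightarrow> v \<in> box (coord l) (coord u)" for v
      using ball_Basis[of "\<lambda>b. l \<bullet> b < from_coord v \<bullet> b \<and> from_coord v \<bullet> b < u \<bullet> b"]
      by (simp add: mem_box(1)[of "from_coord v"] mem_box_cart(1)[of v] fc) (simp add: coord_def)
    then show ?thesis
      by blast
  qed
  have "emeasure (distr lborel borel from_coord) (box l u) = emeasure lborel (box (coord l) (coord u))"
    using meas by (subst emeasure_distr) (simp_all add: eq)
  also have "\<dots> = (\<Prod>b\<in>Basis. (coord u - coord l) \<bullet> b)"
    using lu by (intro emeasure_lborel_box) (auto simp: Basis_vec_def inner_axis coord_def range[symmetric])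
  also have "(\<Prod>b\<in>Basis. (coord u - coord l) \<bullet> b) = (\<Prod>i\<in>UNIV. (coord u - coord l) $ i)"
    by (rule prod.reindex_cong[of "\<lambda>i. axis i 1"])
      (auto simp: Basis_vec_def inj_on_def axis_eq_axis inner_axis)
  also have "\<dots> = (\<Prod>b\<in>Basis. (u - l) \<bullet> b)"
    using prod.reindex_bij_betw[OF bij_betw_coord_basis, of "\<lambda>b. (u - l) \<bullet> b"]
    by (simp add: coord_def inner_diff_left)
  finally show "emeasure (distr lborel borel from_coord) (box l u) = ennreal (\<Prod>b\<in>Basis. (u - l) \<bullet> b)" .
qed simp

lemma borel_coord_image: "A \<in> sets borel \<Longrightarrow> coord ` A \<in> sets borel"
  unfolding coord_image_eq_vimage
  using measurable_sets[OF borel_measurable_continuous_onI[OF continuous_on_from_coord], of A] by simp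

lemma emeasure_coord_image:
  assumes "A \<in> sets borel"
  shows "emeasure lebesgue (coord ` A) = emeasure lebesgue A"
proof -
  have "emeasure (distr lborel borel from_coord) A = emeasure lborel (from_coord -` A)"
    using assms borel_measurable_continuous_onI[OF continuous_on_from_coord]
    by (subst emeasure_distr) auto
  then have "emeasure lborel A = emeasure lborel (from_coord -` A)"
    unfolding distr_lborel_from_coord .
  then show ?thesis
    using assms borel_coord_image[OF assms]
    by (simp add: coord_image_eq_vimage[symmetric] emeasure_completion)
qed

lemma measure_coord_image: "A \<in> sets borel \<Longrightarrow> measure lebesgue (coord ` A) = measure lebesgue A"
  by (simp add: measure_def emeasure_coord_image)

section \<open>Jacobians of monotone maps\<close>

text \<open>Monotone operators in the sense of Minty. The metric projection below the reach and its
  Gaussian approximations both have this property.\<close>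

definition monotone_map_on :: "'a::real_inner set \<Rightarrow> ('a \<Rightarrow> 'a) \<Rightarrow> bool" where
  "monotone_map_on A g \<longleftrightarrow> (\<forall>x\<in>A. \<forall>y\<in>A. 0 \<le> (g x - g y) \<bullet> (x - y))"

definition shrink :: "('a::real_vector \<Rightarrow> 'a) \<Rightarrow> real \<Rightarrow> 'a \<Rightarrow> 'a" where
  "shrink g l x = l *\<^sub>R x + (1 - l) *\<^sub>R g x"

text \<open>Pair the difference of the images with \<open>x - y\<close>: the identity part
  contributes \<open>l\<close> times the squared distance, the \<open>g\<close> part is nonnegative,
  and Cauchy-Schwarz does the rest.\<close>

lemma shrink_expands:
  assumes "monotone_map_on A g" "x \<in> A" "y \<in> A" "l \<in> {0<..1}"
  shows "l * norm (x - y) \<le> norm (shrink g l x - shrink g l y)"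
proof (cases "x = y")
  case False
  have eq: "shrink g l x - shrink g l y = l *\<^sub>R (x - y) + (1 - l) *\<^sub>R (g x - g y)"
    by (simp add: shrink_def algebra_simps)
  have "l * norm (x - y) * norm (x - y) = l * ((x - y) \<bullet> (x - y))"
    by (simp add: dot_square_norm power2_eq_square)
  also have "\<dots> \<le> l * ((x - y) \<bullet> (x - y)) + (1 - l) * ((g x - g y) \<bullet> (x - y))"
    using assms by (simp add: monotone_map_on_def)
  also have "\<dots> = (shrink g l x - shrink g l y) \<bullet> (x - y)"
    unfolding eq by (simp add: inner_add_left)
  also have "\<dots> \<le> norm (shrink g l x - shrink g l y) * norm (x - y)"
    by (rule norm_cauchy_schwarz)
  finally show ?thesis
    using False by simp
qed simp

lemma inj_on_shrink:
  assumes "monotone_map_on A g" "l \<in> {0<..1}"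
  shows "inj_on (shrink g l) A"
proof (rule inj_onI)
  fix x y assume "x \<in> A" "y \<in> A" "shrink g l x = shrink g l y"
  then have "l * norm (x - y) \<le> 0"
    using shrink_expands[OF assms(1), of x y l] assms(2) by simp
  then show "x = y"
    using assms(2) by (simp add: mult_le_0_iff)
qed

lemma continuous_on_shrink:
  fixes g :: "'a::real_normed_vector \<Rightarrow> 'a"
  shows "continuous_on A g \<Longrightarrow> continuous_on A (shrink g l)"
  unfolding shrink_def[abs_def] by (intro continuous_intros)

text \<open>The range is open by invariance of domain, and closed because the expansion estimate
  makes preimages of a convergent sequence Cauchy; connectedness concludes. Surjectivity will supply
  preimages under the approximating maps for points of a limit image.\<close>

lemma surj_shrink:
  fixes g :: "'a::euclidean_space \<Rightarrow> 'a"
  assumes g: "continuous_on UNIV g" "monotone_map_on UNIV g" and l: "l \<in> {0<..1}"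
  shows "surj (shrink g l)"
proof -
  have cont: "continuous_on UNIV (shrink g l)"
    by (rule continuous_on_shrink[OF g(1)])
  have "open (range (shrink g l))"
    by (intro invariance_of_domain cont inj_on_shrink[OF g(2) l]) simp
  moreover have "closed (range (shrink g l))"
    unfolding closed_sequential_limits
  proof (intro allI impI)
    fix f y assume "(\<forall>n. f n \<in> range (shrink g l)) \<and> f \<longlonglongrightarrow> y"
    then have f: "f \<longlonglongrightarrow> y" and "\<forall>n. \<exists>x. f n = shrink g l x"
      by auto
    then obtain x where x: "\<And>n. f n = shrink g l (x n)"
      by metis
    have "Cauchy x"
    proof (rule CauchyI)
      fix e :: real assume "0 < e"
      then obtain M where M: "\<And>m n. m \<ge> M \<Longrightarrow> n \<ge> M \<Longrightarrow> norm (f m - f n) < l * e"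
        using CauchyD[OF LIMSEQ_imp_Cauchy[OF f], of "l * e"] l by auto
      have "norm (x m - x n) < e" if "m \<ge> M" "n \<ge> M" for m n
      proof -
        have "l * norm (x m - x n) < l * e"
          using shrink_expands[OF g(2) UNIV_I UNIV_I l, of "x m" "x n"] M[OF that] x by simp
        then show ?thesis
          using l by simp
      qed
      then show "\<exists>M. \<forall>m\<ge>M. \<forall>n\<ge>M. norm (x m - x n) < e"
        by blast
    qed
    then obtain z where z: "x \<longlonglongrightarrow> z"
      using Cauchy_convergent_iff convergent_def by blast
    have "(\<lambda>n. shrink g l (x n)) \<longlonglongrightarrow> shrink g l z"
      using cont z by (intro isCont_tendsto_compose[of _ "shrink g l"]) (simp add: continuous_on_eq_continuous_at)
    then have "f \<longlonglongrightarrow> shrink g l z"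
      unfolding x[symmetric] .
    then have "shrink g l z = y"
      using f by (rule LIMSEQ_unique)
    then show "y \<in> range (shrink g l)"
      by blast
  qed
  ultimately show ?thesis
    using connected_clopen[of "UNIV :: 'a set"] by fastforce
qed

text \<open>\<open>M\<close> may fail to be symmetric, so the sign is found by continuity in
  \<open>l\<close>: a kernel vector would have to vanish by semidefiniteness, hence the determinant
  has no zero on \<open>{0<..1}\<close>, and at 1 its value is 1.\<close>

lemma det_pos_of_psd:
  fixes M :: "real^'n^'n"
  assumes psd: "\<And>v. 0 \<le> (M *v v) \<bullet> v" and l: "l \<in> {0<..1}"
  shows "0 < det (l *\<^sub>R mat 1 + (1 - l) *\<^sub>R M)"
proof -
  let ?A = "\<lambda>l. l *\<^sub>R mat 1 + (1 - l) *\<^sub>R M"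
  have nz: "det (?A t) \<noteq> 0" if t: "t \<in> {0<..1}" for t
  proof -
    have "v = 0" if "?A t *v v = 0" for v
    proof -
      have "?A t *v v = t *\<^sub>R v + (1 - t) *\<^sub>R (M *v v)"
        by (simp add: matrix_vector_mult_add_rdistrib scaleR_matrix_vector_assoc[symmetric])
      then have "0 = (t *\<^sub>R v + (1 - t) *\<^sub>R (M *v v)) \<bullet> v"
        using that by simp
      also have "\<dots> = t * (v \<bullet> v) + (1 - t) * ((M *v v) \<bullet> v)"
        by (simp add: inner_add_left)
      finally have "t * (v \<bullet> v) + (1 - t) * ((M *v v) \<bullet> v) = 0"
        by simp
      moreover have "0 \<le> (1 - t) * ((M *v v) \<bullet> v)" "0 \<le> t * (v \<bullet> v)"
        using psd[of v] t by auto
      ultimately have "t * (v \<bullet> v) = 0"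
        by linarith
      then show "v = 0"
        using t by simp
    qed
    then show ?thesis
      using matrix_left_invertible_ker[of "?A t"] invertible_left_inverse[of "?A t"] invertible_det_nz[of "?A t"]
      by blast
  qed
  obtain p where p: "\<And>t. det (?A t) = poly p t"
    using polynomial_on_det[of UNIV M] by (auto simp: polynomial_on_def)
  have one: "det (?A 1) = 1"
    by simp
  show ?thesis
  proof (rule ccontr)
    assume "\<not> 0 < det (?A l)"
    moreover have "poly p 1 = 1"
      using one p[of 1] by simp
    ultimately have "\<exists>x\<ge>l. x \<le> 1 \<and> poly p x = 0"
      using l p by (intro IVT') (auto intro!: continuous_intros)
    then obtain t where "l \<le> t" "t \<le> 1" "poly p t = 0"
      by blast
    then show False
      using nz[of t] l p[of t] by simp
  qed
qed

lemma has_derivative_monotone_nonneg: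
  fixes g :: "'a::real_inner \<Rightarrow> 'a"
  assumes "monotone_map_on UNIV g" and der: "(g has_derivative g') (at x)"
  shows "0 \<le> g' v \<bullet> v"
proof (rule mono_on_imp_deriv_nonneg[of UNIV "\<lambda>t. g (x + t *\<^sub>R v) \<bullet> v" _ 0])
  show "mono (\<lambda>t. g (x + t *\<^sub>R v) \<bullet> v)"
  proof (rule monoI)
    fix s t :: real assume "s \<le> t"
    have "0 \<le> (g (x + t *\<^sub>R v) - g (x + s *\<^sub>R v)) \<bullet> ((x + t *\<^sub>R v) - (x + s *\<^sub>R v))"
      using assms(1) unfolding monotone_map_on_def by blast
    also have "\<dots> = (t - s) * ((g (x + t *\<^sub>R v) - g (x + s *\<^sub>R v)) \<bullet> v)"
      by (simp add: scaleR_diff_left[symmetric])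
    finally have "s = t \<or> 0 \<le> (g (x + t *\<^sub>R v) - g (x + s *\<^sub>R v)) \<bullet> v"
      using \<open>s \<le> t\<close> by (auto simp: zero_le_mult_iff)
    then show "g (x + s *\<^sub>R v) \<bullet> v \<le> g (x + t *\<^sub>R v) \<bullet> v"
      by (auto simp: inner_diff_left)
  qed
  have "((\<lambda>t. x + t *\<^sub>R v) has_derivative (\<lambda>t. t *\<^sub>R v)) (at 0)"
    by (auto intro!: derivative_eq_intros)
  then have "((\<lambda>t. g (x + t *\<^sub>R v)) has_derivative (\<lambda>t. g' (t *\<^sub>R v))) (at 0)"
    by (rule has_derivative_compose) (use der in simp)
  then have "((\<lambda>t. g (x + t *\<^sub>R v) \<bullet> v) has_derivative (\<lambda>t. g' (t *\<^sub>R v) \<bullet> v)) (at 0)"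
    by (rule has_derivative_inner_left)
  moreover have "g' (t *\<^sub>R v) \<bullet> v = (g' v \<bullet> v) * t" for t
    by (simp add: linear_cmul[OF has_derivative_linear[OF der]])
  ultimately show "((\<lambda>t. g (x + t *\<^sub>R v) \<bullet> v) has_real_derivative g' v \<bullet> v) (at 0)"
    by (simp add: has_field_derivative_def)
qed simp

lemma coord_inner_left: "coord x \<bullet> v = x \<bullet> from_coord v"
  using coord_inner[of x "from_coord v"] by (simp del: coord_inner)

lemma infinite_unit_interval: "infinite {0<..1::real}"
  by (simp add: infinite_Ioc)

text \<open>The absolute value of the Jacobian in the change of variables formula is what could
  destroy polynomiality; monotonicity makes the determinant positive for every \<open>l\<close> in
  question, so the absolute value disappears.\<close>

lemma polynomial_on_measure_shrink_cart:
  fixes g :: "real^'n::{finite,wellorder} \<Rightarrow> real^'n::_"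
  assumes A: "compact A" and der: "\<And>x. (g has_derivative g' x) (at x)"
    and mono: "monotone_map_on UNIV g"
  shows "polynomial_on CARD('n) {0<..1} (\<lambda>l. measure lebesgue (shrink g l ` A))"
proof -
  let ?J = "\<lambda>l x. det (l *\<^sub>R mat 1 + (1 - l) *\<^sub>R matrix (g' x))"
  have lin: "linear (g' x)" for x
    by (rule has_derivative_linear[OF der])
  have dT: "(shrink g l has_derivative (\<lambda>v. l *\<^sub>R v + (1 - l) *\<^sub>R g' x v)) (at x within A)" for l x
    unfolding shrink_def[abs_def]
    by (intro derivative_intros has_derivative_at_withinI[OF der])
  have psd: "0 \<le> (matrix (g' x) *v v) \<bullet> v" for x v
    using has_derivative_monotone_nonneg[OF mono der[of x], of v] lin[of x]
    by (simp add: fun_cong[OF matrix_vector_mul(2)[OF lin[of x]]])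
  have mat: "matrix (\<lambda>v. l *\<^sub>R v + (1 - l) *\<^sub>R g' x v) = l *\<^sub>R mat 1 + (1 - l) *\<^sub>R matrix (g' x)" for l x
    by (simp add: matrix_def mat_def vec_eq_iff axis_def)
  have "continuous_on A g"
    by (intro continuous_at_imp_continuous_on ballI has_derivative_continuous[OF der])
  then have meas: "shrink g l ` A \<in> lmeasurable" for l
    by (intro lmeasurable_compact compact_continuous_image continuous_on_shrink A)
  have inj: "inj_on (shrink g l) A" if "l \<in> {0<..1}" for l
    using inj_on_shrink[OF mono that] by (rule inj_on_subset) simp
  have A': "A \<in> sets lebesgue"
    using A by (simp add: lmeasurable_compact fmeasurableD)
  have J: "\<bar>det (matrix (\<lambda>v. l *\<^sub>R v + (1 - l) *\<^sub>R g' x v))\<bar> = ?J l x" if "l \<in> {0<..1}" for l x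
    using det_pos_of_psd[OF psd that, of x] by (simp add: mat)
  have int: "?J l integrable_on A" if "l \<in> {0<..1}" for l
    using measurable_differentiable_image_eq[OF A' dT inj[OF that]] meas J[OF that] by simp
  have "measure lebesgue (shrink g l ` A) = integral A (?J l)" if "l \<in> {0<..1}" for l
    using measure_differentiable_image_eq[OF A' dT inj[OF that]] int[OF that] J[OF that] by simp
  moreover have "polynomial_on CARD('n) {0<..1} (\<lambda>l. integral A (?J l))"
    by (rule polynomial_on_integral[OF infinite_unit_interval polynomial_on_det int])
  ultimately show ?thesis
    unfolding polynomial_on_def by simp
qed

lemma polynomial_on_measure_shrink_differentiable:
  fixes g :: "'a::euclidean_space \<Rightarrow> 'a"
  assumes A: "compact A" and der: "\<And>x. g differentiable (at x)"
    and mono: "monotone_map_on UNIV g"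
  shows "polynomial_on DIM('a) {0<..1} (\<lambda>l. measure lebesgue (shrink g l ` A))"
proof -
  define h where "h v = coord (g (from_coord v))" for v
  obtain g' where g': "\<And>x. (g has_derivative g' x) (at x)"
    using der unfolding differentiable_def by metis
  have bl: "bounded_linear (coord :: 'a \<Rightarrow> _)" "bounded_linear (from_coord :: _ \<Rightarrow> 'a)"
    using linear_coord linear_from_coord by (auto simp: linear_conv_bounded_linear)
  have der_h: "(h has_derivative (\<lambda>w. coord (g' (from_coord v) (from_coord w)))) (at v)" for v
    unfolding h_def
    by (rule bounded_linear.has_derivative[OF bl(1)
          has_derivative_compose[OF bounded_linear_imp_has_derivative[OF bl(2)] g']])
  have mono_h: "monotone_map_on UNIV h"
    unfolding monotone_map_on_def
  proof (intro ballI)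
    fix v w :: "real^'a basis_index"
    have "(h v - h w) \<bullet> (v - w) = (g (from_coord v) - g (from_coord w)) \<bullet> (from_coord v - from_coord w)"
      unfolding h_def linear_diff[OF linear_coord, symmetric] linear_diff[OF linear_from_coord, symmetric]
      by (rule coord_inner_left)
    then show "0 \<le> (h v - h w) \<bullet> (v - w)"
      using mono by (simp add: monotone_map_on_def)
  qed
  have comm: "shrink h l (coord x) = coord (shrink g l x)" for l x
    by (simp add: shrink_def h_def linear_add[OF linear_coord] linear_cmul[OF linear_coord])
  have "continuous_on A g"
    by (intro continuous_at_imp_continuous_on ballI has_derivative_continuous[OF g'])
  then have "shrink g l ` A \<in> sets borel" for l
    by (intro borel_compact compact_continuous_image continuous_on_shrink A)
  then have "measure lebesgue (shrink h l ` coord ` A) = measure lebesgue (shrink g l ` A)" for l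
    using measure_coord_image[of "shrink g l ` A"] by (simp add: image_image comm)
  moreover have "compact (coord ` A)"
    by (intro compact_continuous_image continuous_on_coord A)
  from polynomial_on_measure_shrink_cart[OF this der_h mono_h]
  have "polynomial_on DIM('a) {0<..1} (\<lambda>l. measure lebesgue (shrink h l ` coord ` A))"
    by (simp add: CARD_basis_index)
  ultimately show ?thesis
    by simp
qed

text \<open>The indicators of the images converge off the image of the boundary of the box, which is
  negligible because \<open>h\<close> is Lipschitz. A point outside the compact limit image has
  positive distance to it and is eventually missed; a point coming from the interior is eventually
  hit, by surjectivity and expansion of the approximating maps.\<close>

lemma tendsto_measure_shrink:
  fixes g :: "nat \<Rightarrow> 'a::euclidean_space \<Rightarrow> 'a"
  assumes g: "\<And>m. continuous_on UNIV (g m)" "\<And>m. monotone_map_on UNIV (g m)"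
    and h: "L-lipschitz_on (cbox a b) h" "monotone_map_on (cbox a b) h"
    and gh: "\<And>m x. x \<in> cbox a b \<Longrightarrow> norm (g m x - h x) \<le> inverse (real (Suc m))"
    and l: "l \<in> {0<..1}"
  shows "(\<lambda>m. measure lebesgue (shrink (g m) l ` cbox a b)) \<longlonglongrightarrow> measure lebesgue (shrink h l ` cbox a b)"
proof -
  let ?C = "cbox a b"
  have l01: "0 < l" "l \<le> 1"
    using l by auto
  have cont_h: "continuous_on ?C (shrink h l)"
    by (intro continuous_on_shrink lipschitz_on_continuous_on[OF h(1)])
  have cg: "compact (shrink (g m) l ` ?C)" for m
    by (intro compact_continuous_image continuous_on_shrink compact_cbox continuous_on_subset[OF g(1)]) simp
  have ch: "compact (shrink h l ` ?C)"
    by (intro compact_continuous_image cont_h compact_cbox)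
  have dist: "norm (shrink (g m) l x - shrink h l x) \<le> inverse (real (Suc m))" if "x \<in> ?C" for m x
  proof -
    have "shrink (g m) l x - shrink h l x = (1 - l) *\<^sub>R (g m x - h x)"
      by (simp add: shrink_def algebra_simps)
    then have "norm (shrink (g m) l x - shrink h l x) \<le> 1 * norm (g m x - h x)"
      using l01 by (simp add: mult_left_le_one_le)
    then show ?thesis
      using gh[OF that, of m] by simp
  qed
  obtain r where r: "\<And>y. y \<in> shrink h l ` ?C \<Longrightarrow> norm y \<le> r"
    using compact_imp_bounded[OF ch] unfolding bounded_iff by metis
  have bound: "norm (indicat_real (shrink (g m) l ` ?C) y) \<le> indicat_real (cball 0 (r + 1)) y" for m y
  proof (cases "y \<in> shrink (g m) l ` ?C")
    case True
    then obtain x where x: "x \<in> ?C" "y = shrink (g m) l x"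
      by auto
    have "norm y \<le> norm (shrink h l x) + norm (shrink (g m) l x - shrink h l x)"
      unfolding x(2) by (rule norm_triangle_sub)
    also have "\<dots> \<le> r + inverse (real (Suc m))"
      using r dist x by (intro add_mono) auto
    also have "\<dots> \<le> r + 1"
      by (simp add: field_simps)
    finally show ?thesis
      using True by simp
  qed simp
  have neg: "negligible (shrink h l ` (?C - box a b))"
  proof (rule negligible_locally_Lipschitz_image)
    show "negligible (?C - box a b)"
      by (rule negligible_frontier_interval)
    fix x assume x: "x \<in> ?C - box a b"
    have "norm (shrink h l y - shrink h l x) \<le> (1 + L) * norm (y - x)" if "y \<in> ?C" for y
    proof -
      have "shrink h l y - shrink h l x = l *\<^sub>R (y - x) + (1 - l) *\<^sub>R (h y - h x)"
        by (simp add: shrink_def algebra_simps)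
      also have "norm \<dots> \<le> l * norm (y - x) + (1 - l) * norm (h y - h x)"
        using l01 norm_triangle_ineq[of "l *\<^sub>R (y - x)" "(1 - l) *\<^sub>R (h y - h x)"] by simp
      also have "\<dots> \<le> 1 * norm (y - x) + 1 * norm (h y - h x)"
        using l01 by (intro add_mono mult_right_mono) auto
      also have "norm (h y - h x) \<le> L * norm (y - x)"
        using lipschitz_onD[OF h(1), of y x] that x by (simp add: dist_norm)
      finally show ?thesis
        by (simp add: algebra_simps)
    qed
    then show "\<exists>T B. open T \<and> x \<in> T \<and>
        (\<forall>y\<in>(?C - box a b) \<inter> T. norm (shrink h l y - shrink h l x) \<le> B * norm (y - x))"
      by (intro exI[of _ UNIV] exI[of _ "1 + L"]) auto
  qed simp
  have inv: "(\<lambda>m. inverse (real (Suc m))) \<longlonglongrightarrow> 0"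
    by (rule LIMSEQ_inverse_real_of_nat)
  have ev: "(\<lambda>m. indicat_real (shrink (g m) l ` ?C) y) \<longlonglongrightarrow> indicat_real (shrink h l ` ?C) y"
    if y: "y \<notin> shrink h l ` (?C - box a b)" for y
  proof (cases "y \<in> shrink h l ` ?C")
    case True
    then obtain x where x: "x \<in> box a b" "y = shrink h l x"
      using y by auto
    obtain e where e: "0 < e" "ball x e \<subseteq> box a b"
      using open_contains_ball[of "box a b"] x(1) open_box by blast
    have "\<forall>\<^sub>F m in sequentially. inverse (real (Suc m)) < l * e"
      using order_tendstoD(2)[OF inv, of "l * e"] l01 e(1) by simp
    then have "\<forall>\<^sub>F m in sequentially. indicat_real (shrink (g m) l ` ?C) y = 1"
    proof eventually_elim
      case (elim m)
      \<comment> \<open>Surjectivity alone gives a \<open>z\<close> anywhere in the space; expansion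
        forces it within \<open>e\<close> of \<open>x\<close>, because the images of
        \<open>x\<close> under the two maps differ by less than \<open>l * e\<close>.\<close>
      obtain z where z: "y = shrink (g m) l z"
        using surj_shrink[OF g(1,2) l] by (metis surjD)
      have "l * norm (z - x) \<le> norm (shrink (g m) l z - shrink (g m) l x)"
        by (intro shrink_expands[OF g(2)] l) auto
      also have "\<dots> = norm (shrink (g m) l x - shrink h l x)"
        using z x(2) by (simp add: norm_minus_commute)
      also have "\<dots> < l * e"
        using dist[of x m] x(1) box_subset_cbox[of a b] elim by force
      finally have "z \<in> ball x e"
        using l01 by (simp add: dist_norm norm_minus_commute)
      then have "z \<in> ?C"
        using e(2) box_subset_cbox[of a b] by blast
      then show ?case
        using z by simp
    qed
    then show ?thesis
      using True by (simp add: tendsto_eventually)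
  next
    case False
    obtain d where d: "0 < d" "\<And>w. w \<in> shrink h l ` ?C \<Longrightarrow> d \<le> dist y w"
      using separate_point_closed[OF compact_imp_closed[OF ch] False] by blast
    have "\<forall>\<^sub>F m in sequentially. inverse (real (Suc m)) < d"
      using order_tendstoD(2)[OF inv d(1)] .
    then have "\<forall>\<^sub>F m in sequentially. indicat_real (shrink (g m) l ` ?C) y = 0"
    proof eventually_elim
      case (elim m)
      have "y \<noteq> shrink (g m) l x" if "x \<in> ?C" for x
        using d(2)[of "shrink h l x"] dist[OF that, of m] that elim by (auto simp: dist_norm)
      then show ?case
        by (auto simp: indicator_def)
    qed
    then show ?thesis
      using False by (simp add: tendsto_eventually)
  qed
  have "(\<lambda>m. integral\<^sup>L lebesgue (indicat_real (shrink (g m) l ` ?C))) \<longlonglongrightarrow>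
      integral\<^sup>L lebesgue (indicat_real (shrink h l ` ?C))"
  proof (rule integral_dominated_convergence)
    show "integrable lebesgue (indicat_real (cball (0::'a) (r + 1)))"
      using lmeasurable_cball[of "0::'a" "r + 1"]
      by (intro integrable_real_indicator) (auto simp: fmeasurable_def)
    show "AE y in lebesgue. (\<lambda>m. indicat_real (shrink (g m) l ` ?C) y) \<longlonglongrightarrow> indicat_real (shrink h l ` ?C) y"
      by (rule AE_I'[of "shrink h l ` (?C - box a b)"]) (use neg ev in \<open>auto simp: negligible_iff_null_sets\<close>)
  qed (use bound cg ch in \<open>auto intro!: borel_measurable_indicator simp: fmeasurableD lmeasurable_compact\<close>)
  then show ?thesis
    by simp
qed

section \<open>Smooth approximation of the metric projection\<close>

definition gauss_weight :: "real \<Rightarrow> 'a::real_inner \<Rightarrow> 'a \<Rightarrow> real" where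
  "gauss_weight \<beta> x p = exp (- \<beta> * ((x - p) \<bullet> (x - p)))"

text \<open>For positive \<beta> this is the gradient of a log-sum-exp of affine functions,
  \<open>(1 / (2 * \<beta>)) * ln (\<Sum>p\<in>P. exp (\<beta> * (2 * (x \<bullet> p) - p \<bullet>
  p)))\<close>. Convexity of that function is the conceptual source of monotonicity.\<close>

definition soft_closest :: "'a::real_inner set \<Rightarrow> real \<Rightarrow> 'a \<Rightarrow> 'a" where
  "soft_closest P \<beta> x = inverse (\<Sum>p\<in>P. gauss_weight \<beta> x p) *\<^sub>R (\<Sum>p\<in>P. gauss_weight \<beta> x p *\<^sub>R p)"

lemma gauss_weight_pos [simp]: "0 < gauss_weight \<beta> x p"
  by (simp add: gauss_weight_def)

lemma gauss_weight_nonneg [simp]: "0 \<le> gauss_weight \<beta> x p"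
  by (simp add: less_imp_le)

lemma sum_gauss_weight_pos: "finite P \<Longrightarrow> P \<noteq> {} \<Longrightarrow> 0 < (\<Sum>p\<in>P. gauss_weight \<beta> x p)"
  by (intro sum_pos) auto

lemma differentiable_soft_closest:
  assumes "finite P" "P \<noteq> {}"
  shows "soft_closest P \<beta> differentiable (at x)"
proof -
  have "(\<lambda>x. gauss_weight \<beta> x p) differentiable (at x)" for p
    unfolding differentiable_def gauss_weight_def by (rule exI) (auto intro!: derivative_eq_intros)
  then show ?thesis
    unfolding soft_closest_def[abs_def]
    using sum_gauss_weight_pos[OF assms, of \<beta> x] assms(1)
    by (intro differentiable_scaleR differentiable_inverse differentiable_sum ballI differentiable_const) auto
qed

text \<open>Multiplied by the two normalising sums, the inner product becomes a double sum over
  pairs \<open>(p, q)\<close>. Symmetrised, its terms are products of \<open>a p q - a q p\<close>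
  and \<open>(p - q) \<bullet> v\<close>, and these factors agree in sign because the exponents of
  \<open>a p q\<close> and \<open>a q p\<close> differ by
  \<open>2 * \<beta> * ((p - q) \<bullet> v)\<close>.\<close>

lemma monotone_soft_closest:
  assumes "finite P" "P \<noteq> {}" "0 \<le> \<beta>"
  shows "monotone_map_on UNIV (soft_closest P \<beta>)"
  unfolding monotone_map_on_def
proof (intro ballI)
  fix x y :: 'a
  define v where "v = x - y"
  define W where "W z = (\<Sum>p\<in>P. gauss_weight \<beta> z p)" for z
  define a where "a p q = gauss_weight \<beta> x p * gauss_weight \<beta> y q" for p q
  have W: "0 < W z" for z
    unfolding W_def by (rule sum_gauss_weight_pos[OF assms(1,2)])
  have cross: "(x - q) \<bullet> (x - q) + (y - p) \<bullet> (y - p) - ((x - p) \<bullet> (x - p) + (y - q) \<bullet> (y - q)) = 2 * ((p - q) \<bullet> v)" for p q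
    unfolding v_def by (simp add: inner_diff_left inner_diff_right inner_commute algebra_simps)
  have a: "a p q = exp (- \<beta> * ((x - p) \<bullet> (x - p) + (y - q) \<bullet> (y - q)))" for p q
    by (simp add: a_def gauss_weight_def exp_add[symmetric] algebra_simps)
  have nonneg: "0 \<le> (a p q - a q p) * ((p - q) \<bullet> v)" for p q
  proof (cases "0 \<le> (p - q) \<bullet> v")
    case True
    then have "a q p \<le> a p q"
      using cross[of q p] assms(3) unfolding a by (auto intro!: mult_left_mono)
    then show ?thesis
      using True by simp
  next
    case False
    then have "a p q \<le> a q p"
      using cross[of q p] assms(3) unfolding a by (auto intro!: mult_left_mono)
    then show ?thesis
      using False by (simp add: mult_nonpos_nonpos)
  qed
  have "0 \<le> (\<Sum>p\<in>P. \<Sum>q\<in>P. (a p q - a q p) * ((p - q) \<bullet> v))"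
    by (intro sum_nonneg nonneg)
  also have "\<dots> = (\<Sum>p\<in>P. \<Sum>q\<in>P. a p q * ((p - q) \<bullet> v)) + (\<Sum>p\<in>P. \<Sum>q\<in>P. a q p * ((q - p) \<bullet> v))"
    unfolding sum.distrib[symmetric] by (intro sum.cong refl) (simp add: algebra_simps inner_diff_left)
  also have "(\<Sum>p\<in>P. \<Sum>q\<in>P. a q p * ((q - p) \<bullet> v)) = (\<Sum>p\<in>P. \<Sum>q\<in>P. a p q * ((p - q) \<bullet> v))"
    by (rule sum.swap)
  finally have "0 \<le> (\<Sum>p\<in>P. \<Sum>q\<in>P. a p q * ((p - q) \<bullet> v))"
    by simp
  also have "\<dots> = (\<Sum>p\<in>P. \<Sum>q\<in>P. gauss_weight \<beta> x p * (p \<bullet> v) * gauss_weight \<beta> y q) -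
      (\<Sum>p\<in>P. \<Sum>q\<in>P. gauss_weight \<beta> x p * (gauss_weight \<beta> y q * (q \<bullet> v)))"
    unfolding sum_subtractf[symmetric] by (intro sum.cong refl) (simp add: a_def algebra_simps inner_diff_left)
  also have "\<dots> = ((\<Sum>p\<in>P. gauss_weight \<beta> x p *\<^sub>R p) \<bullet> v) * W y - W x * ((\<Sum>q\<in>P. gauss_weight \<beta> y q *\<^sub>R q) \<bullet> v)"
    by (simp add: sum_product W_def inner_sum_left)
  also have "\<dots> = W x * W y * ((soft_closest P \<beta> x - soft_closest P \<beta> y) \<bullet> v)"
    using W[of x] W[of y] by (simp add: soft_closest_def W_def[symmetric] inner_diff_left field_simps)
  finally show "0 \<le> (soft_closest P \<beta> x - soft_closest P \<beta> y) \<bullet> (x - y)"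
    using mult_pos_pos[OF W[of x] W[of y]] by (simp add: zero_le_mult_iff v_def)
qed

text \<open>Minimality of the foot point with quadratic growth at rate \<theta>. The rate 1 is the
  obtuse angle condition known from convex sets; positive reach gives rates below 1. Monotonicity,
  the Lipschitz bound and the Gaussian approximation are all drawn from this one inequality.\<close>

definition strongly_projects :: "'a::real_normed_vector set \<Rightarrow> real \<Rightarrow> 'a set \<Rightarrow> ('a \<Rightarrow> 'a) \<Rightarrow> bool" where
  "strongly_projects X \<theta> A \<xi> \<longleftrightarrow>
     (\<forall>x\<in>A. \<xi> x \<in> X \<and> (\<forall>p\<in>X. (norm (x - \<xi> x))\<^sup>2 + \<theta> * (norm (p - \<xi> x))\<^sup>2 \<le> (norm (x - p))\<^sup>2))"

lemma strongly_projects_subset: "strongly_projects X \<theta> A \<xi> \<Longrightarrow> B \<subseteq> A \<Longrightarrow> strongly_projects X \<theta> B \<xi>"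
  by (auto simp: strongly_projects_def)

text \<open>Test the inequality for \<open>x\<close> with the foot point of \<open>y\<close> and
  vice versa; in the sum only the mixed terms survive.\<close>

lemma strongly_projects_inner:
  fixes \<xi> :: "'a::real_inner \<Rightarrow> 'a"
  assumes "strongly_projects X \<theta> A \<xi>" "x \<in> A" "y \<in> A"
  shows "\<theta> * (norm (\<xi> x - \<xi> y))\<^sup>2 \<le> (\<xi> x - \<xi> y) \<bullet> (x - y)"
proof -
  have *: "(norm (x - \<xi> x))\<^sup>2 + \<theta> * (norm (\<xi> y - \<xi> x))\<^sup>2 \<le> (norm (x - \<xi> y))\<^sup>2"
    "(norm (y - \<xi> y))\<^sup>2 + \<theta> * (norm (\<xi> x - \<xi> y))\<^sup>2 \<le> (norm (y - \<xi> x))\<^sup>2"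
    using assms unfolding strongly_projects_def by blast+
  have "(norm (x - \<xi> y))\<^sup>2 - (norm (x - \<xi> x))\<^sup>2 + (norm (y - \<xi> x))\<^sup>2 - (norm (y - \<xi> y))\<^sup>2 = 2 * ((\<xi> x - \<xi> y) \<bullet> (x - y))"
    by (simp add: power2_norm_eq_inner inner_diff_left inner_diff_right inner_commute algebra_simps)
  then show ?thesis
    using * by (simp add: norm_minus_commute[of "\<xi> y"])
qed

lemma strongly_projects_monotone:
  fixes \<xi> :: "'a::real_inner \<Rightarrow> 'a"
  assumes "strongly_projects X \<theta> A \<xi>" "0 \<le> \<theta>"
  shows "monotone_map_on A \<xi>"
  unfolding monotone_map_on_def
  using strongly_projects_inner[OF assms(1)] assms(2) by (meson mult_nonneg_nonneg order_trans zero_le_power2)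

lemma strongly_projects_lipschitz:
  fixes \<xi> :: "'a::real_inner \<Rightarrow> 'a"
  assumes "strongly_projects X \<theta> A \<xi>" "0 < \<theta>"
  shows "(1 / \<theta>)-lipschitz_on A \<xi>"
proof (rule lipschitz_onI)
  fix x y assume "x \<in> A" "y \<in> A"
  then have "\<theta> * (norm (\<xi> x - \<xi> y))\<^sup>2 \<le> (\<xi> x - \<xi> y) \<bullet> (x - y)"
    by (rule strongly_projects_inner[OF assms(1)])
  also have "\<dots> \<le> norm (\<xi> x - \<xi> y) * norm (x - y)"
    by (rule norm_cauchy_schwarz)
  finally have *: "norm (\<xi> x - \<xi> y) * (\<theta> * norm (\<xi> x - \<xi> y)) \<le> norm (\<xi> x - \<xi> y) * norm (x - y)"
    by (simp add: power2_eq_square mult.assoc mult.left_commute[of \<theta>])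
  have "\<theta> * norm (\<xi> x - \<xi> y) \<le> norm (x - y)"
  proof (cases "\<xi> x = \<xi> y")
    case False
    then show ?thesis
      using * by (subst (asm) mult_le_cancel_left_pos) auto
  qed simp
  then show "dist (\<xi> x) (\<xi> y) \<le> 1 / \<theta> * dist x y"
    using assms(2) by (simp add: dist_norm field_simps)
qed (use assms in simp)

text \<open>With \<open>p0\<close> a point of a fine net close to \<open>\<xi> x\<close>, every net point \<open>p\<close> far from \<open>\<xi> x\<close> is
  further away from \<open>x\<close> than \<open>p0\<close> by a definite amount, so its weight is negligible against that of
  \<open>p0\<close> once \<open>\<beta>\<close> is large.\<close>

lemma soft_closest_approx:
  fixes \<xi> :: "'a::euclidean_space \<Rightarrow> 'a"
  assumes A: "bounded A" and X: "closed X" and \<xi>: "strongly_projects X \<theta> A \<xi>" and \<theta>: "0 < \<theta>" and e: "0 < e"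
  obtains P \<beta> where "finite P" "P \<noteq> {}" "0 \<le> \<beta>" "\<And>x. x \<in> A \<Longrightarrow> norm (soft_closest P \<beta> x - \<xi> x) \<le> e"
proof (cases "A = {}")
  case True
  then show ?thesis
    using that[of "{0}" 0] by simp
next
  case False
  define d where "d = e / 2"
  \<comment> \<open>Net points at distance at least \<open>d\<close> from the foot point exceed its
    squared distance from \<open>x\<close> by at least \<open>2 * c\<close>: one half of this gap
    pays for the net error, the other remains for the exponential decay.\<close>
  define c where "c = \<theta> * d\<^sup>2 / 2"
  have d: "0 < d" and c: "0 < c"
    using e \<theta> by (auto simp: d_def c_def)
  have lip: "(1 / \<theta>)-lipschitz_on A \<xi>"
    by (rule strongly_projects_lipschitz[OF \<xi> \<theta>])
  have b\<xi>: "bounded (\<xi> ` A)"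
    by (intro bounded_uniformly_continuous_image lipschitz_on_uniformly_continuous[OF lip] A)
  obtain D1 where D1: "\<And>x. x \<in> A \<Longrightarrow> norm x \<le> D1"
    using A unfolding bounded_iff by metis
  obtain D2 where D2: "\<And>p. p \<in> closure (\<xi> ` A) \<Longrightarrow> norm p \<le> D2"
    using bounded_closure[OF b\<xi>] unfolding bounded_iff by metis
  have \<xi>X: "\<xi> ` A \<subseteq> X"
    using \<xi> by (auto simp: strongly_projects_def)
  then have cl: "closure (\<xi> ` A) \<subseteq> X"
    using X by (rule closure_minimal)
  have D0: "0 \<le> D1" "0 \<le> D2"
    using False D1 D2 norm_ge_zero order_trans closure_subset by (metis ex_in_conv, metis ex_in_conv image_eqI subsetD)
  \<comment> \<open>\<open>2 * (D1 + D2) + 1\<close> bounds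
    \<open>2 * norm (x - \<xi> x) + \<eta>\<close>, so moving from the foot point to a net point
    within \<eta> raises the squared distance to \<open>x\<close> by at most
    \<open>c\<close>.\<close>
  define \<eta> where "\<eta> = min 1 (c / (2 * (D1 + D2) + 1))"
  have \<eta>: "0 < \<eta>" "\<eta> \<le> 1"
    using c D0 by (auto simp: \<eta>_def)
  have "\<eta> * (2 * (D1 + D2) + 1) \<le> c / (2 * (D1 + D2) + 1) * (2 * (D1 + D2) + 1)"
    using D0 by (intro mult_right_mono) (auto simp: \<eta>_def)
  then have \<eta>c: "\<eta> * (2 * (D1 + D2) + 1) \<le> c"
    using D0 by simp
  \<comment> \<open>The net is taken in the closure of the image of \<open>A\<close>, which is
    compact and contained in \<open>X\<close>, so the growth inequality applies to the net
    points.\<close>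
  have "seq_compact (closure (\<xi> ` A))"
    using b\<xi> by (simp add: compact_closure compact_imp_seq_compact)
  from seq_compact_imp_totally_bounded[OF this] obtain P where P: "finite P" "P \<subseteq> closure (\<xi> ` A)"
    "closure (\<xi> ` A) \<subseteq> (\<Union>p\<in>P. ball p \<eta>)"
    using \<eta>(1) by meson
  have "P \<noteq> {}"
    using P(3) False closure_subset[of "\<xi> ` A"] by auto
  define M where "M = real (card P) * (2 * D2)"
  have M: "0 \<le> M"
    using D0 by (simp add: M_def)
  \<comment> \<open>This makes \<open>\<beta> * c = M / d\<close>, and
    \<open>t * exp (- t) \<le> 1\<close> at \<open>t = M / d\<close> yields
    \<open>M * exp (- \<beta> * c) \<le> d\<close>.\<close>
  define \<beta> where "\<beta> = M / d / c"
  have \<beta>: "0 \<le> \<beta>"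
    using M d c by (simp add: \<beta>_def)
  have "M / d \<le> exp (M / d)"
    using exp_ge_add_one_self[of "M / d"] by linarith
  then have "M / d * exp (- (M / d)) \<le> exp (M / d) * exp (- (M / d))"
    by (intro mult_right_mono) auto
  also have "\<dots> = 1"
    by (simp add: exp_minus)
  finally have "d * (M / d * exp (- (M / d))) \<le> d * 1"
    using d by (intro mult_left_mono) auto
  then have expM: "M * exp (- \<beta> * c) \<le> d"
    using d c by (simp add: \<beta>_def)
  show ?thesis
  proof (rule that[OF P(1) \<open>P \<noteq> {}\<close> \<beta>])
    fix x assume x: "x \<in> A"
    define W where "W = (\<Sum>p\<in>P. gauss_weight \<beta> x p)"
    have W: "0 < W"
      unfolding W_def by (rule sum_gauss_weight_pos[OF P(1) \<open>P \<noteq> {}\<close>])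
    have \<xi>x: "\<xi> x \<in> closure (\<xi> ` A)"
      using x closure_subset[of "\<xi> ` A"] by auto
    then obtain p0 where p0: "p0 \<in> P" "norm (p0 - \<xi> x) < \<eta>"
      using P(3) by (auto simp: dist_norm)
    have "norm (x - p0) \<le> norm (x - \<xi> x) + \<eta>"
      using norm_triangle_ineq4[of "x - \<xi> x" "p0 - \<xi> x"] p0(2) by simp
    then have "(norm (x - p0))\<^sup>2 \<le> (norm (x - \<xi> x) + \<eta>)\<^sup>2"
      by (intro power_mono) auto
    also have "\<dots> = (norm (x - \<xi> x))\<^sup>2 + \<eta> * (2 * norm (x - \<xi> x) + \<eta>)"
      by (simp add: power2_eq_square algebra_simps)
    also have "\<eta> * (2 * norm (x - \<xi> x) + \<eta>) \<le> \<eta> * (2 * (D1 + D2) + 1)"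
      using norm_triangle_ineq4[of x "\<xi> x"] D1[OF x] D2[OF \<xi>x] \<eta> by (intro mult_left_mono) auto
    also have "\<dots> \<le> c"
      by (rule \<eta>c)
    finally have near: "(norm (x - p0))\<^sup>2 \<le> (norm (x - \<xi> x))\<^sup>2 + c"
      by simp
    have le: "gauss_weight \<beta> x p * norm (p - \<xi> x) \<le> gauss_weight \<beta> x p * d + W * (exp (- \<beta> * c) * (2 * D2))" if p: "p \<in> P" for p
    proof (cases "norm (p - \<xi> x) < d")
      case True
      then have "gauss_weight \<beta> x p * norm (p - \<xi> x) \<le> gauss_weight \<beta> x p * d"
        by (intro mult_left_mono) auto
      moreover have "0 \<le> W * (exp (- \<beta> * c) * (2 * D2))"
        using W D0 by simp
      ultimately show ?thesis
        by linarith
    next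
      case False
      then have "d\<^sup>2 \<le> (norm (p - \<xi> x))\<^sup>2"
        using d by (intro power_mono) auto
      then have "2 * c \<le> \<theta> * (norm (p - \<xi> x))\<^sup>2"
        using \<theta> by (simp add: c_def)
      moreover have "(norm (x - \<xi> x))\<^sup>2 + \<theta> * (norm (p - \<xi> x))\<^sup>2 \<le> (norm (x - p))\<^sup>2"
        using \<xi> x p P(2) cl unfolding strongly_projects_def by blast
      ultimately have "(x - p0) \<bullet> (x - p0) + c \<le> (x - p) \<bullet> (x - p)"
        using near by (simp add: power2_norm_eq_inner)
      then have "\<beta> * ((x - p0) \<bullet> (x - p0) + c) \<le> \<beta> * ((x - p) \<bullet> (x - p))"
        using \<beta> by (rule mult_left_mono)
      then have "gauss_weight \<beta> x p \<le> gauss_weight \<beta> x p0 * exp (- \<beta> * c)"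
        by (simp add: gauss_weight_def exp_add[symmetric] algebra_simps)
      also have "\<dots> \<le> W * exp (- \<beta> * c)"
        unfolding W_def using P(1) p0(1) by (intro mult_right_mono member_le_sum) auto
      finally have "gauss_weight \<beta> x p * norm (p - \<xi> x) \<le> W * exp (- \<beta> * c) * (2 * D2)"
        using norm_triangle_ineq4[of p "\<xi> x"] D2[OF \<xi>x] D2[of p] p P(2) W by (intro mult_mono) auto
      moreover have "0 \<le> gauss_weight \<beta> x p * d"
        using d by simp
      ultimately show ?thesis
        by (simp add: mult.assoc)
    qed
    have "soft_closest P \<beta> x - \<xi> x = inverse W *\<^sub>R ((\<Sum>p\<in>P. gauss_weight \<beta> x p *\<^sub>R p) - W *\<^sub>R \<xi> x)"
      using W by (simp add: soft_closest_def W_def[symmetric] scaleR_diff_right)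
    also have "(\<Sum>p\<in>P. gauss_weight \<beta> x p *\<^sub>R p) - W *\<^sub>R \<xi> x = (\<Sum>p\<in>P. gauss_weight \<beta> x p *\<^sub>R (p - \<xi> x))"
      by (simp add: W_def scaleR_sum_left scaleR_diff_right sum_subtractf)
    finally have "norm (soft_closest P \<beta> x - \<xi> x) = inverse W * norm (\<Sum>p\<in>P. gauss_weight \<beta> x p *\<^sub>R (p - \<xi> x))"
      using W by simp
    also have "norm (\<Sum>p\<in>P. gauss_weight \<beta> x p *\<^sub>R (p - \<xi> x)) \<le> (\<Sum>p\<in>P. gauss_weight \<beta> x p * norm (p - \<xi> x))"
      by (rule order_trans[OF norm_sum]) simp
    also have "\<dots> \<le> (\<Sum>p\<in>P. gauss_weight \<beta> x p * d + W * (exp (- \<beta> * c) * (2 * D2)))"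
      by (intro sum_mono le)
    also have "\<dots> = W * (d + M * exp (- \<beta> * c))"
      unfolding sum.distrib sum_distrib_right[symmetric] W_def[symmetric] by (simp add: M_def algebra_simps)
    also have "\<dots> \<le> W * (d + d)"
      using W expM by (intro mult_left_mono add_mono) auto
    finally have "norm (soft_closest P \<beta> x - \<xi> x) \<le> inverse W * (W * (d + d))"
      using W by (simp add: mult_left_mono)
    then show "norm (soft_closest P \<beta> x - \<xi> x) \<le> e"
      using W by (simp add: d_def mult.assoc[symmetric])
  qed
qed

lemma polynomial_on_measure_shrink_cbox:
  fixes \<xi> :: "'a::euclidean_space \<Rightarrow> 'a"
  assumes X: "closed X" and \<xi>: "strongly_projects X \<theta> (cbox a b) \<xi>" and \<theta>: "0 < \<theta>"
  shows "polynomial_on DIM('a) {0<..1} (\<lambda>l. measure lebesgue (shrink \<xi> l ` cbox a b))"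
proof -
  have "\<exists>P \<beta>. finite P \<and> P \<noteq> {} \<and> 0 \<le> \<beta> \<and>
      (\<forall>x\<in>cbox a b. norm (soft_closest P \<beta> x - \<xi> x) \<le> inverse (real (Suc m)))" for m
    by (rule soft_closest_approx[OF bounded_cbox X \<xi> \<theta>, of "inverse (real (Suc m))"]) auto
  then obtain P \<beta> where P: "\<And>m. finite (P m)" "\<And>m. P m \<noteq> {}" "\<And>m. 0 \<le> \<beta> m"
    "\<And>m x. x \<in> cbox a b \<Longrightarrow> norm (soft_closest (P m) (\<beta> m) x - \<xi> x) \<le> inverse (real (Suc m))"
    by metis
  have diff: "soft_closest (P m) (\<beta> m) differentiable (at x)" for m x
    by (rule differentiable_soft_closest[OF P(1,2)])
  have mono: "monotone_map_on UNIV (soft_closest (P m) (\<beta> m))" for m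
    by (rule monotone_soft_closest[OF P(1,2,3)])
  have cont: "continuous_on UNIV (soft_closest (P m) (\<beta> m))" for m
    by (intro continuous_at_imp_continuous_on ballI differentiable_imp_continuous_within diff)
  show ?thesis
  proof (rule polynomial_on_limit[OF infinite_unit_interval])
    show "polynomial_on DIM('a) {0<..1} (\<lambda>l. measure lebesgue (shrink (soft_closest (P m) (\<beta> m)) l ` cbox a b))" for m
      by (rule polynomial_on_measure_shrink_differentiable[OF compact_cbox diff mono])
    show "(\<lambda>m. measure lebesgue (shrink (soft_closest (P m) (\<beta> m)) l ` cbox a b))
        \<longlonglongrightarrow> measure lebesgue (shrink \<xi> l ` cbox a b)" if "l \<in> {0<..1}" for l
      by (rule tendsto_measure_shrink[OF cont mono strongly_projects_lipschitz[OF \<xi> \<theta>]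
            strongly_projects_monotone[OF \<xi> less_imp_le[OF \<theta>]] P(4) that])
  qed
qed

section \<open>From closed boxes to bounded Borel sets\<close>

lemma borel_eq_cbox: "borel = sigma UNIV (range (\<lambda>(a, b). cbox a b :: 'a::euclidean_space set))"
proof (rule borel_eq_sigmaI2[OF borel_eq_box])
  fix a b :: 'a
  obtain D where "countable D" "\<And>X. X \<in> D \<Longrightarrow> \<exists>a b. X = cbox a b" "\<Union>D = box a b"
    using open_countable_Union_open_cbox[OF open_box] by metis
  then have "\<Union>D \<in> sets (sigma UNIV (range (\<lambda>(a, b). cbox a b :: 'a set)))"
    by (intro sets.countable_Union) fastforce+
  then show "box a b \<in> sets (sigma UNIV (range (\<lambda>(a, b). cbox a b :: 'a set)))"
    using \<open>\<Union>D = box a b\<close> by simp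
qed auto

text \<open>Measurability of the images is carried along because the complement and union steps of
  the Dynkin argument subtract and add their volumes.\<close>

definition shrink_polynomial :: "('a::euclidean_space \<Rightarrow> 'a) \<Rightarrow> 'a set \<Rightarrow> bool" where
  "shrink_polynomial \<xi> A \<longleftrightarrow> (\<forall>l\<in>{0<..1}. shrink \<xi> l ` A \<in> lmeasurable) \<and>
     polynomial_on DIM('a) {0<..1} (\<lambda>l. measure lebesgue (shrink \<xi> l ` A))"

lemma shrink_polynomial_lmeasurable:
  "shrink_polynomial \<xi> A \<Longrightarrow> l \<in> {0<..1} \<Longrightarrow> shrink \<xi> l ` A \<in> lmeasurable"
  by (simp add: shrink_polynomial_def)

lemma shrink_polynomial_cbox:
  fixes \<xi> :: "'a::euclidean_space \<Rightarrow> 'a"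
  assumes "closed X" "strongly_projects X \<theta> (cbox a b) \<xi>" "0 < \<theta>"
  shows "shrink_polynomial \<xi> (cbox a b)"
  unfolding shrink_polynomial_def
  by (intro conjI ballI lmeasurable_compact compact_continuous_image continuous_on_shrink compact_cbox
      lipschitz_on_continuous_on[OF strongly_projects_lipschitz[OF assms(2,3)]]
      polynomial_on_measure_shrink_cbox[OF assms])

text \<open>Injectivity of \<open>shrink\<close> on \<open>Q\<close>, which comes from monotonicity,
  lets images commute with the difference.\<close>

lemma shrink_polynomial_Diff:
  assumes "monotone_map_on Q \<xi>" "shrink_polynomial \<xi> Q" "shrink_polynomial \<xi> A" "A \<subseteq> Q"
  shows "shrink_polynomial \<xi> (Q - A)"
proof -
  have img: "shrink \<xi> l ` (Q - A) = shrink \<xi> l ` Q - shrink \<xi> l ` A" if "l \<in> {0<..1}" for l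
    using inj_on_image_set_diff[OF inj_on_shrink[OF assms(1) that]] assms(4) by auto
  have meas: "measure lebesgue (shrink \<xi> l ` (Q - A)) =
      measure lebesgue (shrink \<xi> l ` Q) - measure lebesgue (shrink \<xi> l ` A)" if "l \<in> {0<..1}" for l
    unfolding img[OF that]
    by (intro measurable_measure_Diff fmeasurableD shrink_polynomial_lmeasurable[OF _ that] assms image_mono)
  have "polynomial_on DIM('a) {0<..1} (\<lambda>l. measure lebesgue (shrink \<xi> l ` (Q - A)))"
    by (subst polynomial_on_cong[OF meas])
      (use assms(2,3) in \<open>auto simp: shrink_polynomial_def intro: polynomial_on_diff\<close>)
  moreover have "shrink \<xi> l ` (Q - A) \<in> lmeasurable" if "l \<in> {0<..1}" for l
    unfolding img[OF that]
    by (intro fmeasurable_Diff fmeasurableD shrink_polynomial_lmeasurable[OF _ that] assms)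
  ultimately show ?thesis
    by (simp add: shrink_polynomial_def)
qed

lemma bounded_shrink_image:
  fixes \<xi> :: "'a::real_normed_vector \<Rightarrow> 'a"
  assumes "bounded A" "bounded (\<xi> ` A)"
  shows "bounded (shrink \<xi> l ` A)"
proof -
  have "bounded ((\<lambda>x. l *\<^sub>R x) ` A)" "bounded ((\<lambda>x. (1 - l) *\<^sub>R x) ` \<xi> ` A)"
    by (intro bounded_scaling assms)+
  then have "bounded ((\<lambda>x. l *\<^sub>R x + (1 - l) *\<^sub>R \<xi> x) ` A)"
    by (intro bounded_plus_comp) (simp_all add: image_image)
  then show ?thesis
    by (simp add: shrink_def[abs_def])
qed

lemma shrink_polynomial_UN:
  fixes \<xi> :: "'a::euclidean_space \<Rightarrow> 'a"
  assumes mono: "monotone_map_on (\<Union>i. A i) \<xi>" and A: "\<And>i::nat. shrink_polynomial \<xi> (A i)"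
    and disj: "disjoint_family A" and bdd: "bounded (\<Union>i. A i)" "bounded (\<xi> ` (\<Union>i. A i))"
  shows "shrink_polynomial \<xi> (\<Union>i. A i)"
proof -
  have sets: "range (\<lambda>i. shrink \<xi> l ` A i) \<subseteq> sets lebesgue" if "l \<in> {0<..1}" for l
    using shrink_polynomial_lmeasurable[OF A that] by (auto dest: fmeasurableD)
  have lm: "shrink \<xi> l ` (\<Union>i. A i) \<in> lmeasurable" if "l \<in> {0<..1}" for l
    using sets[OF that] bounded_shrink_image[OF bdd]
    by (intro bounded_set_imp_lmeasurable) (auto simp: image_UN intro: sets.countable_UN)
  have sums: "(\<lambda>i. measure lebesgue (shrink \<xi> l ` A i)) sums measure lebesgue (shrink \<xi> l ` (\<Union>i. A i))"
    if "l \<in> {0<..1}" for l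
    unfolding image_UN
  proof (rule measure_UNION[OF sets[OF that]])
    show "disjoint_family (\<lambda>i. shrink \<xi> l ` A i)"
      unfolding disjoint_family_on_def
    proof (intro ballI impI)
      fix i j :: nat assume "i \<noteq> j"
      then have "A i \<inter> A j = {}"
        using disj by (auto simp: disjoint_family_on_def)
      moreover have "shrink \<xi> l ` A i \<inter> shrink \<xi> l ` A j = shrink \<xi> l ` (A i \<inter> A j)"
        by (rule inj_on_image_Int[OF inj_on_shrink[OF mono that], symmetric]) auto
      ultimately show "shrink \<xi> l ` A i \<inter> shrink \<xi> l ` A j = {}"
        by simp
    qed
    show "emeasure lebesgue (\<Union>i. shrink \<xi> l ` A i) \<noteq> \<infinity>"
      using fmeasurableD2[OF lm[OF that]] by (simp add: image_UN)
  qed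
  have "polynomial_on DIM('a) {0<..1} (\<lambda>l. measure lebesgue (shrink \<xi> l ` (\<Union>i. A i)))"
  proof (rule polynomial_on_sums[OF infinite_unit_interval _ sums])
    show "polynomial_on DIM('a) {0<..1} (\<lambda>l. measure lebesgue (shrink \<xi> l ` A i))" for i
      using A[of i] by (simp add: shrink_polynomial_def)
  qed
  then show ?thesis
    using lm by (simp add: shrink_polynomial_def)
qed

text \<open>Dynkin induction over the intersection-stable family of closed boxes. Everything is
  relative to one fixed box, so that complements keep finite volume and the strong projection is
  available throughout.\<close>

lemma shrink_polynomial_Int_cbox:
  fixes \<xi> :: "'a::euclidean_space \<Rightarrow> 'a"
  assumes X: "closed X" and \<xi>: "strongly_projects X \<theta> (cbox a b) \<xi>" and \<theta>: "0 < \<theta>" and B: "B \<in> sets borel"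
  shows "shrink_polynomial \<xi> (B \<inter> cbox a b)"
proof -
  let ?G = "range (\<lambda>(a, b). cbox a b :: 'a set)"
  have lip: "(1 / \<theta>)-lipschitz_on (cbox a b) \<xi>"
    by (rule strongly_projects_lipschitz[OF \<xi> \<theta>])
  have bdd: "bounded (\<xi> ` cbox a b)"
    by (intro bounded_uniformly_continuous_image lipschitz_on_uniformly_continuous[OF lip] bounded_cbox)
  have mono: "monotone_map_on (cbox a b) \<xi>"
    by (rule strongly_projects_monotone[OF \<xi> less_imp_le[OF \<theta>]])
  have box: "shrink_polynomial \<xi> (cbox c d \<inter> cbox a b)" for c d
    unfolding Int_interval
    by (intro shrink_polynomial_cbox[OF X _ \<theta>] strongly_projects_subset[OF \<xi>]) (simp add: Int_interval[symmetric])
  have "Int_stable ?G"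
    by (auto simp: Int_stable_def Int_interval)
  moreover have "?G \<subseteq> Pow UNIV"
    by simp
  moreover have "B \<in> sigma_sets UNIV ?G"
    using B unfolding borel_eq_cbox by simp
  ultimately show ?thesis
  proof (induction rule: sigma_sets_induct_disjoint)
    case (basic A)
    then show ?case
      using box by auto
  next
    case empty
    then show ?case
      by (simp add: shrink_polynomial_def polynomial_on_const)
  next
    case (compl A)
    have "(UNIV - A) \<inter> cbox a b = cbox a b - A \<inter> cbox a b"
      by auto
    then show ?case
      using shrink_polynomial_Diff[OF mono shrink_polynomial_cbox[OF X \<xi> \<theta>] compl(2)] by simp
  next
    case (union A)
    have "shrink_polynomial \<xi> (\<Union>i. A i \<inter> cbox a b)"
    proof (rule shrink_polynomial_UN)
      show "monotone_map_on (\<Union>i. A i \<inter> cbox a b) \<xi>"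
        using mono by (auto simp: monotone_map_on_def)
      show "disjoint_family (\<lambda>i. A i \<inter> cbox a b)"
        using union(1) by (auto simp: disjoint_family_on_def)
      show "bounded (\<Union>i. A i \<inter> cbox a b)"
        by (rule bounded_subset[OF bounded_cbox[of a b]]) auto
      show "bounded (\<xi> ` (\<Union>i. A i \<inter> cbox a b))"
        by (rule bounded_subset[OF bdd]) auto
    qed (rule union(3))
    then show ?case
      by (simp only: UN_extend_simps)
  qed
qed

text \<open>The open set \<open>W\<close> is a countable union of closed boxes; made disjoint, they
  cut \<open>A\<close> into Borel pieces each contained in a single box.\<close>

lemma shrink_polynomial_borel:
  fixes \<xi> :: "'a::euclidean_space \<Rightarrow> 'a"
  assumes X: "closed X" and \<xi>: "strongly_projects X \<theta> W \<xi>" and \<theta>: "0 < \<theta>" and W: "open W"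
    and A: "A \<in> sets borel" "bounded A" "A \<subseteq> W"
  shows "shrink_polynomial \<xi> A"
proof -
  obtain D where D: "countable D" "D \<subseteq> Pow W" "\<And>Q. Q \<in> D \<Longrightarrow> \<exists>a b. Q = cbox a b" "\<Union>D = W"
    using open_countable_Union_open_cbox[OF W] by metis
  \<comment> \<open>\<open>from_nat_into\<close> has no meaningful value on the empty family, which
    can occur only if \<open>W\<close> is empty; the constant empty set replaces it.\<close>
  define Q where "Q i = (if D = {} then {} else from_nat_into D i)" for i
  have Q: "\<exists>a b. Q i = cbox a b" "Q i \<subseteq> W" for i
  proof -
    show "\<exists>a b. Q i = cbox a b"
      using D(3) from_nat_into[of D i] empty_as_interval by (auto simp: Q_def)
    show "Q i \<subseteq> W"
      using D(2) from_nat_into[of D i] by (auto simp: Q_def)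
  qed
  have UN: "(\<Union>i. Q i) = W"
    using D(1,4) range_from_nat_into[of D] by (auto simp: Q_def)
  have Qb: "Q i \<in> sets borel" for i
    using Q(1)[of i] by auto
  define B where "B i = A \<inter> disjointed Q i" for i
  have UB: "(\<Union>i. B i) = A"
    using UN A(3) by (auto simp: B_def UN_disjointed_eq simp flip: Int_UN_distrib)
  have lip: "(1 / \<theta>)-lipschitz_on A \<xi>"
    by (rule strongly_projects_lipschitz[OF strongly_projects_subset[OF \<xi> A(3)] \<theta>])
  have "shrink_polynomial \<xi> (\<Union>i. B i)"
  proof (rule shrink_polynomial_UN)
    show "monotone_map_on (\<Union>i. B i) \<xi>"
      unfolding UB by (rule strongly_projects_monotone[OF strongly_projects_subset[OF \<xi> A(3)] less_imp_le[OF \<theta>]])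
    show "disjoint_family B"
      using disjoint_family_disjointed[of Q] by (auto simp: B_def disjoint_family_on_def)
    show "bounded (\<Union>i. B i)" "bounded (\<xi> ` (\<Union>i. B i))"
      unfolding UB
      by (rule A(2), rule bounded_uniformly_continuous_image[OF lipschitz_on_uniformly_continuous[OF lip] A(2)])
    show "shrink_polynomial \<xi> (B i)" for i
    proof -
      obtain a b where ab: "Q i = cbox a b"
        using Q(1) by blast
      have "strongly_projects X \<theta> (cbox a b) \<xi>"
        using strongly_projects_subset[OF \<xi>] Q(2)[of i] ab by simp
      moreover have "B i \<in> sets borel"
        unfolding B_def disjointed_def using A(1) Qb by (intro sets.Int sets.Diff sets.finite_UN) auto
      ultimately have "shrink_polynomial \<xi> (B i \<inter> cbox a b)"
        by (intro shrink_polynomial_Int_cbox[OF X _ \<theta>])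
      moreover have "B i \<inter> cbox a b = B i"
        using disjointed_subset[of Q i] ab by (auto simp: B_def)
      ultimately show ?thesis
        by simp
    qed
  qed
  then show ?thesis
    by (simp add: UB)
qed

section \<open>Metric projection onto sets of positive reach\<close>

lemma closest_point_dist:
  fixes X :: "'a::euclidean_space set"
  assumes "closed X" "X \<noteq> {}"
  shows "dist x (closest_point X x) = infdist x X"
proof (rule antisym)
  obtain a where "a \<in> X" "infdist x X = dist x a"
    using infdist_attains_inf[OF assms] by blast
  then show "dist x (closest_point X x) \<le> infdist x X"
    using closest_point_le[OF assms(1)] by simp
  show "infdist x X \<le> dist x (closest_point X x)"
    by (intro infdist_le closest_point_in_set assms)
qed

lemma closest_point_eqI:
  fixes X :: "'a::euclidean_space set"
  assumes "closed X" "X \<noteq> {}" "x \<in> unp X" "a \<in> X" "dist x a = infdist x X"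
  shows "closest_point X x = a"
  using assms closest_point_dist[OF assms(1,2), of x] closest_point_in_set[OF assms(1,2), of x]
  unfolding unp_def by blast

text \<open>Apply the bound on the local reach at the foot point of \<open>x\<close> itself:
  \<open>x\<close> lies in a ball around it that consists of points with unique projection.\<close>

lemma mem_unp_if_infdist_less_reach:
  fixes X :: "'a::euclidean_space set"
  assumes "closed X" "X \<noteq> {}" "ereal (infdist x X) < reach X"
  shows "x \<in> unp X"
proof -
  let ?a = "closest_point X x"
  have "reach X \<le> reach_at X ?a"
    unfolding reach_def by (intro INF_lower closest_point_in_set assms)
  with assms(3) have "ereal (infdist x X) < reach_at X ?a"
    by (rule less_le_trans)
  then obtain s where "ball ?a s \<subseteq> unp X" "infdist x X < s"
    unfolding reach_at_def less_SUP_iff by auto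
  then show ?thesis
    using closest_point_dist[OF assms(1,2), of x] by (auto simp: dist_commute)
qed

lemma closest_point_eqI':
  fixes X :: "'a::euclidean_space set"
  assumes "closed X" "X \<noteq> {}" "ereal (infdist x X) < reach X" "a \<in> X" "dist x a = infdist x X"
  shows "closest_point X x = a"
  by (rule closest_point_eqI[OF assms(1,2) mem_unp_if_infdist_less_reach[OF assms(1-3)] assms(4,5)])

text \<open>A closed graph argument. By uniqueness the graph over \<open>S\<close> is the zero set
  of \<open>dist x p - infdist x X\<close> in \<open>S \<times> T\<close>, where \<open>T\<close> is
  a compact piece of \<open>X\<close> containing all foot points, bounded by comparison with one
  point \<open>x0\<close> of \<open>X\<close>.\<close>

lemma continuous_on_closest_point_unp:
  fixes X :: "'a::euclidean_space set"
  assumes X: "closed X" "X \<noteq> {}" and S: "bounded S" "S \<subseteq> unp X"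
  shows "continuous_on S (closest_point X)"
proof -
  obtain r where r: "\<And>x. x \<in> S \<Longrightarrow> norm x \<le> r"
    using S(1) unfolding bounded_iff by metis
  obtain x0 where x0: "x0 \<in> X"
    using X(2) by blast
  define T where "T = X \<inter> cball 0 (r + (r + norm x0))"
  have img: "closest_point X \<in> S \<rightarrow> T"
  proof
    fix x assume x: "x \<in> S"
    have "norm (closest_point X x) \<le> norm x + dist x (closest_point X x)"
      using norm_triangle_sub[of "closest_point X x" x] by (simp add: dist_norm norm_minus_commute)
    also have "dist x (closest_point X x) \<le> dist x x0"
      by (rule closest_point_le[OF X(1) x0])
    also have "dist x x0 \<le> norm x + norm x0"
      by (simp add: dist_norm norm_triangle_ineq4)
    finally show "closest_point X x \<in> T"
      using r[OF x] closest_point_in_set[OF X] by (simp add: T_def)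
  qed
  have T: "compact T"
    unfolding T_def using X(1) by (intro closed_Int_compact compact_cball)
  have "(\<lambda>x. (x, closest_point X x)) ` S = {z \<in> S \<times> T. dist (fst z) (snd z) - infdist (fst z) X = 0}"
  proof (intro equalityI subsetI)
    fix z assume "z \<in> (\<lambda>x. (x, closest_point X x)) ` S"
    then show "z \<in> {z \<in> S \<times> T. dist (fst z) (snd z) - infdist (fst z) X = 0}"
      using img closest_point_dist[OF X] by auto
  next
    fix z assume z: "z \<in> {z \<in> S \<times> T. dist (fst z) (snd z) - infdist (fst z) X = 0}"
    then have "closest_point X (fst z) = snd z"
      using S(2) by (intro closest_point_eqI[OF X]) (auto simp: T_def)
    then show "z \<in> (\<lambda>x. (x, closest_point X x)) ` S"
      using z by (intro image_eqI[of _ _ "fst z"]) auto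
  qed
  moreover have "closedin (top_of_set (S \<times> T)) {z \<in> S \<times> T. dist (fst z) (snd z) - infdist (fst z) X = 0}"
    by (intro continuous_closedin_preimage_constant continuous_intros)
  ultimately show ?thesis
    unfolding continuous_closed_graph_eq[OF T img] by simp
qed

lemma closest_on_segment:
  fixes X :: "'a::euclidean_space set"
  assumes "p \<in> X" "dist y p = infdist y X" "0 \<le> t" "t \<le> 1"
  shows "infdist (p + t *\<^sub>R (y - p)) X = t * infdist y X" "dist (p + t *\<^sub>R (y - p)) p = t * infdist y X"
proof -
  let ?x = "p + t *\<^sub>R (y - p)"
  show d: "dist ?x p = t * infdist y X"
    using assms by (simp add: dist_norm)
  show "infdist ?x X = t * infdist y X"
  proof (rule antisym)
    show "infdist ?x X \<le> t * infdist y X"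
      using infdist_le[OF assms(1), of ?x] d by simp
    have "y - ?x = (1 - t) *\<^sub>R (y - p)"
      by (simp add: algebra_simps)
    then have "dist y ?x = (1 - t) * infdist y X"
      using assms by (simp add: dist_norm)
    then show "t * infdist y X \<le> infdist ?x X"
      using infdist_triangle[of y X ?x] by (simp add: algebra_simps)
  qed
qed

text \<open>A fixed point \<open>y\<close> of \<open>y \<mapsto> x + c (x - \<xi> y)\<close> has \<open>x\<close> on the segment from \<open>\<xi> y\<close> to \<open>y\<close>,
  so \<open>x\<close> and \<open>y\<close> project to the same point.\<close>

lemma closest_point_ray_extend_step:
  fixes X :: "'a::euclidean_space set"
  assumes X: "closed X" "X \<noteq> {}" and x: "ereal (infdist x X) < reach X" "0 < infdist x X"
  obtains m where "1 < m" "infdist (closest_point X x + m *\<^sub>R (x - closest_point X x)) X = m * infdist x X"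
proof -
  let ?d = "infdist x X"
  obtain s where s: "?d < s" "ereal s < reach X"
    using ereal_dense2[OF x(1)] by auto
  define \<rho> where "\<rho> = s - ?d"
  have \<rho>: "0 < \<rho>"
    using s by (simp add: \<rho>_def)
  have tube: "infdist y X \<le> s" if "y \<in> cball x \<rho>" for y
    using infdist_triangle[of y X x] that by (simp add: \<rho>_def dist_commute)
  have unp: "cball x \<rho> \<subseteq> unp X"
    by (intro subsetI mem_unp_if_infdist_less_reach[OF X] le_less_trans[OF _ s(2)]) (simp add: tube)
  \<comment> \<open>Foot points of the ball are at distance at most \<open>?d + 2 * \<rho>\<close>
    from \<open>x\<close>, so this factor makes the map send the ball into itself, as Brouwer's
    theorem requires.\<close>
  define c where "c = \<rho> / (?d + 2 * \<rho>)"
  have c: "0 < c"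
    using \<rho> x(2) by (simp add: c_def)
  let ?f = "\<lambda>y. x + c *\<^sub>R (x - closest_point X y)"
  have "?f \<in> cball x \<rho> \<rightarrow> cball x \<rho>"
  proof
    fix y assume y: "y \<in> cball x \<rho>"
    have "dist x (closest_point X y) \<le> dist x y + dist y (closest_point X y)"
      by (rule dist_triangle)
    also have "\<dots> \<le> \<rho> + s"
      using y tube[OF y] closest_point_dist[OF X, of y] by (intro add_mono) auto
    finally have "c * dist x (closest_point X y) \<le> c * (?d + 2 * \<rho>)"
      using c by (intro mult_left_mono) (auto simp: \<rho>_def)
    also have "\<dots> = \<rho>"
      using \<rho> x(2) by (simp add: c_def)
    finally show "?f y \<in> cball x \<rho>"
      using c by (simp add: dist_norm)
  qed
  moreover have "continuous_on (cball x \<rho>) ?f"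
    by (intro continuous_intros continuous_on_closest_point_unp[OF X _ unp] bounded_cball)
  ultimately obtain y where y: "y \<in> cball x \<rho>" "?f y = y"
    using \<rho> by (auto intro: brouwer[OF compact_cball convex_cball, of x \<rho> ?f])
  define p where "p = closest_point X y"
  have p: "p \<in> X" "dist y p = infdist y X"
    unfolding p_def using closest_point_in_set[OF X] closest_point_dist[OF X] by auto
  have yp: "y - p = (1 + c) *\<^sub>R (x - p)"
    using y(2) unfolding p_def[symmetric] by (simp add: algebra_simps)
  then have xp: "x = p + (1 / (1 + c)) *\<^sub>R (y - p)"
    using c by simp
  have seg: "infdist x X = 1 / (1 + c) * infdist y X" "dist x p = 1 / (1 + c) * infdist y X"
    using closest_on_segment[OF p, of "1 / (1 + c)"] c by (simp_all flip: xp)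
  have "closest_point X x = p"
    using seg by (intro closest_point_eqI'[OF X x(1) p(1)]) simp
  moreover have "p + (1 + c) *\<^sub>R (x - p) = y"
    using yp by (simp add: algebra_simps)
  ultimately show ?thesis
    using that[of "1 + c"] seg c by simp
qed

text \<open>Continuation along the normal ray: the radii up to \<open>s\<close> at which the ray
  still realises the distance form a closed set, and its supremum cannot lie below \<open>s\<close>,
  since the one-step extension starts again there with the same foot point.\<close>

lemma closest_point_ray_extend:
  fixes X :: "'a::euclidean_space set"
  assumes X: "closed X" "X \<noteq> {}" and x: "0 < infdist x X" "infdist x X \<le> s" and s: "ereal s < reach X"
  shows "infdist (closest_point X x + (s / infdist x X) *\<^sub>R (x - closest_point X x)) X = s"
proof -
  define d where "d = infdist x X"
  define p where "p = closest_point X x"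
  define z where "z t = p + (t / d) *\<^sub>R (x - p)" for t
  have d: "0 < d" "d \<le> s"
    using x by (auto simp: d_def)
  have p: "p \<in> X" "dist x p = d"
    unfolding p_def d_def using closest_point_in_set[OF X] closest_point_dist[OF X] by auto
  have zp: "dist (z t) p = \<bar>t\<bar>" for t
    using p(2) d by (simp add: z_def dist_norm)
  have zz: "p + m *\<^sub>R (z t - p) = z (m * t)" for m t
    by (simp add: z_def)
  define I where "I = {t. d \<le> t \<and> t \<le> s \<and> infdist (z t) X = t}"
  have "d \<in> I"
    using d by (simp add: I_def z_def d_def)
  have "I = {d..s} \<inter> {t. infdist (z t) X = t}"
    by (auto simp: I_def)
  moreover have "closed {t. infdist (z t) X = t}"
    unfolding z_def by (intro closed_Collect_eq continuous_intros) (use d in auto)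
  ultimately have "closed I"
    by auto
  moreover have bdd: "bdd_above I"
    by (rule bdd_aboveI[of _ s]) (simp add: I_def)
  ultimately have \<tau>: "Sup I \<in> I"
    using \<open>d \<in> I\<close> by (intro closed_contains_Sup) auto
  define \<tau> where "\<tau> = Sup I"
  have \<tau>': "d \<le> \<tau>" "\<tau> \<le> s" "infdist (z \<tau>) X = \<tau>"
    using \<tau> unfolding \<tau>_def[symmetric] by (auto simp: I_def)
  have "\<tau> = s"
  proof (rule ccontr)
    assume "\<tau> \<noteq> s"
    with \<tau>' have "\<tau> < s"
      by simp
    have r: "ereal (infdist (z \<tau>) X) < reach X"
      by (rule le_less_trans[OF _ s]) (use \<tau>' in simp)
    have cp: "closest_point X (z \<tau>) = p"
      using \<tau>' d zp[of \<tau>] by (intro closest_point_eqI'[OF X r p(1)]) auto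
    obtain m where m: "1 < m" "infdist (z (m * \<tau>)) X = m * \<tau>"
      using closest_point_ray_extend_step[OF X r] \<tau>' d unfolding cp zz by auto
    \<comment> \<open>The extension may overshoot \<open>s\<close>. Points before its end still
      project to \<open>p\<close>, so it can be cut back to \<open>s\<close>.\<close>
    define t where "t = min s (m * \<tau>)"
    have "1 * \<tau> < m * \<tau>"
      using m d \<tau>' by (intro mult_strict_right_mono) auto
    then have t: "\<tau> < t" "t \<le> s" "t \<le> m * \<tau>" "0 < t" "0 < m * \<tau>"
      using \<open>\<tau> < s\<close> d \<tau>' by (auto simp: t_def)
    have "infdist (z (t / (m * \<tau>) * (m * \<tau>))) X = t / (m * \<tau>) * (m * \<tau>)"
      using closest_on_segment(1)[OF p(1), of "z (m * \<tau>)" "t / (m * \<tau>)"] zp[of "m * \<tau>"] t m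
      unfolding zz by simp
    moreover have "t / u * u = t" if "0 < u" for u :: real
      using that by simp
    ultimately have "infdist (z t) X = t"
      using t(5) by metis
    then have "t \<in> I"
      using t \<tau>' by (simp add: I_def)
    then show False
      using cSup_upper[OF _ bdd, of t] t(1) unfolding \<tau>_def by simp
  qed
  then show ?thesis
    using \<tau>' by (simp add: z_def p_def d_def)
qed

text \<open>Push \<open>x\<close> along its normal ray to a point \<open>y\<close> at distance
  \<open>s2\<close> from \<open>X\<close>. No point of \<open>X\<close> lies in the open ball of
  radius \<open>s2\<close> around \<open>y\<close>; expanding this condition at \<open>q\<close>
  gives growth rate \<open>1 - d / s2\<close> at \<open>x\<close>, where \<open>d\<close> is its
  distance, hence the uniform rate for \<open>d < s1\<close>.\<close>

lemma strongly_projects_closest_point: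
  fixes X :: "'a::euclidean_space set"
  assumes X: "closed X" "X \<noteq> {}" and s: "0 < s1" "s1 < s2" "ereal s2 < reach X"
  shows "strongly_projects X (1 - s1 / s2) {x. infdist x X < s1} (closest_point X)"
  unfolding strongly_projects_def
proof (intro ballI conjI)
  fix x q assume x: "x \<in> {x. infdist x X < s1}" and q: "q \<in> X"
  define d where "d = infdist x X"
  define p where "p = closest_point X x"
  have d: "0 \<le> d" "d < s1"
    using x by (auto simp: d_def infdist_nonneg)
  have p: "p \<in> X" "dist x p = d"
    unfolding p_def d_def using closest_point_in_set[OF X] closest_point_dist[OF X] by auto
  have "(norm (x - p))\<^sup>2 + (1 - d / s2) * (norm (q - p))\<^sup>2 \<le> (norm (x - q))\<^sup>2"
  proof (cases "d = 0")
    case True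
    then show ?thesis
      using p by (simp add: norm_minus_commute)
  next
    case False
    define m where "m = s2 / d"
    have m: "0 < m" "1 / m = d / s2"
      using False d s by (auto simp: m_def)
    define y where "y = p + m *\<^sub>R (x - p)"
    have "infdist y X = s2"
      using closest_point_ray_extend[OF X, of x s2] False d s unfolding y_def p_def m_def d_def by auto
    then have "s2 \<le> norm (y - q)"
      using infdist_le[OF q, of y] by (simp add: dist_norm)
    moreover have "norm (m *\<^sub>R (x - p)) = s2"
      using p(2) False d s by (simp add: m_def dist_norm)
    ultimately have "(norm (m *\<^sub>R (x - p)))\<^sup>2 \<le> (norm (m *\<^sub>R (x - p) - (q - p)))\<^sup>2"
      by (intro power_mono) (auto simp: y_def algebra_simps)
    also have "\<dots> = (norm (m *\<^sub>R (x - p)))\<^sup>2 - 2 * m * ((x - p) \<bullet> (q - p)) + (norm (q - p))\<^sup>2"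
      by (simp add: power2_norm_eq_inner inner_diff_left inner_diff_right inner_commute algebra_simps)
    finally have "2 * m * ((x - p) \<bullet> (q - p)) \<le> (norm (q - p))\<^sup>2"
      by simp
    then have "2 * ((x - p) \<bullet> (q - p)) \<le> 1 / m * (norm (q - p))\<^sup>2"
      using m by (simp add: field_simps)
    moreover have "(norm (x - q))\<^sup>2 = (norm (x - p))\<^sup>2 - 2 * ((x - p) \<bullet> (q - p)) + (norm (q - p))\<^sup>2"
      by (simp add: power2_norm_eq_inner inner_diff_left inner_diff_right inner_commute algebra_simps)
    ultimately show ?thesis
      by (simp add: m(2) algebra_simps)
  qed
  moreover have "(1 - s1 / s2) * (norm (q - p))\<^sup>2 \<le> (1 - d / s2) * (norm (q - p))\<^sup>2"
    using d s by (intro mult_right_mono) (auto simp: divide_right_mono)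
  ultimately show "(norm (x - closest_point X x))\<^sup>2 + (1 - s1 / s2) * (norm (q - closest_point X x))\<^sup>2 \<le> (norm (x - q))\<^sup>2"
    unfolding p_def by linarith
qed (rule closest_point_in_set[OF X])

section \<open>The local Steiner formula\<close>

definition tube_over :: "'a::euclidean_space set \<Rightarrow> real \<Rightarrow> 'a set \<Rightarrow> 'a set" where
  "tube_over X s B = {x. infdist x X \<le> s \<and> closest_point X x \<in> B}"

abbreviation tube_volume :: "'a::euclidean_space set \<Rightarrow> real \<Rightarrow> 'a set \<Rightarrow> real" where
  "tube_volume X s B \<equiv> measure lebesgue (tube_over X s B)"

text \<open>Two margins are needed: \<open>s1\<close> gives an open neighbourhood of the tube, and
  \<open>s2\<close> beyond it keeps the growth rate \<open>1 - s1 / s2\<close> positive.\<close>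

lemma obtain_radii_below_reach:
  assumes "0 \<le> s" "ereal s < reach X"
  obtains s1 s2 where "s < s1" "0 < s1" "s1 < s2" "ereal s2 < reach X"
proof -
  obtain s2 where s2: "s < s2" "ereal s2 < reach X"
    using ereal_dense2[OF assms(2)] by auto
  obtain s1 where "s < s1" "s1 < s2"
    using dense[OF s2(1)] by blast
  then show ?thesis
    using that[of s1 s2] s2 assms by simp
qed

lemma continuous_on_closest_point_tube:
  fixes X :: "'a::euclidean_space set"
  assumes X: "closed X" "X \<noteq> {}" and s: "0 \<le> s" "ereal s < reach X"
  shows "continuous_on {x. infdist x X \<le> s} (closest_point X)"
proof -
  obtain s1 s2 where s12: "s < s1" "0 < s1" "s1 < s2" "ereal s2 < reach X"
    using obtain_radii_below_reach[OF s] .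
  have "0 < 1 - s1 / s2"
    using s12 by simp
  then have "continuous_on {x. infdist x X < s1} (closest_point X)"
    by (rule lipschitz_on_continuous_on[OF strongly_projects_lipschitz[OF strongly_projects_closest_point[OF X s12(2-4)]]])
  then show ?thesis
    by (rule continuous_on_subset) (use s12(1) in auto)
qed

lemma tube_over_borel:
  fixes X :: "'a::euclidean_space set"
  assumes X: "closed X" "X \<noteq> {}" and s: "0 \<le> s" "ereal s < reach X" and B: "B \<in> sets borel"
  shows "tube_over X s B \<in> sets borel"
proof -
  let ?D = "{x. infdist x X \<le> s}"
  have D: "?D \<in> sets borel"
    by (intro borel_closed closed_Collect_le continuous_intros)
  have "closest_point X \<in> borel_measurable (restrict_space borel ?D)"
    by (rule borel_measurable_continuous_on_restrict[OF continuous_on_closest_point_tube[OF X s]])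
  from measurable_sets[OF this B] have "closest_point X -` B \<inter> ?D \<in> sets (restrict_space borel ?D)"
    by (simp add: space_restrict_space)
  then have "closest_point X -` B \<inter> ?D \<in> sets borel"
    using D by (simp add: sets_restrict_space_iff)
  moreover have "closest_point X -` B \<inter> ?D = tube_over X s B"
    by (auto simp: tube_over_def)
  ultimately show ?thesis
    by simp
qed

lemma bounded_tube_over:
  fixes X :: "'a::euclidean_space set"
  assumes X: "closed X" "X \<noteq> {}" and B: "bounded B"
  shows "bounded (tube_over X s B)"
proof -
  obtain r where r: "\<And>x. x \<in> B \<Longrightarrow> norm x \<le> r"
    using B unfolding bounded_iff by metis
  have "norm x \<le> r + s" if "x \<in> tube_over X s B" for x
    using that r[of "closest_point X x"] closest_point_dist[OF X, of x]
      norm_triangle_sub[of x "closest_point X x"]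
    by (auto simp: tube_over_def dist_norm)
  then show ?thesis
    unfolding bounded_iff by blast
qed

lemma tube_over_lmeasurable:
  fixes X :: "'a::euclidean_space set"
  assumes "closed X" "X \<noteq> {}" "0 \<le> s" "ereal s < reach X" "B \<in> sets borel" "bounded B"
  shows "tube_over X s B \<in> lmeasurable"
  by (intro bounded_set_imp_lmeasurable bounded_tube_over sets_completionI_sets) (use tube_over_borel assms in auto)

text \<open>Onto is the substantial direction: a point \<open>y\<close> of the thin tube is moved
  out along its normal ray by the factor \<open>1 / l\<close>, which preserves the foot point
  because the new distance stays below the reach. Points of \<open>X\<close> define no ray and are
  left out.\<close>

lemma shrink_image_tube:
  fixes X :: "'a::euclidean_space set"
  assumes X: "closed X" "X \<noteq> {}" and s: "0 < s" "ereal s < reach X" and l: "l \<in> {0<..1}"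
  shows "shrink (closest_point X) l ` (tube_over X s B - X) = tube_over X (l * s) B - X"
proof (intro equalityI subsetI)
  fix y assume "y \<in> shrink (closest_point X) l ` (tube_over X s B - X)"
  then obtain x where x: "x \<in> tube_over X s B - X" "y = shrink (closest_point X) l x"
    by auto
  define p where "p = closest_point X x"
  have p: "p \<in> X" "dist x p = infdist x X"
    unfolding p_def using closest_point_in_set[OF X] closest_point_dist[OF X] by auto
  have dx: "0 < infdist x X" "infdist x X \<le> s" "p \<in> B"
    using x(1) X by (auto simp: tube_over_def p_def infdist_pos_not_in_closed)
  have y: "y = p + l *\<^sub>R (x - p)"
    unfolding x(2) shrink_def p_def[symmetric] by (simp add: algebra_simps)
  have seg: "infdist y X = l * infdist x X" "dist y p = l * infdist x X"
    unfolding y using closest_on_segment[OF p, of l] l by auto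
  have "l * infdist x X \<le> 1 * s"
    using l dx by (intro mult_mono) auto
  then have "ereal (infdist y X) < reach X"
    by (intro le_less_trans[OF _ s(2)]) (simp add: seg)
  then have "closest_point X y = p"
    using seg by (intro closest_point_eqI'[OF X _ p(1)]) auto
  moreover have "l * infdist x X \<le> l * s"
    using l dx by simp
  moreover have "y \<notin> X"
    using seg(1) l dx by auto
  ultimately show "y \<in> tube_over X (l * s) B - X"
    using dx(3) by (simp add: tube_over_def seg)
next
  fix y assume y: "y \<in> tube_over X (l * s) B - X"
  define p where "p = closest_point X y"
  define d where "d = infdist y X"
  have p: "p \<in> X" "dist y p = d"
    unfolding p_def d_def using closest_point_in_set[OF X] closest_point_dist[OF X] by auto
  have d: "0 < d" "d \<le> l * s" "p \<in> B"
    using y X by (auto simp: tube_over_def p_def d_def infdist_pos_not_in_closed)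
  define x where "x = p + (1 / l) *\<^sub>R (y - p)"
  have dl: "d / l \<le> s" "d \<le> d / l"
    using d l by (auto simp: field_simps)
  then have r: "ereal (d / l) < reach X"
    by (intro le_less_trans[OF _ s(2)]) simp
  have "p + (d / l / d) *\<^sub>R (y - p) = x"
    using d by (simp add: x_def)
  then have dx: "infdist x X = d / l"
    using closest_point_ray_extend[OF X, of y "d / l"] d dl r unfolding p_def[symmetric] d_def[symmetric] by simp
  have "dist x p = d / l"
    using p(2) l by (simp add: x_def dist_norm)
  then have cx: "closest_point X x = p"
    using r dx by (intro closest_point_eqI'[OF X _ p(1)]) auto
  have "x \<notin> X"
    using dx d l by auto
  then have "x \<in> tube_over X s B - X"
    using dx dl cx d by (simp add: tube_over_def)
  moreover have "shrink (closest_point X) l x = y"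
    unfolding shrink_def cx using l by (simp add: x_def algebra_simps)
  ultimately show "y \<in> shrink (closest_point X) l ` (tube_over X s B - X)"
    by (metis imageI)
qed

lemma measure_tube_over:
  fixes X :: "'a::euclidean_space set"
  assumes X: "closed X" "X \<noteq> {}" and s: "0 \<le> s" "ereal s < reach X" and B: "B \<in> sets borel" "bounded B"
  shows "tube_volume X s B = measure lebesgue (X \<inter> B) + measure lebesgue (tube_over X s B - X)"
proof -
  have sub: "X \<inter> B \<subseteq> tube_over X s B"
    using s(1) by (auto simp: tube_over_def closest_point_self)
  have "tube_over X s B - X = tube_over X s B - X \<inter> B"
    by (auto simp: tube_over_def closest_point_self)
  moreover have "X \<inter> B \<in> sets lebesgue"
    using X(1) B(1) by (intro sets_completionI_sets) (simp add: borel_closed sets.Int)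
  ultimately show ?thesis
    using measurable_measure_Diff[OF tube_over_lmeasurable[OF X s B] _ sub] by simp
qed

text \<open>Shrinking the tube of radius \<open>s\<close> reaches the radii in
  \<open>{0<..s}\<close>. The radius 0 is added by continuity: the tubes without \<open>X\<close>
  decrease to the empty set, so their polynomial vanishes at 0, in agreement with the tube of radius
  0, which is \<open>X \<inter> B\<close>.\<close>

lemma polynomial_on_measure_tube:
  fixes X :: "'a::euclidean_space set"
  assumes X: "closed X" "X \<noteq> {}" and s: "0 < s" "ereal s < reach X" and B: "B \<in> sets borel" "bounded B"
  shows "polynomial_on DIM('a) {0..s} (\<lambda>t. tube_volume X t B)"
proof -
  let ?A = "\<lambda>t. tube_over X t B - X"
  have s0: "0 \<le> s"
    using s by simp
  have inX: "x \<in> X" if "infdist x X \<le> 0" for x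
    using that infdist_nonneg[of x X] in_closed_iff_infdist_zero[OF X, of x] by simp
  obtain s1 s2 where s12: "s < s1" "0 < s1" "s1 < s2" "ereal s2 < reach X"
    using obtain_radii_below_reach[OF s0 s(2)] .
  have below: "ereal t < reach X" if "t \<le> s" for t
    by (rule le_less_trans[OF _ s(2)]) (use that in simp)
  have "shrink_polynomial (closest_point X) (?A s)"
  proof (rule shrink_polynomial_borel[OF X(1) strongly_projects_closest_point[OF X s12(2-4)]])
    show "0 < 1 - s1 / s2"
      using s12 by simp
    show "open {x. infdist x X < s1}"
      by (intro open_Collect_less continuous_intros)
    show "?A s \<in> sets borel"
      using X(1) by (intro sets.Diff tube_over_borel[OF X s0 s(2) B(1)]) (simp add: borel_closed)
    show "bounded (?A s)"
      by (rule bounded_subset[OF bounded_tube_over[OF X B(2)]]) auto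
    show "?A s \<subseteq> {x. infdist x X < s1}"
      using s12(1) by (auto simp: tube_over_def)
  qed
  then obtain p where p: "degree p \<le> DIM('a)" "\<And>l. l \<in> {0<..1} \<Longrightarrow> measure lebesgue (?A (l * s)) = poly p l"
    unfolding shrink_polynomial_def polynomial_on_def by (auto simp: shrink_image_tube[OF X s])
  have "poly p 0 = 0"
  proof -
    define l where "l m = inverse (real (Suc m))" for m
    have l: "l m \<in> {0<..1}" for m
      by (auto simp: l_def field_simps)
    have l0: "l \<longlonglongrightarrow> 0"
      unfolding l_def by (rule LIMSEQ_inverse_real_of_nat)
    have ls: "0 \<le> l m * s" "l m * s \<le> s" for m
      using l[of m] s by (auto simp: mult_left_le_one_le)
    have lim: "(\<lambda>m. measure lebesgue (?A (l m * s))) \<longlonglongrightarrow> measure lebesgue (\<Inter>m. ?A (l m * s))"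
    proof (rule Lim_measure_decseq)
      have meas: "?A (l m * s) \<in> lmeasurable" for m
        using X(1) by (intro fmeasurable_Diff tube_over_lmeasurable[OF X ls(1) below[OF ls(2)] B] sets_completionI_sets)
          (simp add: borel_closed)
      show "range (\<lambda>m. ?A (l m * s)) \<subseteq> sets lebesgue"
        using meas by (auto dest: fmeasurableD)
      show "emeasure lebesgue (?A (l m * s)) \<noteq> \<infinity>" for m
        using fmeasurableD2[OF meas] by simp
      have "l (Suc m) * s \<le> l m * s" for m
        using s by (intro mult_right_mono) (auto simp: l_def field_simps)
      then show "decseq (\<lambda>m. ?A (l m * s))"
        by (intro decseq_SucI) (auto simp: tube_over_def intro: order_trans)
    qed
    have empty: "(\<Inter>m. ?A (l m * s)) = {}"
    proof -
      have "x \<in> X" if x: "\<And>m. infdist x X \<le> l m * s" for x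
      proof -
        have "(\<lambda>m. l m * s) \<longlonglongrightarrow> 0 * s"
          by (intro tendsto_intros l0)
        then have "infdist x X \<le> 0 * s"
          by (rule LIMSEQ_le_const) (use x in blast)
        then show ?thesis
          by (intro inX) simp
      qed
      then show ?thesis
        by (auto simp: tube_over_def)
    qed
    have "(\<lambda>m. measure lebesgue (?A (l m * s))) \<longlonglongrightarrow> poly p 0"
      unfolding p(2)[OF l] by (rule isCont_tendsto_compose[OF poly_isCont l0])
    then show ?thesis
      using LIMSEQ_unique[OF lim] unfolding empty by simp
  qed
  define c where "c = measure lebesgue (X \<inter> B)"
  have "tube_volume X t B = poly ([:c:] + pcompose p [:0, 1 / s:]) t" if t: "t \<in> {0..s}" for t
  proof (cases "t = 0")
    case True
    have "?A 0 = {}"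
      using inX by (auto simp: tube_over_def)
    then have "measure lebesgue (?A 0) = 0"
      by (simp only: measure_empty)
    then show ?thesis
      using measure_tube_over[OF X _ below B, of 0] s \<open>poly p 0 = 0\<close> True by (simp add: c_def poly_pcompose)
  next
    case False
    then have "t / s \<in> {0<..1}"
      using t s by auto
    from p(2)[OF this] show ?thesis
      using measure_tube_over[OF X _ below B, of t] s t by (simp add: c_def poly_pcompose)
  qed
  moreover have "degree ([:c:] + pcompose p [:0, 1 / s:]) \<le> DIM('a)"
    using p(1) by (intro degree_add_le) (simp_all add: degree_pcompose)
  ultimately show ?thesis
    unfolding polynomial_on_def by blast
qed

text \<open>\<open>steiner_coeffs\<close> asks for one set of coefficients at all radii below the
  reach; the polynomial of a longer interval agrees with \<open>p\<close> on \<open>{0..s}\<close>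
  and is therefore the same.\<close>

lemma steiner_polynomial:
  fixes X :: "'a::euclidean_space set"
  assumes X: "closed X" "X \<noteq> {}" and s: "0 < s" "ereal s < reach X" and B: "B \<in> sets borel" "bounded B"
    and p: "degree p \<le> DIM('a)" "\<And>t. t \<in> {0..s} \<Longrightarrow> tube_volume X t B = poly p t"
    and t: "0 \<le> t" "ereal t < reach X"
  shows "tube_volume X t B = poly p t"
proof (cases "t \<le> s")
  case True
  then show ?thesis
    using p(2) t by simp
next
  case False
  then obtain q where q: "\<And>u. u \<in> {0..t} \<Longrightarrow> tube_volume X u B = poly q u"
    using polynomial_on_measure_tube[OF X _ t(2) B] s by (auto simp: polynomial_on_def)
  have "p = q"
  proof (rule polynomial_on_unique)
    show "infinite {0..s}"
      using s by (simp add: infinite_Icc)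
    show "poly p u = poly q u" if "u \<in> {0..s}" for u
      using p(2)[OF that] q[of u] that False by simp
  qed
  then show ?thesis
    using q[of t] t by simp
qed

text \<open>This resolves the definite description: the coefficients of \<open>p\<close>, divided by
  the ball volumes, satisfy the Steiner formula, and any other solution yields the same polynomial
  and hence the same entry at \<open>k\<close>.\<close>

lemma federer_curvature_eq_coeff:
  fixes X :: "'a::euclidean_space set"
  assumes X: "closed X" "X \<noteq> {}" and s: "0 < s" "ereal s < reach X" and B: "B \<in> sets borel" "bounded B"
    and p: "degree p \<le> DIM('a)" "\<And>t. t \<in> {0..s} \<Longrightarrow> tube_volume X t B = poly p t"
    and k: "k \<le> DIM('a)"
  shows "federer_curvature k X B = coeff p (DIM('a) - k) / unit_ball_vol (real (DIM('a) - k))"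
proof -
  let ?n = "DIM('a)"
  define u where "u i = unit_ball_vol (real (?n - i))" for i
  have steiner: "steiner_coeffs X B \<psi> \<longleftrightarrow> (\<forall>t. 0 \<le> t \<and> ereal t < reach X \<longrightarrow>
      tube_volume X t B = (\<Sum>i\<le>?n. t ^ (?n - i) * u i * \<psi> i))" for \<psi>
    by (simp only: steiner_coeffs_def tube_over_def u_def)
  have u: "u i \<noteq> 0" for i
    unfolding u_def using unit_ball_vol_pos[OF of_nat_0_le_iff, of "?n - i"] by (metis less_irrefl)
  define \<phi> where "\<phi> i = coeff p (?n - i) / u i" for i
  have "(\<Sum>i\<le>?n. t ^ (?n - i) * u i * \<phi> i) = poly p t" for t
  proof -
    have "(\<Sum>i\<le>?n. t ^ (?n - i) * u i * \<phi> i) = (\<Sum>i\<le>?n. coeff p (?n - i) * t ^ (?n - i))"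
      using u by (intro sum.cong refl) (simp add: \<phi>_def)
    also have "\<dots> = (\<Sum>i\<le>?n. coeff p i * t ^ i)"
      by (rule sum.reindex_bij_witness[where i = "\<lambda>i. ?n - i" and j = "\<lambda>i. ?n - i"]) auto
    also have "\<dots> = poly (\<Sum>i\<le>?n. monom (coeff p i) i) t"
      by (simp add: poly_sum poly_monom)
    finally show ?thesis
      by (simp add: poly_as_sum_of_monoms'[OF p(1)])
  qed
  then have "steiner_coeffs X B \<phi>"
    unfolding steiner using steiner_polynomial[OF X s B p] by simp
  moreover have "\<psi> k = \<phi> k" if \<psi>: "steiner_coeffs X B \<psi>" for \<psi>
  proof -
    define q where "q = (\<Sum>i\<le>?n. monom (u i * \<psi> i) (?n - i))"
    have "p = q"
    proof (rule polynomial_on_unique)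
      show "infinite {0..s}"
        using s by (simp add: infinite_Icc)
      show "poly p t = poly q t" if t: "t \<in> {0..s}" for t
      proof -
        have "ereal t < reach X"
          by (rule le_less_trans[OF _ s(2)]) (use t in simp)
        then have "tube_volume X t B = (\<Sum>i\<le>?n. t ^ (?n - i) * u i * \<psi> i)"
          using \<psi> t unfolding steiner by simp
        then show ?thesis
          using p(2)[OF t] by (simp add: q_def poly_sum poly_monom mult_ac)
      qed
    qed
    then have "coeff p (?n - k) = (\<Sum>i\<le>?n. if ?n - i = ?n - k then u i * \<psi> i else 0)"
      by (simp add: q_def coeff_sum)
    also have "\<dots> = (\<Sum>i\<le>?n. if i = k then u i * \<psi> i else 0)"
      by (rule sum.cong[OF refl]) (use k in auto)
    also have "\<dots> = u k * \<psi> k"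
      using k by simp
    finally show ?thesis
      using u[of k] by (simp add: \<phi>_def)
  qed
  ultimately have "(THE c. \<exists>\<psi>. steiner_coeffs X B \<psi> \<and> \<psi> k = c) = \<phi> k"
    by (intro the_equality) blast+
  then show ?thesis
    unfolding federer_curvature_def \<phi>_def u_def .
qed

text \<open>The weights depend neither on \<open>B\<close> nor on \<open>X\<close>, only on the
  nodes. Additivity, continuity along increasing sequences and locality of the curvatures thus
  reduce to statements about tube volumes at finitely many small radii.\<close>

lemma federer_curvature_eq_sum:
  fixes X :: "'a::euclidean_space set"
  assumes X: "closed X" "X \<noteq> {}" and s: "0 < s" "ereal s < reach X" and B: "B \<in> sets borel" "bounded B"
    and t: "inj_on t {..DIM('a)}" "t ` {..DIM('a)} \<subseteq> {0..s}" and k: "k \<le> DIM('a)"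
  shows "federer_curvature k X B = (\<Sum>j\<le>DIM('a). tube_volume X (t j) B *
      (coeff (lagrange_basis t DIM('a) j) (DIM('a) - k) / unit_ball_vol (real (DIM('a) - k))))"
proof -
  obtain p where p: "degree p \<le> DIM('a)" "\<And>t. t \<in> {0..s} \<Longrightarrow> tube_volume X t B = poly p t"
    using polynomial_on_measure_tube[OF X s B] by (auto simp: polynomial_on_def)
  have "coeff p (DIM('a) - k) = (\<Sum>j\<le>DIM('a). poly p (t j) * coeff (lagrange_basis t DIM('a) j) (DIM('a) - k))"
    by (subst lagrange_interpolation[OF p(1) t(1)]) (simp add: coeff_sum)
  also have "\<dots> = (\<Sum>j\<le>DIM('a). tube_volume X (t j) B * coeff (lagrange_basis t DIM('a) j) (DIM('a) - k))"
    using t(2) p(2) by (intro sum.cong refl) auto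
  finally have "coeff p (DIM('a) - k) / unit_ball_vol (real (DIM('a) - k)) = (\<Sum>j\<le>DIM('a). tube_volume X (t j) B *
      (coeff (lagrange_basis t DIM('a) j) (DIM('a) - k) / unit_ball_vol (real (DIM('a) - k))))"
    by (simp add: sum_divide_distrib)
  then show ?thesis
    using federer_curvature_eq_coeff[OF X s B p k] by simp
qed

section \<open>Additivity, locality and total variation\<close>

lemma obtain_nodes:
  assumes "0 < (s::real)"
  obtains t :: "nat \<Rightarrow> real" where "inj_on t {..n}" "t ` {..n} \<subseteq> {0..s}"
  using infinite_obtain_nodes[of "{0..s}" n] assms by (auto simp: infinite_Icc)

lemma ereal_less_of_le: "a \<le> b \<Longrightarrow> ereal b < c \<Longrightarrow> ereal a < c"
  by (rule le_less_trans[of "ereal a" "ereal b"]) simp_all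

lemma obtain_radius_below_reach:
  assumes "0 < reach X" "0 < e"
  obtains s where "0 < s" "s < e" "ereal s < reach X"
proof -
  obtain r where r: "0 < r" "ereal r < reach X"
    using ereal_dense2[OF assms(1)] by (auto simp: zero_ereal_def)
  define s where "s = min r (e / 2)"
  have "ereal s < reach X"
    by (rule le_less_trans[OF _ r(2)]) (simp add: s_def)
  then show ?thesis
    using that[of s] r assms by (simp add: s_def)
qed

lemma federer_curvature_Un:
  fixes X :: "'a::euclidean_space set"
  assumes X: "closed X" "X \<noteq> {}" "0 < reach X" and k: "k \<le> DIM('a)"
    and A: "A \<in> sets borel" "bounded A" and B: "B \<in> sets borel" "bounded B" and disj: "A \<inter> B = {}"
  shows "federer_curvature k X (A \<union> B) = federer_curvature k X A + federer_curvature k X B"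
proof -
  obtain s where s: "0 < s" "ereal s < reach X"
    using obtain_radius_below_reach[OF X(3) zero_less_one] .
  obtain t where t: "inj_on t {..DIM('a)}" "t ` {..DIM('a)} \<subseteq> {0..s}"
    using obtain_nodes[OF s(1)] .
  have meas: "tube_volume X (t j) (A \<union> B) =
      tube_volume X (t j) A + tube_volume X (t j) B" if "j \<le> DIM('a)" for j
  proof -
    have "t j \<in> {0..s}"
      using t(2) that by blast
    then have tj: "0 \<le> t j" "ereal (t j) < reach X"
      using ereal_less_of_le[OF _ s(2), of "t j"] by auto
    note lm = tube_over_lmeasurable[OF X(1,2) tj A] tube_over_lmeasurable[OF X(1,2) tj B]
    have "tube_over X (t j) (A \<union> B) = tube_over X (t j) A \<union> tube_over X (t j) B"
      by (auto simp: tube_over_def)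
    moreover have "tube_over X (t j) A \<inter> tube_over X (t j) B = {}"
      using disj by (auto simp: tube_over_def)
    ultimately show ?thesis
      using measure_Union[of lebesgue "tube_over X (t j) A" "tube_over X (t j) B"]
        fmeasurableD2[OF lm(1)] fmeasurableD2[OF lm(2)] fmeasurableD[OF lm(1)] fmeasurableD[OF lm(2)] by simp
  qed
  have AB: "A \<union> B \<in> sets borel" "bounded (A \<union> B)"
    using A B by auto
  let ?c = "\<lambda>j. coeff (lagrange_basis t DIM('a) j) (DIM('a) - k) / unit_ball_vol (real (DIM('a) - k))"
  have "federer_curvature k X (A \<union> B) = (\<Sum>j\<le>DIM('a).
      (tube_volume X (t j) A + tube_volume X (t j) B) * ?c j)"
    unfolding federer_curvature_eq_sum[OF X(1,2) s AB t k] by (intro sum.cong refl) (simp only: meas atMost_iff)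
  then show ?thesis
    unfolding federer_curvature_eq_sum[OF X(1,2) s A t k] federer_curvature_eq_sum[OF X(1,2) s B t k]
    by (simp only: distrib_right sum.distrib)
qed

lemma federer_curvature_sum:
  fixes X :: "'a::euclidean_space set"
  assumes X: "closed X" "X \<noteq> {}" "0 < reach X" and k: "k \<le> DIM('a)" and I: "finite I"
    and A: "\<And>i. i \<in> I \<Longrightarrow> A i \<in> sets borel" "\<And>i. i \<in> I \<Longrightarrow> bounded (A i)" and disj: "disjoint_family_on A I"
  shows "federer_curvature k X (\<Union>i\<in>I. A i) = (\<Sum>i\<in>I. federer_curvature k X (A i))"
  using I A disj
proof (induction rule: finite_induct)
  case empty
  \<comment> \<open>Additivity on two empty sets makes the value equal to its double.\<close>
  show ?case
    using federer_curvature_Un[OF X k, of "{}" "{}"] by simp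
next
  case (insert i I)
  have "A i \<inter> (\<Union>i\<in>I. A i) = {}"
    using insert.hyps(2) insert.prems(3) by (fastforce simp: disjoint_family_on_def)
  then have "federer_curvature k X (A i \<union> (\<Union>i\<in>I. A i)) =
      federer_curvature k X (A i) + federer_curvature k X (\<Union>i\<in>I. A i)"
    using insert.prems insert.hyps(1)
    by (intro federer_curvature_Un[OF X k] sets.finite_UN bounded_UN) auto
  then show ?case
    using insert.IH insert.prems insert.hyps by (simp add: disjoint_family_on_def)
qed

lemma tendsto_federer_curvature_incseq:
  fixes X :: "'a::euclidean_space set"
  assumes X: "closed X" "X \<noteq> {}" "0 < reach X" and k: "k \<le> DIM('a)"
    and B: "\<And>m::nat. B m \<in> sets borel" "incseq B" "bounded (\<Union>m. B m)"
  shows "(\<lambda>m. federer_curvature k X (B m)) \<longlonglongrightarrow> federer_curvature k X (\<Union>m. B m)"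
proof -
  obtain s where s: "0 < s" "ereal s < reach X"
    using obtain_radius_below_reach[OF X(3) zero_less_one] .
  obtain t where t: "inj_on t {..DIM('a)}" "t ` {..DIM('a)} \<subseteq> {0..s}"
    using obtain_nodes[OF s(1)] .
  have bB: "bounded (B m)" for m
    by (rule bounded_subset[OF B(3)]) auto
  have uB: "(\<Union>m. B m) \<in> sets borel"
    using B(1) by (intro sets.countable_UN) auto
  have "(\<lambda>m. tube_volume X (t j) (B m)) \<longlonglongrightarrow> tube_volume X (t j) (\<Union>m. B m)"
    if "j \<le> DIM('a)" for j
  proof -
    have "t j \<in> {0..s}"
      using t(2) that by blast
    then have tj: "0 \<le> t j" "ereal (t j) < reach X"
      using ereal_less_of_le[OF _ s(2), of "t j"] by auto
    have eq: "tube_over X (t j) (\<Union>m. B m) = (\<Union>m. tube_over X (t j) (B m))"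
      by (auto simp: tube_over_def)
    show ?thesis
      unfolding eq
    proof (rule Lim_measure_incseq)
      show "range (\<lambda>m. tube_over X (t j) (B m)) \<subseteq> sets lebesgue"
        using tube_over_lmeasurable[OF X(1,2) tj B(1) bB] by (auto dest: fmeasurableD)
      show "incseq (\<lambda>m. tube_over X (t j) (B m))"
        using B(2) by (auto simp: incseq_def tube_over_def)
      show "emeasure lebesgue (\<Union>m. tube_over X (t j) (B m)) \<noteq> \<infinity>"
        using fmeasurableD2[OF tube_over_lmeasurable[OF X(1,2) tj uB B(3)]] by (simp add: eq)
    qed
  qed
  then show ?thesis
    unfolding federer_curvature_eq_sum[OF X(1,2) s B(1) bB t k] federer_curvature_eq_sum[OF X(1,2) s uB B(3) t k]
    by (intro tendsto_sum tendsto_mult tendsto_const) auto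
qed

text \<open>If \<open>Y\<close> had a point closer to \<open>x\<close> than the foot point
  \<open>p\<close> in \<open>X\<close>, it would be within \<open>2 * s\<close> of \<open>p\<close>,
  hence inside the ball where the two sets agree, and so would belong to \<open>X\<close>.\<close>

lemma tube_over_cong:
  fixes X Y :: "'a::euclidean_space set"
  assumes X: "closed X" "X \<noteq> {}" and Y: "closed Y" "Y \<noteq> {}"
    and e: "\<And>p. p \<in> B \<Longrightarrow> X \<inter> ball p e = Y \<inter> ball p e" "0 < e" "2 * s < e" "ereal s < reach Y"
  shows "tube_over X s B \<subseteq> tube_over Y s B"
proof
  fix x assume x: "x \<in> tube_over X s B"
  define p where "p = closest_point X x"
  have p: "p \<in> X" "dist x p = infdist x X" "p \<in> B" "infdist x X \<le> s"
    using closest_point_in_set[OF X] closest_point_dist[OF X] x by (auto simp: p_def tube_over_def)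
  have eq: "X \<inter> ball p e = Y \<inter> ball p e"
    by (rule e(1)[OF p(3)])
  have "p \<in> X \<inter> ball p e"
    using p(1) e(2) by simp
  then have pY: "p \<in> Y"
    unfolding eq by simp
  have "dist x p \<le> infdist x Y"
  proof (rule ccontr)
    assume "\<not> dist x p \<le> infdist x Y"
    moreover define q where "q = closest_point Y x"
    ultimately have q: "q \<in> Y" "dist x q < dist x p"
      using closest_point_in_set[OF Y] closest_point_dist[OF Y, of x] by auto
    have "dist p q < e"
      using dist_triangle[of p q x] q p e(3) by (simp add: dist_commute)
    then have "q \<in> Y \<inter> ball p e"
      using q by simp
    then have "q \<in> X"
      unfolding eq[symmetric] by simp
    then show False
      using infdist_le[of q X x] q p by simp
  qed
  then have dY: "dist x p = infdist x Y"
    using infdist_le[OF pY, of x] by simp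
  have "ereal (infdist x Y) < reach Y"
    by (rule le_less_trans[OF _ e(4)]) (use p dY in simp)
  then have "closest_point Y x = p"
    using dY by (intro closest_point_eqI'[OF Y _ pY])
  then show "x \<in> tube_over Y s B"
    using p dY by (simp add: tube_over_def)
qed

text \<open>Points of \<open>B\<close> at distance at least \<open>1/m\<close> from the symmetric difference of \<open>X\<close> and \<open>Y\<close> have
  the same tubes of small radius in both sets; these points exhaust \<open>B\<close>.\<close>

lemma federer_curvature_local:
  fixes X Y :: "'a::euclidean_space set"
  assumes X: "closed X" "X \<noteq> {}" "0 < reach X" and Y: "closed Y" "Y \<noteq> {}" "0 < reach Y" and k: "k \<le> DIM('a)"
    and B: "B \<in> sets borel" "bounded B"
    and loc: "\<And>x. x \<in> B \<Longrightarrow> \<exists>e>0. X \<inter> ball x e = Y \<inter> ball x e"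
  shows "federer_curvature k X B = federer_curvature k Y B"
proof (cases "X = Y")
  case False
  define D where "D = (X - Y) \<union> (Y - X)"
  have D: "D \<noteq> {}"
    using False by (auto simp: D_def)
  have ball: "X \<inter> ball x e = Y \<inter> ball x e \<longleftrightarrow> ball x e \<inter> D = {}" for x e
    by (auto simp: D_def)
  define C where "C m = B \<inter> {x. inverse (real (Suc m)) \<le> infdist x D}" for m
  have "closed {x. inverse (real (Suc m)) \<le> infdist x D}" for m
    by (intro closed_Collect_le continuous_intros)
  then have C: "C m \<in> sets borel" for m
    using B(1) by (auto simp: C_def intro: borel_closed)
  have bC: "bounded (C m)" for m
    by (rule bounded_subset[OF B(2)]) (auto simp: C_def)
  have inc: "incseq C"
    unfolding C_def incseq_def by (auto intro: order_trans[rotated] simp: le_imp_inverse_le)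
  have UN: "(\<Union>m. C m) = B"
  proof
    show "B \<subseteq> (\<Union>m. C m)"
    proof
      fix x assume x: "x \<in> B"
      obtain e where e: "0 < e" "ball x e \<inter> D = {}"
        using loc[OF x] ball by auto
      have "e \<le> infdist x D"
        unfolding infdist_notempty[OF D] using e(2) by (intro cINF_greatest[OF D]) (auto simp: not_less[symmetric])
      moreover obtain m where "inverse (real (Suc m)) < e"
        using reals_Archimedean[OF e(1)] by auto
      ultimately show "x \<in> (\<Union>m. C m)"
        using x by (auto simp: C_def intro!: exI[of _ m])
    qed
  qed (auto simp: C_def)
  have eq: "federer_curvature k X (C m) = federer_curvature k Y (C m)" for m
  proof -
    let ?e = "inverse (real (Suc m))"
    have e: "0 < ?e / 2"
      by simp
    obtain s1 where s1: "0 < s1" "s1 < ?e / 2" "ereal s1 < reach X"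
      using obtain_radius_below_reach[OF X(3) e] .
    obtain s where s: "0 < s" "s < s1" "ereal s < reach Y"
      using obtain_radius_below_reach[OF Y(3) s1(1)] .
    have sX: "ereal s < reach X"
      by (rule le_less_trans[OF _ s1(3)]) (use s in simp)
    obtain t where t: "inj_on t {..DIM('a)}" "t ` {..DIM('a)} \<subseteq> {0..s}"
      using obtain_nodes[OF s(1)] .
    have loc': "X \<inter> ball p ?e = Y \<inter> ball p ?e" if "p \<in> C m" for p
      unfolding ball using that infdist_le[of _ D p] by (fastforce simp: C_def)
    have "tube_over X (t j) (C m) = tube_over Y (t j) (C m)" if "j \<le> DIM('a)" for j
    proof -
      have tj: "t j \<le> s"
        using t(2) that by auto
      have "ereal (t j) < reach X" "ereal (t j) < reach Y"
        using ereal_less_of_le[OF tj] sX s(3) by auto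
      moreover have "2 * t j < ?e"
        using tj s s1 by simp
      ultimately show ?thesis
        by (intro equalityI tube_over_cong[OF X(1,2) Y(1,2) loc'] tube_over_cong[OF Y(1,2) X(1,2) loc'[symmetric]])
          auto
    qed
    then show ?thesis
      unfolding federer_curvature_eq_sum[OF X(1,2) s(1) sX C bC t k] federer_curvature_eq_sum[OF Y(1,2) s(1,3) C bC t k]
      by simp
  qed
  have "(\<lambda>m. federer_curvature k X (C m)) \<longlonglongrightarrow> federer_curvature k X B"
    using tendsto_federer_curvature_incseq[OF X k C inc] B(2) by (simp add: UN)
  moreover have "(\<lambda>m. federer_curvature k X (C m)) \<longlonglongrightarrow> federer_curvature k Y B"
    unfolding eq using tendsto_federer_curvature_incseq[OF Y k C inc] B(2) by (simp add: UN)
  ultimately show ?thesis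
    by (rule LIMSEQ_unique)
qed simp

text \<open>A Borel partition of \<open>A\<close> becomes one of \<open>B\<close> by prepending
  \<open>B - A\<close>. If \<open>A\<close> is not Borel, it has no such partition and its total
  variation is a supremum over the empty set, that is 0.\<close>

lemma total_variation_mono:
  fixes \<mu> :: "'a::topological_space set \<Rightarrow> real"
  assumes AB: "A \<subseteq> B" and B: "B \<in> sets borel"
  shows "total_variation \<mu> A \<le> total_variation \<mu> B"
  unfolding total_variation_def
proof (rule SUP_least)
  fix E :: "nat \<Rightarrow> 'a set"
  assume E: "E \<in> {E. range E \<subseteq> sets borel \<and> disjoint_family E \<and> (\<Union>n. E n) = A}"
  define E' where "E' n = (case n of 0 \<Rightarrow> B - A | Suc m \<Rightarrow> E m)" for n
  have E'Suc: "E' (Suc n) = E n" for n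
    by (simp add: E'_def)
  have A: "A \<in> sets borel"
    using E by (auto intro: sets.countable_UN)
  have "range E' \<subseteq> sets borel"
    using E A B by (auto simp: E'_def split: nat.splits)
  moreover have "disjoint_family E'"
    using E unfolding disjoint_family_on_def E'_def by (auto split: nat.splits)
  moreover have "(\<Union>n. E' n) = B"
  proof (intro equalityI subsetI)
    fix x assume "x \<in> (\<Union>n. E' n)"
    then obtain n where "x \<in> E' n"
      by blast
    then show "x \<in> B"
      using E AB by (cases n) (auto simp: E'_def)
  next
    fix x assume x: "x \<in> B"
    show "x \<in> (\<Union>n. E' n)"
    proof (cases "x \<in> A")
      case True
      then obtain n where "x \<in> E n"
        using E by auto
      then show ?thesis
        using E'Suc[of n] by blast
    next
      case False
      then have "x \<in> E' 0"
        using x by (simp add: E'_def)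
      then show ?thesis
        by blast
    qed
  qed
  ultimately have E': "E' \<in> {E. range E \<subseteq> sets borel \<and> disjoint_family E \<and> (\<Union>n. E n) = B}"
    by simp
  let ?f = "\<lambda>n. ennreal \<bar>\<mu> (E' n)\<bar>"
  have "(\<lambda>n. ?f (Suc n)) sums (\<Sum>n. ?f (Suc n))"
    by (rule summable_sums) simp
  then have "?f sums ((\<Sum>n. ?f (Suc n)) + ?f 0)"
    by (rule sums_Suc)
  then have "(\<Sum>n. ?f n) = (\<Sum>n. ?f (Suc n)) + ?f 0"
    by (rule sums_unique[symmetric])
  then have "(\<Sum>n. ennreal \<bar>\<mu> (E n)\<bar>) \<le> (\<Sum>n. ?f n)"
    by (simp add: E'Suc)
  also have "\<dots> \<le> (SUP E\<in>{E. range E \<subseteq> sets borel \<and> disjoint_family E \<and> (\<Union>n. E n) = B}. \<Sum>n. ennreal \<bar>\<mu> (E n)\<bar>)"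
    by (rule SUP_upper[OF E'])
  finally show "(\<Sum>n. ennreal \<bar>\<mu> (E n)\<bar>) \<le> \<dots>" .
qed

lemma total_variation_cong:
  fixes \<mu> \<nu> :: "'a::topological_space set \<Rightarrow> real"
  assumes "\<And>E. E \<in> sets borel \<Longrightarrow> E \<subseteq> A \<Longrightarrow> \<bar>\<mu> E\<bar> = \<bar>\<nu> E\<bar>"
  shows "total_variation \<mu> A = total_variation \<nu> A"
  unfolding total_variation_def
proof (rule SUP_cong[OF refl])
  fix E :: "nat \<Rightarrow> 'a set"
  assume "E \<in> {E. range E \<subseteq> sets borel \<and> disjoint_family E \<and> (\<Union>n. E n) = A}"
  then have "\<bar>\<mu> (E n)\<bar> = \<bar>\<nu> (E n)\<bar>" for n
    by (intro assms) auto
  then show "(\<Sum>n. ennreal \<bar>\<mu> (E n)\<bar>) = (\<Sum>n. ennreal \<bar>\<nu> (E n)\<bar>)"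
    by simp
qed

lemma total_variation_subadditive:
  fixes \<mu> :: "'a::topological_space set \<Rightarrow> real"
  assumes I: "finite I" and A: "A = (\<Union>i\<in>I. C i)" "\<And>i. i \<in> I \<Longrightarrow> C i \<in> sets borel"
    and \<mu>: "\<And>E. E \<in> sets borel \<Longrightarrow> E \<subseteq> A \<Longrightarrow> \<bar>\<mu> E\<bar> \<le> (\<Sum>i\<in>I. \<bar>\<mu> (E \<inter> C i)\<bar>)"
  shows "total_variation \<mu> A \<le> (\<Sum>i\<in>I. total_variation \<mu> (C i))"
  unfolding total_variation_def[of \<mu> A]
proof (rule SUP_least)
  fix E :: "nat \<Rightarrow> 'a set"
  assume E: "E \<in> {E. range E \<subseteq> sets borel \<and> disjoint_family E \<and> (\<Union>n. E n) = A}"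
  have "ennreal \<bar>\<mu> (E n)\<bar> \<le> (\<Sum>i\<in>I. ennreal \<bar>\<mu> (E n \<inter> C i)\<bar>)" for n
  proof -
    have "\<bar>\<mu> (E n)\<bar> \<le> (\<Sum>i\<in>I. \<bar>\<mu> (E n \<inter> C i)\<bar>)"
      using E by (intro \<mu>) auto
    then show ?thesis
      by (simp add: sum_ennreal ennreal_leI)
  qed
  then have "(\<Sum>n. ennreal \<bar>\<mu> (E n)\<bar>) \<le> (\<Sum>n. \<Sum>i\<in>I. ennreal \<bar>\<mu> (E n \<inter> C i)\<bar>)"
    by (intro suminf_le) auto
  also have "\<dots> = (\<Sum>i\<in>I. \<Sum>n. ennreal \<bar>\<mu> (E n \<inter> C i)\<bar>)"
    by (rule suminf_sum) simp
  also have "\<dots> \<le> (\<Sum>i\<in>I. total_variation \<mu> (C i))"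
  proof (rule sum_mono)
    fix i assume i: "i \<in> I"
    show "(\<Sum>n. ennreal \<bar>\<mu> (E n \<inter> C i)\<bar>) \<le> total_variation \<mu> (C i)"
      unfolding total_variation_def
    proof (rule SUP_upper)
      show "(\<lambda>n. E n \<inter> C i) \<in> {E. range E \<subseteq> sets borel \<and> disjoint_family E \<and> (\<Union>n. E n) = C i}"
        unfolding mem_Collect_eq
      proof (intro conjI)
        show "disjoint_family (\<lambda>n. E n \<inter> C i)"
          using E by (simp add: disjoint_family_on_def) blast
        show "range (\<lambda>n. E n \<inter> C i) \<subseteq> sets borel"
          using E A(2)[OF i] by auto
        show "(\<Union>n. E n \<inter> C i) = C i"
          using E A(1) i by auto
      qed
    qed
  qed
  finally show "(\<Sum>n. ennreal \<bar>\<mu> (E n)\<bar>) \<le> (\<Sum>i\<in>I. total_variation \<mu> (C i))" .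
qed

section \<open>Similarities\<close>

definition similarity :: "real \<Rightarrow> ('a::metric_space \<Rightarrow> 'a) \<Rightarrow> bool" where
  "similarity \<rho> g \<longleftrightarrow> 0 < \<rho> \<and> (\<forall>x y. dist (g x) (g y) = \<rho> * dist x y)"

lemma similarityD: "similarity \<rho> g \<Longrightarrow> 0 < \<rho>" "similarity \<rho> g \<Longrightarrow> dist (g x) (g y) = \<rho> * dist x y"
  by (auto simp: similarity_def)

lemma similarity_decomposition:
  fixes g :: "'a::euclidean_space \<Rightarrow> 'a"
  assumes g: "similarity \<rho> g"
  obtains f where "orthogonal_transformation f" "\<And>x. g x = \<rho> *\<^sub>R f x + g 0"
proof -
  define f where "f x = (1 / \<rho>) *\<^sub>R (g x - g 0)" for x
  have "dist (f x) (f y) = dist x y" for x y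
  proof -
    have "f x - f y = (1 / \<rho>) *\<^sub>R (g x - g y)"
      by (simp add: f_def algebra_simps)
    then have "dist (f x) (f y) = 1 / \<rho> * dist (g x) (g y)"
      using similarityD(1)[OF g] by (simp add: dist_norm)
    then show ?thesis
      using similarityD[OF g] by simp
  qed
  then have "orthogonal_transformation f"
    by (simp add: orthogonal_transformation_isometry) (simp add: f_def)
  then show ?thesis
    using that[of f] similarityD(1)[OF g] by (simp add: f_def)
qed

lemma bij_similarity:
  fixes g :: "'a::euclidean_space \<Rightarrow> 'a"
  assumes g: "similarity \<rho> g"
  shows "bij g"
proof (rule bijI)
  show "inj g"
  proof (rule injI)
    fix x y assume "g x = g y"
    then have "\<rho> * dist x y = 0"
      using similarityD(2)[OF g, of x y] by simp
    then show "x = y"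
      using similarityD(1)[OF g] by simp
  qed
  obtain f where f: "orthogonal_transformation f" "\<And>x. g x = \<rho> *\<^sub>R f x + g 0"
    using similarity_decomposition[OF g] by blast
  have "\<exists>x. g x = y" for y
  proof -
    obtain x where "f x = (1 / \<rho>) *\<^sub>R (y - g 0)"
      using orthogonal_transformation_surj[OF f(1)] by (metis surjD)
    then have "g x = y"
      using f(2)[of x] similarityD(1)[OF g] by simp
    then show ?thesis
      by blast
  qed
  then show "surj g"
    unfolding surj_def by metis
qed

lemma similarity_inv:
  fixes g :: "'a::euclidean_space \<Rightarrow> 'a"
  assumes g: "similarity \<rho> g"
  shows "similarity (1 / \<rho>) (inv g)"
  unfolding similarity_def
proof (intro conjI allI)
  fix x y
  have "dist x y = \<rho> * dist (inv g x) (inv g y)"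
    using similarityD(2)[OF g, of "inv g x" "inv g y"] bij_similarity[OF g] by (simp add: bij_is_surj surj_f_inv_f)
  then show "dist (inv g x) (inv g y) = 1 / \<rho> * dist x y"
    using similarityD(1)[OF g] by simp
qed (use similarityD(1)[OF g] in simp)

lemma lipschitz_on_similarity: "similarity \<rho> g \<Longrightarrow> \<rho>-lipschitz_on A g"
  by (auto simp: similarity_def intro!: lipschitz_onI)

lemma continuous_on_similarity: "similarity \<rho> g \<Longrightarrow> continuous_on A g"
  by (rule lipschitz_on_continuous_on[OF lipschitz_on_similarity])

lemma bounded_similarity_image:
  fixes g :: "'a::euclidean_space \<Rightarrow> 'a"
  shows "similarity \<rho> g \<Longrightarrow> bounded A \<Longrightarrow> bounded (g ` A)"
  by (rule bounded_uniformly_continuous_image[OF lipschitz_on_uniformly_continuous[OF lipschitz_on_similarity]])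

lemma similarity_image_eqI:
  fixes g :: "'a::euclidean_space \<Rightarrow> 'a"
  assumes "similarity \<rho> g" "\<And>x. g x \<in> B \<longleftrightarrow> x \<in> A"
  shows "B = g ` A"
proof -
  have "g -` B = A"
    using assms(2) by blast
  then show ?thesis
    using surj_image_vimage_eq[OF bij_is_surj[OF bij_similarity[OF assms(1)]], of B] by simp
qed

lemma borel_similarity_image:
  fixes g :: "'a::euclidean_space \<Rightarrow> 'a"
  assumes g: "similarity \<rho> g" and A: "A \<in> sets borel"
  shows "g ` A \<in> sets borel"
proof -
  have "inv g -` A = g ` A"
    using bij_vimage_eq_inv_image[OF bij_imp_bij_inv[OF bij_similarity[OF g]], of A]
    by (simp add: inv_inv_eq bij_similarity[OF g])
  then show ?thesis
    using measurable_sets[OF borel_measurable_continuous_onI[OF continuous_on_similarity[OF similarity_inv[OF g]]] A]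
    by simp
qed

lemma measure_similarity_image:
  fixes g :: "'a::euclidean_space \<Rightarrow> 'a"
  assumes g: "similarity \<rho> g" and A: "A \<in> sets borel" "A \<in> lmeasurable"
  shows "measure lebesgue (g ` A) = \<rho> ^ DIM('a) * measure lebesgue A"
proof -
  obtain f where f: "orthogonal_transformation f" "\<And>x. g x = \<rho> *\<^sub>R f x + g 0"
    using similarity_decomposition[OF g] by blast
  \<comment> \<open>Conjugation by the coordinate isometry turns the orthogonal part into an
    orthogonal map of a coordinate space, where invariance of the volume applies.\<close>
  define h where "h v = coord (f (from_coord v))" for v
  have lin: "linear f" and inner: "\<And>x y. f x \<bullet> f y = x \<bullet> y"
    using f(1) by (auto simp: orthogonal_transformation_def)
  have "linear (coord \<circ> (f \<circ> from_coord))"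
    by (intro linear_compose linear_from_coord linear_coord lin)
  then have h: "orthogonal_transformation h"
    unfolding orthogonal_transformation_def h_def by (simp add: o_def inner)
  have fA: "f ` A \<in> sets borel"
    using f(1) by (intro borel_similarity_image[of 1 f] A) (simp add: similarity_def orthogonal_transformation_isometry)
  have "emeasure lebesgue (coord ` A) < \<infinity>"
    unfolding emeasure_coord_image[OF A(1)] using A(2) by (simp only: fmeasurable_def mem_Collect_eq infinity_ennreal_def)
  then have cA: "coord ` A \<in> lmeasurable"
    using borel_coord_image[OF A(1)] by (intro fmeasurableI sets_completionI_sets) auto
  have "measure lebesgue (f ` A) = measure lebesgue (coord ` f ` A)"
    by (rule measure_coord_image[OF fA, symmetric])
  also have "coord ` f ` A = h ` coord ` A"
    by (simp add: image_image h_def)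
  also have "measure lebesgue \<dots> = measure lebesgue A"
    using measure_orthogonal_image[OF h cA] measure_coord_image[OF A(1)] by simp
  finally have "measure lebesgue (f ` A) = measure lebesgue A" .
  moreover have "g ` A = (\<lambda>x. \<rho> *\<^sub>R x + g 0) ` f ` A"
    unfolding image_image f(2)[symmetric] ..
  ultimately show ?thesis
    using measure_lebesgue_affine[of \<rho> "g 0" "f ` A"] similarityD(1)[OF g] by simp
qed

section \<open>Distance, reach and curvature under similarities\<close>

lemma infdist_similarity:
  assumes g: "similarity \<rho> g"
  shows "infdist (g x) (g ` A) = \<rho> * infdist x A"
proof (cases "A = {}")
  case False
  have \<rho>: "0 < \<rho>"
    by (rule similarityD(1)[OF g])
  show ?thesis
  proof (rule antisym)
    have "infdist (g x) (g ` A) / \<rho> \<le> dist x a" if "a \<in> A" for a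
      using infdist_le[of "g a" "g ` A" "g x"] that \<rho> by (simp add: similarityD(2)[OF g] field_simps)
    then have "infdist (g x) (g ` A) / \<rho> \<le> infdist x A"
      unfolding infdist_notempty[OF False] by (intro cINF_greatest[OF False])
    then show "infdist (g x) (g ` A) \<le> \<rho> * infdist x A"
      using \<rho> by (simp add: field_simps)
    have "\<rho> * infdist x A \<le> dist (g x) b" if "b \<in> g ` A" for b
      using that infdist_le[of _ A x] \<rho> by (auto simp: similarityD(2)[OF g])
    then show "\<rho> * infdist x A \<le> infdist (g x) (g ` A)"
      using False unfolding infdist_notempty[of "g ` A", simplified, OF False] by (intro cINF_greatest) auto
  qed
qed (simp add: infdist_def)

lemma closure_similarity_image:
  fixes g :: "'a::euclidean_space \<Rightarrow> 'a"
  assumes g: "similarity \<rho> g"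
  shows "closure (g ` A) = g ` closure A"
proof (cases "A = {}")
  case False
  show ?thesis
    using False similarityD(1)[OF g]
    by (intro similarity_image_eqI[OF g]) (simp add: in_closure_iff_infdist_zero infdist_similarity[OF g])
qed simp

lemma closed_similarity_image:
  fixes g :: "'a::euclidean_space \<Rightarrow> 'a"
  assumes "similarity \<rho> g" "closed A"
  shows "closed (g ` A)"
  using closure_similarity_image[OF assms(1), of A] closure_closed[OF assms(2)] closed_closure[of "g ` A"] by simp

lemma parallel_set_similarity:
  fixes g :: "'a::euclidean_space \<Rightarrow> 'a"
  assumes g: "similarity \<rho> g"
  shows "parallel_set (g ` K) (\<rho> * \<epsilon>) = g ` parallel_set K \<epsilon>"
  using similarityD(1)[OF g]
  by (intro similarity_image_eqI[OF g]) (simp add: parallel_set_def infdist_similarity[OF g])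

lemma closed_complement_similarity:
  fixes g :: "'a::euclidean_space \<Rightarrow> 'a"
  assumes g: "similarity \<rho> g"
  shows "closed_complement (g ` A) = g ` closed_complement A"
  unfolding closed_complement_def
  by (simp add: closure_similarity_image[OF g, symmetric] bij_image_Compl_eq[OF bij_similarity[OF g]])

lemma unp_similarity:
  fixes g :: "'a::euclidean_space \<Rightarrow> 'a"
  assumes g: "similarity \<rho> g" and x: "x \<in> unp X"
  shows "g x \<in> unp (g ` X)"
proof -
  have eq: "dist (g x) (g a) = infdist (g x) (g ` X) \<longleftrightarrow> dist x a = infdist x X" for a
    using similarityD[OF g] by (simp add: infdist_similarity[OF g])
  obtain a where a: "a \<in> X" "dist x a = infdist x X" "\<And>b. b \<in> X \<Longrightarrow> dist x b = infdist x X \<Longrightarrow> b = a"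
    using x unfolding unp_def by blast
  have "b = g a" if "b \<in> g ` X \<and> dist (g x) b = infdist (g x) (g ` X)" for b
    using that a(3) eq by blast
  moreover have "g a \<in> g ` X \<and> dist (g x) (g a) = infdist (g x) (g ` X)"
    using a(1,2) eq by simp
  ultimately show ?thesis
    unfolding unp_def mem_Collect_eq by (rule ex1I[rotated])
qed

text \<open>Phrased through real numbers below the reach, which covers infinite reach without
  arithmetic on extended reals.\<close>

lemma reach_similarity:
  fixes g :: "'a::euclidean_space \<Rightarrow> 'a"
  assumes g: "similarity \<rho> g" and s: "ereal s < reach X"
  shows "ereal (\<rho> * s) \<le> reach (g ` X)"
  unfolding reach_def
proof (rule INF_greatest)
  fix b assume "b \<in> g ` X"
  then obtain a where a: "a \<in> X" "b = g a"
    by auto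
  have "ereal s < reach_at X a"
    by (rule less_le_trans[OF s]) (simp add: reach_def INF_lower[OF a(1)])
  then obtain u where u: "ball a u \<subseteq> unp X" "s < u"
    unfolding reach_at_def less_SUP_iff by auto
  have "ball b (\<rho> * u) \<subseteq> unp (g ` X)"
  proof
    fix y assume y: "y \<in> ball b (\<rho> * u)"
    obtain x where x: "y = g x"
      using bij_is_surj[OF bij_similarity[OF g]] by (metis surjD)
    have "x \<in> ball a u"
      using y similarityD[OF g] unfolding a(2) x by simp
    then show "y \<in> unp (g ` X)"
      unfolding x using u(1) by (intro unp_similarity[OF g]) auto
  qed
  then have "ereal (\<rho> * u) \<le> reach_at (g ` X) b"
    unfolding reach_at_def by (intro SUP_upper) simp
  moreover have "ereal (\<rho> * s) \<le> ereal (\<rho> * u)"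
    using u(2) similarityD(1)[OF g] by simp
  ultimately show "ereal (\<rho> * s) \<le> reach_at (g ` X) b"
    by (rule order_trans[rotated])
qed

lemma reach_pos_similarity:
  fixes g :: "'a::euclidean_space \<Rightarrow> 'a"
  assumes g: "similarity \<rho> g" and "0 < reach X"
  shows "0 < reach (g ` X)"
proof -
  obtain s where "0 < s" "ereal s < reach X"
    using obtain_radius_below_reach[OF assms(2) zero_less_one] .
  then have "ereal 0 < ereal (\<rho> * s)" "ereal (\<rho> * s) \<le> reach (g ` X)"
    using similarityD(1)[OF g] reach_similarity[OF g, of s X] by auto
  then show ?thesis
    unfolding zero_ereal_def by (rule less_le_trans)
qed

lemma tube_over_similarity:
  fixes g :: "'a::euclidean_space \<Rightarrow> 'a"
  assumes g: "similarity \<rho> g" and X: "closed X" "X \<noteq> {}" and s: "ereal s < reach X"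
  shows "tube_over (g ` X) (\<rho> * s) (g ` B) = g ` tube_over X s B"
proof (rule similarity_image_eqI[OF g])
  have \<rho>: "0 < \<rho>" and inj: "inj g"
    using similarityD(1)[OF g] bij_similarity[OF g] by (auto simp: bij_def)
  show "g x \<in> tube_over (g ` X) (\<rho> * s) (g ` B) \<longleftrightarrow> x \<in> tube_over X s B" for x
  proof (cases "infdist x X \<le> s")
    case True
    have "closest_point (g ` X) (g x) = g (closest_point X x)"
    proof (rule closest_point_eqI)
      show "closed (g ` X)"
        by (rule closed_similarity_image[OF g X(1)])
      show "g x \<in> unp (g ` X)"
        by (intro unp_similarity[OF g] mem_unp_if_infdist_less_reach[OF X] ereal_less_of_le[OF True s])
      show "dist (g x) (g (closest_point X x)) = infdist (g x) (g ` X)"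
        by (simp add: similarityD(2)[OF g] infdist_similarity[OF g] closest_point_dist[OF X])
    qed (use X closest_point_in_set[OF X] in auto)
    then show ?thesis
      using \<rho> by (simp add: tube_over_def infdist_similarity[OF g] inj_image_mem_iff[OF inj])
  next
    case False
    then show ?thesis
      using \<rho> by (simp add: tube_over_def infdist_similarity[OF g])
  qed
qed

text \<open>The Steiner polynomial of the image is \<open>\<rho> ^ DIM('a)\<close> times
  \<open>p\<close> at \<open>t / \<rho>\<close>; in the coefficient of degree
  \<open>DIM('a) - k\<close> the powers of \<rho> combine to \<open>\<rho> ^ k\<close>.\<close>

lemma federer_curvature_similarity:
  fixes g :: "'a::euclidean_space \<Rightarrow> 'a"
  assumes g: "similarity \<rho> g" and X: "closed X" "X \<noteq> {}" "0 < reach X" and k: "k \<le> DIM('a)"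
    and B: "B \<in> sets borel" "bounded B"
  shows "federer_curvature k (g ` X) (g ` B) = \<rho> ^ k * federer_curvature k X B"
proof -
  have \<rho>: "0 < \<rho>"
    by (rule similarityD(1)[OF g])
  obtain s where s: "0 < s" "ereal s < reach X"
    using obtain_radius_below_reach[OF X(3) zero_less_one] .
  obtain p where p: "degree p \<le> DIM('a)" "\<And>t. t \<in> {0..s} \<Longrightarrow> tube_volume X t B = poly p t"
    using polynomial_on_measure_tube[OF X(1,2) s B] by (auto simp: polynomial_on_def)
  define q where "q = smult (\<rho> ^ DIM('a)) (pcompose p [:0, 1 / \<rho>:])"
  \<comment> \<open>Halving \<open>s\<close> turns the weak inequality supplied by
    \<open>reach_similarity\<close> into the strict one demanded of a radius.\<close>
  have "ereal (\<rho> * (s / 2)) < ereal (\<rho> * s)"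
    using \<rho> s(1) by simp
  then have r: "ereal (\<rho> * (s / 2)) < reach (g ` X)"
    using reach_similarity[OF g s(2)] by (rule less_le_trans)
  have "federer_curvature k (g ` X) (g ` B) = coeff q (DIM('a) - k) / unit_ball_vol (real (DIM('a) - k))"
  proof (rule federer_curvature_eq_coeff[OF closed_similarity_image[OF g X(1)] _ _ r])
    show "degree q \<le> DIM('a)"
      using p(1) by (simp add: q_def degree_pcompose \<rho>)
    fix t assume t: "t \<in> {0..\<rho> * (s / 2)}"
    then have ts: "0 \<le> t / \<rho>" "t / \<rho> \<le> s"
      using \<rho> s(1) by (auto simp: field_simps)
    have ts': "ereal (t / \<rho>) < reach X"
      by (rule ereal_less_of_le[OF ts(2) s(2)])
    have "tube_over (g ` X) t (g ` B) = g ` tube_over X (t / \<rho>) B"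
      using tube_over_similarity[OF g X(1,2) ts', of B] \<rho> by simp
    then have "tube_volume (g ` X) t (g ` B) = \<rho> ^ DIM('a) * tube_volume X (t / \<rho>) B"
      using measure_similarity_image[OF g tube_over_borel[OF X(1,2) ts(1) ts' B(1)] tube_over_lmeasurable[OF X(1,2) ts(1) ts' B]]
      by simp
    then show "tube_volume (g ` X) t (g ` B) = poly q t"
      using p(2)[of "t / \<rho>"] ts by (simp add: q_def poly_pcompose)
  qed (use X \<rho> s k B in \<open>auto intro: borel_similarity_image[OF g] bounded_similarity_image[OF g]\<close>)
  also have "coeff q (DIM('a) - k) = \<rho> ^ k * coeff p (DIM('a) - k)"
  proof -
    have "\<rho> ^ DIM('a) = \<rho> ^ k * \<rho> ^ (DIM('a) - k)"
      using k by (simp flip: power_add)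
    then show ?thesis
      using \<rho> by (simp add: q_def coeff_pcompose_linear power_one_over)
  qed
  finally show ?thesis
    using federer_curvature_eq_coeff[OF X(1,2) s B p k] by simp
qed

lemma total_variation_similarity_le:
  fixes g :: "'a::euclidean_space \<Rightarrow> 'a"
  assumes g: "similarity \<rho> g" and c: "0 \<le> c"
    and \<mu>: "\<And>E. E \<in> sets borel \<Longrightarrow> E \<subseteq> A \<Longrightarrow> \<bar>\<nu> (g ` E)\<bar> = c * \<bar>\<mu> E\<bar>"
  shows "total_variation \<nu> (g ` A) \<le> ennreal c * total_variation \<mu> A"
  unfolding total_variation_def[of \<nu>]
proof (rule SUP_least)
  fix E :: "nat \<Rightarrow> 'a set"
  assume E: "E \<in> {E. range E \<subseteq> sets borel \<and> disjoint_family E \<and> (\<Union>n. E n) = g ` A}"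
  define D where "D n = g -` E n" for n
  have ED: "E n = g ` D n" for n
    unfolding D_def using bij_is_surj[OF bij_similarity[OF g]] by (simp add: surj_image_vimage_eq)
  have D: "D n \<in> sets borel" for n
    using measurable_sets[OF borel_measurable_continuous_onI[OF continuous_on_similarity[OF g]], of "E n"] E
    by (auto simp: D_def)
  have UD: "(\<Union>n. D n) = A"
  proof -
    have "(\<Union>n. D n) = g -` (\<Union>n. E n)"
      by (auto simp: D_def)
    then show ?thesis
      using E bij_is_inj[OF bij_similarity[OF g]] by (simp add: inj_vimage_image_eq)
  qed
  have disj: "disjoint_family D"
    using E unfolding D_def disjoint_family_on_def by blast
  have "\<bar>\<nu> (E n)\<bar> = c * \<bar>\<mu> (D n)\<bar>" for n
    unfolding ED using UD by (intro \<mu> D) auto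
  then have "(\<Sum>n. ennreal \<bar>\<nu> (E n)\<bar>) = (\<Sum>n. ennreal c * ennreal \<bar>\<mu> (D n)\<bar>)"
    using c by (simp add: ennreal_mult)
  also have "\<dots> = ennreal c * (\<Sum>n. ennreal \<bar>\<mu> (D n)\<bar>)"
    by (rule ennreal_suminf_cmult)
  also have "\<dots> \<le> ennreal c * total_variation \<mu> A"
    unfolding total_variation_def using D UD disj by (intro mult_left_mono SUP_upper) auto
  finally show "(\<Sum>n. ennreal \<bar>\<nu> (E n)\<bar>) \<le> ennreal c * total_variation \<mu> A" .
qed

section \<open>Words\<close>

lemma word_map_Nil [simp]: "word_map S [] = id"
  and word_map_Cons [simp]: "word_map S (i # \<omega>) = S i \<circ> word_map S \<omega>"
  by (simp_all add: word_map_def)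

lemma word_map_append: "word_map S (u @ v) = word_map S u \<circ> word_map S v"
  by (induction u) auto

lemma word_ratio_Nil [simp]: "word_ratio r [] = 1"
  and word_ratio_Cons [simp]: "word_ratio r (i # \<omega>) = r i * word_ratio r \<omega>"
  by (simp_all add: word_ratio_def)

lemma word_ratio_append: "word_ratio r (u @ v) = word_ratio r u * word_ratio r v"
  by (simp add: word_ratio_def)

lemma words_append [simp]: "u @ v \<in> words N \<longleftrightarrow> u \<in> words N \<and> v \<in> words N"
  by (auto simp: words_def)

lemma words_Cons [simp]: "i # v \<in> words N \<longleftrightarrow> i \<in> {1..N} \<and> v \<in> words N"
  by (auto simp: words_def)

lemma words_Nil [simp]: "[] \<in> words N"
  by (simp add: words_def)

lemma countable_words: "countable (words N)"
  unfolding words_def by (rule countable_subset[of _ UNIV]) auto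

lemma word_ratio_pos:
  assumes "similarities N S r"
  shows "\<omega> \<in> words N \<Longrightarrow> 0 < word_ratio r \<omega>"
  using assms by (induction \<omega>) (auto simp: similarities_def)

lemma similarity_word_map:
  assumes "similarities N S r"
  shows "\<omega> \<in> words N \<Longrightarrow> similarity (word_ratio r \<omega>) (word_map S \<omega>)"
proof (induction \<omega>)
  case (Cons i \<omega>)
  then show ?case
    using assms by (simp add: similarities_def similarity_def)
qed (simp add: similarity_def)

lemma word_ratio_le_power:
  assumes "similarities N S r" "\<And>i. i \<in> {1..N} \<Longrightarrow> r i \<le> q"
  shows "\<omega> \<in> words N \<Longrightarrow> word_ratio r \<omega> \<le> q ^ length \<omega>"
proof (induction \<omega>)
  case (Cons i \<omega>)
  then have "0 < r i" "r i \<le> q" "0 < word_ratio r \<omega>" "word_ratio r \<omega> \<le> q ^ length \<omega>"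
    using assms word_ratio_pos[OF assms(1)] by (auto simp: similarities_def)
  then show ?case
    using mult_mono[of "r i" q "word_ratio r \<omega>" "q ^ length \<omega>"] by simp
qed simp

lemma word_ratio_le_1:
  assumes "similarities N S r" "\<omega> \<in> words N"
  shows "word_ratio r \<omega> \<le> 1"
proof -
  have "r i \<le> 1" if "i \<in> {1..N}" for i
    using assms(1) that by (auto simp: similarities_def intro: less_imp_le)
  from word_ratio_le_power[OF assms(1) this assms(2)] show ?thesis
    by simp
qed

lemma word_ratio_append_le:
  assumes "similarities N S r" "u \<in> words N" "v \<in> words N"
  shows "word_ratio r (u @ v) \<le> word_ratio r u"
  using mult_left_mono[OF word_ratio_le_1[OF assms(1,3)], of "word_ratio r u"] word_ratio_pos[OF assms(1,2)]
  by (simp add: word_ratio_append)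

lemma obtain_ratio_bounds:
  assumes "similarities N S r"
  obtains m q where "0 < m" "q < 1" "0 < q" "\<And>i. i \<in> {1..N} \<Longrightarrow> m \<le> r i \<and> r i \<le> q"
proof -
  \<comment> \<open>The inserted values 1 and, below, 1/2 make both extrema meaningful for
    \<open>N = 0\<close> and keep \<open>m\<close> positive and \<open>q\<close> strictly between 0
    and 1.\<close>
  define m where "m = Min (insert 1 (r ` {1..N}))"
  define q where "q = Max (insert (1 / 2) (r ` {1..N}))"
  have "0 < m" "q < 1"
    using assms by (auto simp: m_def q_def similarities_def)
  moreover have "1 / 2 \<le> q"
    unfolding q_def by (intro Max_ge) auto
  moreover have "m \<le> r i \<and> r i \<le> q" if "i \<in> {1..N}" for i
    unfolding m_def q_def by (intro conjI Min_le Max_ge) (use that in auto)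
  ultimately show ?thesis
    using that[of m q] by simp
qed

lemma word_ratio_eventually_small:
  assumes S: "similarities N S r" and "0 < R" "0 < \<epsilon>"
  obtains n where "\<And>\<omega>. \<omega> \<in> words N \<Longrightarrow> n \<le> length \<omega> \<Longrightarrow> R * word_ratio r \<omega> < \<epsilon>"
proof -
  obtain m q where q: "q < 1" "0 < q" "\<And>i. i \<in> {1..N} \<Longrightarrow> m \<le> r i \<and> r i \<le> q"
    using obtain_ratio_bounds[OF S] by metis
  obtain n where n: "q ^ n < \<epsilon> / R"
    using real_arch_pow_inv[OF _ q(1), of "\<epsilon> / R"] assms by auto
  have "R * word_ratio r \<omega> < \<epsilon>" if "\<omega> \<in> words N" "n \<le> length \<omega>" for \<omega>
  proof -
    have "word_ratio r \<omega> \<le> q ^ length \<omega>"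
      using word_ratio_le_power[OF S _ that(1)] q(3) by blast
    also have "\<dots> \<le> q ^ n"
      using that(2) q by (intro power_decreasing) auto
    also have "\<dots> < \<epsilon> / R"
      by (rule n)
    finally show ?thesis
      using assms(2) by (simp add: field_simps)
  qed
  then show ?thesis
    by (rule that)
qed

lemma word_map_image_subset:
  assumes "hutchinson N S A \<subseteq> A"
  shows "\<omega> \<in> words N \<Longrightarrow> word_map S \<omega> ` A \<subseteq> A"
proof (induction \<omega>)
  case (Cons i \<omega>)
  have "word_map S (i # \<omega>) ` A = S i ` word_map S \<omega> ` A"
    by (simp add: image_image)
  also have "\<dots> \<subseteq> S i ` A"
    using Cons by (intro image_mono) auto
  also have "\<dots> \<subseteq> A"
    using Cons.prems assms unfolding hutchinson_def words_Cons by blast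
  finally show ?case .
qed simp

lemma word_map_append_image_subset:
  assumes "hutchinson N S A \<subseteq> A" "v \<in> words N"
  shows "word_map S (u @ v) ` A \<subseteq> word_map S u ` A"
  using image_mono[OF word_map_image_subset[OF assms], of "word_map S u"]
  by (simp add: word_map_append image_comp)

lemma word_of_length_covers:
  assumes "A \<subseteq> hutchinson N S A" "x \<in> A"
  shows "\<exists>\<omega>\<in>words N. length \<omega> = n \<and> x \<in> word_map S \<omega> ` A"
proof (induction n)
  case 0
  then show ?case
    using assms(2) by (intro bexI[of _ "[]"]) auto
next
  case (Suc n)
  then obtain \<omega> y where \<omega>: "\<omega> \<in> words N" "length \<omega> = n" "y \<in> A" "x = word_map S \<omega> y"
    by auto
  obtain i z where "i \<in> {1..N}" "z \<in> A" "y = S i z"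
    using assms(1) \<omega>(3) by (auto simp: hutchinson_def)
  then show ?case
    using \<omega> by (intro bexI[of _ "\<omega> @ [i]"]) (auto simp: word_map_append)
qed

section \<open>Words of comparable scale\<close>

lemma scale_wordsD:
  assumes "\<sigma> \<in> scale_words N r R \<epsilon>"
  shows "\<sigma> \<in> words N" "\<sigma> \<noteq> []" "R * word_ratio r \<sigma> < \<epsilon>" "\<epsilon> \<le> R * word_ratio r (butlast \<sigma>)"
  using assms by (auto simp: scale_words_def)

text \<open>A proper prefix is already a prefix of \<open>butlast\<close>, and ratios only decrease
  along a word. This yields the antichain property and, for a common prefix of several words, the
  upper bound \<open>R\<close> for the scaled distance.\<close>

lemma scale_words_proper_prefix:
  assumes S: "similarities N S r" and R: "0 < R" and \<sigma>: "u @ v \<in> scale_words N r R \<epsilon>" "v \<noteq> []"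
  shows "\<epsilon> \<le> R * word_ratio r u"
proof -
  have "butlast (u @ v) = u @ butlast v"
    using \<sigma>(2) by (simp add: butlast_append)
  moreover have "u \<in> words N" "butlast v \<in> words N"
    using scale_wordsD(1)[OF \<sigma>(1)] by (auto simp: words_def dest: in_set_butlastD)
  ultimately have "word_ratio r (butlast (u @ v)) \<le> word_ratio r u"
    using word_ratio_append_le[OF S] by simp
  then have "R * word_ratio r (butlast (u @ v)) \<le> R * word_ratio r u"
    using R by simp
  then show ?thesis
    using scale_wordsD(4)[OF \<sigma>(1)] by linarith
qed

lemma scale_words_antichain:
  assumes S: "similarities N S r" and R: "0 < R"
    and \<sigma>: "\<sigma> \<in> scale_words N r R \<epsilon>" and \<tau>: "\<tau> \<in> scale_words N r R \<epsilon>" and "prefix \<sigma> \<tau>"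
  shows "\<sigma> = \<tau>"
proof (rule ccontr)
  assume "\<sigma> \<noteq> \<tau>"
  then obtain v where v: "\<tau> = \<sigma> @ v" "v \<noteq> []"
    using assms(5) by (auto simp: prefix_def)
  then show False
    using scale_words_proper_prefix[OF S R, of \<sigma> v \<epsilon>] \<tau> scale_wordsD(3)[OF \<sigma>] by simp
qed

lemma finite_scale_words:
  assumes S: "similarities N S r" and R: "0 < R" and \<epsilon>: "0 < \<epsilon>"
  shows "finite (scale_words N r R \<epsilon>)"
proof -
  obtain n where n: "\<And>\<omega>. \<omega> \<in> words N \<Longrightarrow> n \<le> length \<omega> \<Longrightarrow> R * word_ratio r \<omega> < \<epsilon>"
    using word_ratio_eventually_small[OF assms] by blast
  have "length \<sigma> \<le> Suc n" if \<sigma>: "\<sigma> \<in> scale_words N r R \<epsilon>" for \<sigma>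
  proof (rule ccontr)
    assume "\<not> length \<sigma> \<le> Suc n"
    then have "n \<le> length (butlast \<sigma>)"
      by simp
    moreover have "butlast \<sigma> \<in> words N"
      using scale_wordsD(1)[OF \<sigma>] by (auto simp: words_def dest: in_set_butlastD)
    ultimately show False
      using n[of "butlast \<sigma>"] scale_wordsD(4)[OF \<sigma>] by simp
  qed
  then have "scale_words N r R \<epsilon> \<subseteq> {xs. set xs \<subseteq> {1..N} \<and> length xs \<le> Suc n}"
    by (auto simp: scale_words_def words_def)
  then show ?thesis
    by (rule finite_subset) (intro finite_lists_length_le finite_atLeastAtMost)
qed

text \<open>Read an address of \<open>x\<close> until its ratio first drops below
  \<open>\<epsilon> / R\<close>; since \<open>\<epsilon> \<le> R\<close>, this does not happen at
  the empty word.\<close>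

lemma scale_words_cover:
  assumes S: "similarities N S r" and F: "F = hutchinson N S F" and \<epsilon>: "0 < \<epsilon>" "\<epsilon> \<le> R"
  shows "F = (\<Union>\<sigma>\<in>scale_words N r R \<epsilon>. word_map S \<sigma> ` F)"
proof (intro equalityI subsetI)
  fix x assume x: "x \<in> F"
  have R: "0 < R"
    using \<epsilon> by simp
  obtain n where n: "\<And>\<omega>. \<omega> \<in> words N \<Longrightarrow> n \<le> length \<omega> \<Longrightarrow> R * word_ratio r \<omega> < \<epsilon>"
    using word_ratio_eventually_small[OF S R \<epsilon>(1)] by blast
  obtain \<omega> where \<omega>: "\<omega> \<in> words N" "length \<omega> = n" "x \<in> word_map S \<omega> ` F"
    using word_of_length_covers[of F N S x n] F x by auto
  let ?P = "\<lambda>l. R * word_ratio r (take l \<omega>) < \<epsilon>"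
  have Pn: "?P n"
    using n[OF \<omega>(1)] \<omega>(2) by simp
  define l where "l = (LEAST l. ?P l)"
  have Pl: "?P l"
    unfolding l_def by (rule LeastI[of ?P, OF Pn])
  have "l \<noteq> 0"
    using Pl \<epsilon> by (auto intro: ccontr)
  have "l \<le> n"
    unfolding l_def by (rule Least_le[of ?P, OF Pn])
  have "\<not> ?P (l - 1)"
    using not_less_Least[of "l - 1" ?P] \<open>l \<noteq> 0\<close> unfolding l_def by simp
  moreover have "butlast (take l \<omega>) = take (l - 1) \<omega>"
    using \<open>l \<le> n\<close> \<omega>(2) by (simp add: butlast_take)
  moreover have tw: "take l \<omega> \<in> words N" "drop l \<omega> \<in> words N"
    using \<omega>(1) by (auto simp: words_def dest: in_set_takeD in_set_dropD)
  ultimately have "take l \<omega> \<in> scale_words N r R \<epsilon>"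
    using Pl \<open>l \<noteq> 0\<close> \<open>l \<le> n\<close> \<omega>(2) by (auto simp: scale_words_def)
  moreover have "x \<in> word_map S (take l \<omega>) ` F"
    using word_map_append_image_subset[of N S F "drop l \<omega>" "take l \<omega>"] F tw \<omega>(3) by auto
  ultimately show "x \<in> (\<Union>\<sigma>\<in>scale_words N r R \<epsilon>. word_map S \<sigma> ` F)"
    by blast
next
  fix x assume "x \<in> (\<Union>\<sigma>\<in>scale_words N r R \<epsilon>. word_map S \<sigma> ` F)"
  then show "x \<in> F"
    using word_map_image_subset[of N S F] F scale_wordsD(1) by blast
qed

text \<open>Neither word is a prefix of the other, so they branch at two different letters; the
  first-level images of \<open>U\<close> are disjoint there, and the remaining letters stay inside
  them.\<close>

lemma scale_words_osc_disjoint: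
  fixes S :: "nat \<Rightarrow> 'a::euclidean_space \<Rightarrow> 'a"
  assumes S: "similarities N S r" and U: "osc_set N S U" and R: "0 < R"
    and \<sigma>: "\<sigma> \<in> scale_words N r R \<epsilon>" and \<tau>: "\<tau> \<in> scale_words N r R \<epsilon>" and ne: "\<sigma> \<noteq> \<tau>"
  shows "word_map S \<sigma> ` U \<inter> word_map S \<tau> ` U = {}"
proof -
  have "\<sigma> \<parallel> \<tau>"
    using scale_words_antichain[OF S R] \<sigma> \<tau> ne by (metis parallelI)
  then obtain \<omega> i u j v where d: "i \<noteq> j" "\<sigma> = \<omega> @ i # u" "\<tau> = \<omega> @ j # v"
    using parallel_decomp by blast
  have w: "\<omega> \<in> words N" "i \<in> {1..N}" "j \<in> {1..N}" "u \<in> words N" "v \<in> words N"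
    using scale_wordsD(1)[OF \<sigma>] scale_wordsD(1)[OF \<tau>] d by auto
  have sub: "word_map S (\<omega> @ l # x) ` U \<subseteq> word_map S \<omega> ` S l ` U" if "x \<in> words N" for l x
    using word_map_append_image_subset[of N S U x "\<omega> @ [l]"] that U
    by (simp add: osc_set_def word_map_append image_comp)
  have "inj (word_map S \<omega>)"
    by (rule bij_is_inj[OF bij_similarity[OF similarity_word_map[OF S w(1)]]])
  then have "word_map S \<omega> ` S i ` U \<inter> word_map S \<omega> ` S j ` U = word_map S \<omega> ` (S i ` U \<inter> S j ` U)"
    by (rule image_Int[symmetric])
  also have "\<dots> = {}"
    using U d(1) w by (auto simp: osc_set_def)
  finally show ?thesis
    using sub[OF w(4), of i] sub[OF w(5), of j] unfolding d by blast
qed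

section \<open>Parallel sets and the number of neighbouring cells\<close>

lemma mem_parallel_set_iff:
  fixes K :: "'a::heine_borel set"
  assumes "closed K"
  shows "x \<in> parallel_set K \<epsilon> \<longleftrightarrow> (\<exists>y\<in>K. dist x y \<le> \<epsilon>)"
proof (cases "K = {}")
  case False
  obtain a where "a \<in> K" "infdist x K = dist x a"
    using infdist_attains_inf[OF assms False] by blast
  then show ?thesis
    using False infdist_le[of _ K x] by (auto simp: parallel_set_def intro: order_trans)
qed (simp add: parallel_set_def)

lemma closed_parallel_set: "closed (parallel_set K \<epsilon>)"
proof (cases "K = {}")
  case False
  then have "parallel_set K \<epsilon> = {x. infdist x K \<le> \<epsilon>}"
    by (simp add: parallel_set_def)
  then show ?thesis
    by (auto intro!: closed_Collect_le continuous_intros)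
qed (simp add: parallel_set_def)

lemma bounded_parallel_set:
  fixes K :: "'a::euclidean_space set"
  assumes "compact K"
  shows "bounded (parallel_set K \<epsilon>)"
proof -
  obtain r where r: "\<And>y. y \<in> K \<Longrightarrow> norm y \<le> r"
    using compact_imp_bounded[OF assms] unfolding bounded_iff by metis
  have "norm x \<le> r + \<epsilon>" if x: "x \<in> parallel_set K \<epsilon>" for x
  proof -
    obtain y where "y \<in> K" "dist x y \<le> \<epsilon>"
      using x mem_parallel_set_iff[OF compact_imp_closed[OF assms]] by blast
    then show ?thesis
      using r[of y] norm_triangle_sub[of x y] by (simp add: dist_norm)
  qed
  then show ?thesis
    unfolding bounded_iff by blast
qed

lemma parallel_set_mono:
  assumes "K \<subseteq> L" "closed (L :: 'a::heine_borel set)" "closed K"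
  shows "parallel_set K \<epsilon> \<subseteq> parallel_set L \<epsilon>"
  unfolding subset_iff mem_parallel_set_iff[OF assms(2)] mem_parallel_set_iff[OF assms(3)]
  using assms(1) by blast

lemma parallel_set_UN:
  fixes K :: "'b \<Rightarrow> 'a::heine_borel set"
  assumes "finite I" "\<And>i. i \<in> I \<Longrightarrow> closed (K i)"
  shows "parallel_set (\<Union>i\<in>I. K i) \<epsilon> = (\<Union>i\<in>I. parallel_set (K i) \<epsilon>)"
proof -
  have "closed (\<Union>i\<in>I. K i)"
    using assms by auto
  then show ?thesis
    using assms(2) by (simp add: set_eq_iff mem_parallel_set_iff)
qed

text \<open>The cells of two neighbouring words contain disjoint balls of radius comparable to \<open>\<epsilon>\<close> whose
  centres are at distance comparable to \<open>\<epsilon>\<close>.\<close>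

lemma scale_words_neighbours_bounded:
  fixes S :: "nat \<Rightarrow> 'a::euclidean_space \<Rightarrow> 'a"
  assumes S: "similarities N S r" and F: "compact F" and U: "osc_set N S U" and R: "0 < R"
  obtains M where "\<And>\<epsilon> \<sigma>. 0 < \<epsilon> \<Longrightarrow> \<sigma> \<in> scale_words N r R \<epsilon> \<Longrightarrow>
    card {\<tau> \<in> scale_words N r R \<epsilon>. parallel_set (word_map S \<tau> ` F) \<epsilon> \<inter> parallel_set (word_map S \<sigma> ` F) \<epsilon> \<noteq> {}} \<le> M"
proof -
  obtain m q where m: "0 < m" "\<And>i. i \<in> {1..N} \<Longrightarrow> m \<le> r i \<and> r i \<le> q"
    using obtain_ratio_bounds[OF S] by metis
  have "U \<noteq> {}" "open U"
    using U by (auto simp: osc_set_def)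
  then obtain u0 a where a: "0 < a" "ball u0 a \<subseteq> U"
    unfolding open_contains_ball by blast
  obtain D where D: "\<And>f. f \<in> F \<Longrightarrow> dist u0 f \<le> D"
    using compact_imp_bounded[OF F] unfolding bounded_any_center[of F u0] by metis
  define D' where "D' = max D 0"
  have D': "0 \<le> D'" "\<And>f. f \<in> F \<Longrightarrow> dist u0 f \<le> D'"
    using D by (auto simp: D'_def max.coboundedI1)
  \<comment> \<open>Every word of the given scale has ratio at least
    \<open>\<epsilon> * m / R\<close>, its last letter costing at least the factor \<open>m\<close>;
    so its copy of \<open>ball u0 a\<close> contains a ball of radius
    \<open>\<epsilon> * b\<close>.\<close>
  define b where "b = m * a / R"
  \<comment> \<open>In units of \<epsilon>: two parallel distances, the distance from each of the
    two centres to its cell points, at most \<open>D' / R\<close>, and the radius \<open>b\<close>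
    of the small ball.\<close>
  define L where "L = 2 + 2 * D' / R + b"
  have b: "0 < b"
    using m a R by (simp add: b_def)
  have L: "0 < L"
    using D' R b by (auto simp: L_def intro!: add_pos_pos add_pos_nonneg)
  define M where "M = nat \<lfloor>(L / b) ^ DIM('a)\<rfloor>"
  have "card {\<tau> \<in> scale_words N r R \<epsilon>. parallel_set (word_map S \<tau> ` F) \<epsilon> \<inter> parallel_set (word_map S \<sigma> ` F) \<epsilon> \<noteq> {}} \<le> M"
    if \<epsilon>: "0 < \<epsilon>" and \<sigma>: "\<sigma> \<in> scale_words N r R \<epsilon>" for \<epsilon> \<sigma>
  proof -
    define T where "T = {\<tau> \<in> scale_words N r R \<epsilon>. parallel_set (word_map S \<tau> ` F) \<epsilon> \<inter> parallel_set (word_map S \<sigma> ` F) \<epsilon> \<noteq> {}}"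
    define c where "c \<tau> = word_map S \<tau> u0" for \<tau>
    have fin: "finite T"
      unfolding T_def using finite_scale_words[OF S R \<epsilon>] by simp
    have Tsub: "\<tau> \<in> scale_words N r R \<epsilon>" if "\<tau> \<in> T" for \<tau>
      using that by (simp add: T_def)
    have sim: "similarity (word_ratio r \<tau>) (word_map S \<tau>)" if "\<tau> \<in> scale_words N r R \<epsilon>" for \<tau>
      by (rule similarity_word_map[OF S scale_wordsD(1)[OF that]])
    have closedF: "closed (word_map S \<tau> ` F)" if "\<tau> \<in> scale_words N r R \<epsilon>" for \<tau>
      by (intro compact_imp_closed compact_continuous_image continuous_on_similarity[OF sim[OF that]] F)
    have near: "dist (word_map S \<tau> f) (c \<tau>) \<le> \<epsilon> * (D' / R)" if "\<tau> \<in> scale_words N r R \<epsilon>" "f \<in> F" for \<tau> f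
    proof -
      have "word_ratio r \<tau> \<le> \<epsilon> / R"
        using scale_wordsD(3)[OF that(1)] R by (simp add: field_simps)
      then have "word_ratio r \<tau> * dist u0 f \<le> \<epsilon> / R * D'"
        using D'(2)[OF that(2)] \<epsilon> R by (intro mult_mono) auto
      then show ?thesis
        using similarityD(2)[OF sim[OF that(1)], of f u0] by (simp add: c_def dist_commute)
    qed
    have ballU: "ball (c \<tau>) (\<epsilon> * b) \<subseteq> word_map S \<tau> ` U" if \<tau>: "\<tau> \<in> scale_words N r R \<epsilon>" for \<tau>
    proof
      fix y assume y: "y \<in> ball (c \<tau>) (\<epsilon> * b)"
      obtain x where x: "y = word_map S \<tau> x"
        using bij_is_surj[OF bij_similarity[OF sim[OF \<tau>]]] by (metis surjD)
      have last: "butlast \<tau> \<in> words N" "last \<tau> \<in> {1..N}"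
        using scale_wordsD(1,2)[OF \<tau>] append_butlast_last_id[of \<tau>] words_append[of "butlast \<tau>" "[last \<tau>]" N] by auto
      have "word_ratio r \<tau> = word_ratio r (butlast \<tau>) * r (last \<tau>)"
        using word_ratio_append[of r "butlast \<tau>" "[last \<tau>]"] scale_wordsD(2)[OF \<tau>] by simp
      moreover have "\<epsilon> / R * m \<le> word_ratio r (butlast \<tau>) * r (last \<tau>)"
        using scale_wordsD(4)[OF \<tau>] R \<epsilon> m(1) m(2)[OF last(2)] word_ratio_pos[OF S last(1)]
        by (intro mult_mono) (auto simp: field_simps)
      ultimately have "\<epsilon> / R * m \<le> word_ratio r \<tau>"
        by simp
      then have "\<epsilon> / R * m * a \<le> word_ratio r \<tau> * a"
        by (rule mult_right_mono) (use a(1) in simp)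
      moreover have "dist (c \<tau>) y < \<epsilon> / R * m * a"
        using y by (simp add: b_def)
      ultimately have "word_ratio r \<tau> * dist u0 x < word_ratio r \<tau> * a"
        using similarityD(2)[OF sim[OF \<tau>], of u0 x] unfolding x c_def by simp
      then have "x \<in> ball u0 a"
        using similarityD(1)[OF sim[OF \<tau>]] by simp
      then show "y \<in> word_map S \<tau> ` U"
        using a(2) x by blast
    qed
    have sub: "ball (c \<tau>) (\<epsilon> * b) \<subseteq> ball (c \<sigma>) (\<epsilon> * L)" if \<tau>: "\<tau> \<in> T" for \<tau>
    proof
      fix y assume y: "y \<in> ball (c \<tau>) (\<epsilon> * b)"
      obtain z where "z \<in> parallel_set (word_map S \<tau> ` F) \<epsilon>" "z \<in> parallel_set (word_map S \<sigma> ` F) \<epsilon>"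
        using \<tau> by (auto simp: T_def)
      then obtain f g where fg: "f \<in> F" "g \<in> F" "dist z (word_map S \<tau> f) \<le> \<epsilon>" "dist z (word_map S \<sigma> g) \<le> \<epsilon>"
        using mem_parallel_set_iff[OF closedF[OF Tsub[OF \<tau>]]] mem_parallel_set_iff[OF closedF[OF \<sigma>]] by auto
      have "dist (c \<sigma>) y \<le> dist (c \<sigma>) (word_map S \<sigma> g) + dist (word_map S \<sigma> g) z + dist z (word_map S \<tau> f)
          + dist (word_map S \<tau> f) (c \<tau>) + dist (c \<tau>) y"
        using dist_triangle[of "c \<sigma>" y "word_map S \<sigma> g"] dist_triangle[of "word_map S \<sigma> g" y z]
          dist_triangle[of z y "word_map S \<tau> f"] dist_triangle[of "word_map S \<tau> f" y "c \<tau>"] by linarith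
      also have "\<dots> < \<epsilon> * (D' / R) + \<epsilon> + \<epsilon> + \<epsilon> * (D' / R) + \<epsilon> * b"
      proof -
        have "dist (c \<tau>) y < \<epsilon> * b"
          using y by simp
        then show ?thesis
          using near[OF \<sigma> fg(2)] near[OF Tsub[OF \<tau>] fg(1)] fg(3,4)
            dist_commute[of "c \<sigma>" "word_map S \<sigma> g"] dist_commute[of z "word_map S \<sigma> g"] by linarith
      qed
      also have "\<dots> = \<epsilon> * L"
        by (simp add: L_def algebra_simps)
      finally show "y \<in> ball (c \<sigma>) (\<epsilon> * L)"
        by simp
    qed
    have pw: "pairwise (\<lambda>\<tau> \<tau>'. disjnt (ball (c \<tau>) (\<epsilon> * b)) (ball (c \<tau>') (\<epsilon> * b))) T"
      unfolding pairwise_def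
    proof (intro ballI impI)
      fix \<tau> \<tau>' assume T: "\<tau> \<in> T" "\<tau>' \<in> T" "\<tau> \<noteq> \<tau>'"
      then have "word_map S \<tau> ` U \<inter> word_map S \<tau>' ` U = {}"
        by (intro scale_words_osc_disjoint[OF S U R Tsub Tsub])
      then show "disjnt (ball (c \<tau>) (\<epsilon> * b)) (ball (c \<tau>') (\<epsilon> * b))"
        using ballU[OF Tsub[OF T(1)]] ballU[OF Tsub[OF T(2)]] unfolding disjnt_def by blast
    qed
    define V where "V = unit_ball_vol (real DIM('a))"
    have V: "0 < V"
      unfolding V_def by (rule unit_ball_vol_pos) simp
    have ball: "measure lebesgue (ball (x::'a) \<rho>) = V * \<rho> ^ DIM('a)" if "0 \<le> \<rho>" for x \<rho>
      using that by (simp add: content_ball V_def)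
    have "(\<Sum>\<tau>\<in>T. measure lebesgue (ball (c \<tau>) (\<epsilon> * b))) = measure lebesgue (\<Union>\<tau>\<in>T. ball (c \<tau>) (\<epsilon> * b))"
      by (rule measure_UNION'[symmetric, OF fin lmeasurable_ball pw])
    also have "\<dots> \<le> measure lebesgue (ball (c \<sigma>) (\<epsilon> * L))"
    proof (rule measure_mono_fmeasurable[OF UN_least[OF sub] _ lmeasurable_ball])
      show "(\<Union>\<tau>\<in>T. ball (c \<tau>) (\<epsilon> * b)) \<in> sets lebesgue"
        by (rule sets.finite_UN[OF fin fmeasurableD[OF lmeasurable_ball]])
    qed
    also have "\<dots> = V * (\<epsilon> * L) ^ DIM('a)"
      using \<epsilon> L by (intro ball) simp
    also have "(\<Sum>\<tau>\<in>T. measure lebesgue (ball (c \<tau>) (\<epsilon> * b))) = V * (real (card T) * (\<epsilon> * b) ^ DIM('a))"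
      using \<epsilon> b by (simp only: ball mult_nonneg_nonneg less_imp_le sum_constant) simp
    finally have "real (card T) * (\<epsilon> * b) ^ DIM('a) \<le> (\<epsilon> * L) ^ DIM('a)"
      using V by (simp only: mult_le_cancel_left_pos)
    then have "real (card T) \<le> (\<epsilon> * L) ^ DIM('a) / (\<epsilon> * b) ^ DIM('a)"
      using \<epsilon> b by (simp only: pos_le_divide_eq zero_less_power mult_pos_pos)
    then have "real (card T) \<le> ((\<epsilon> * L) / (\<epsilon> * b)) ^ DIM('a)"
      by (simp only: power_divide)
    then have "real (card T) \<le> (L / b) ^ DIM('a)"
      using \<epsilon> by simp
    then show ?thesis
      unfolding T_def[symmetric] M_def by (simp add: le_nat_floor)
  qed
  then show ?thesis
    by (rule that)
qed

section \<open>Curvature of parallel sets\<close>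

lemma closure_Compl_Int_ball_cong:
  fixes A B :: "'a::metric_space set"
  assumes "A \<inter> ball x e = B \<inter> ball x e"
  shows "closure (- A) \<inter> ball x e = closure (- B) \<inter> ball x e"
proof -
  have *: "closure (- A) \<inter> ball x e \<subseteq> closure (- B)" if "A \<inter> ball x e = B \<inter> ball x e" for A B
  proof -
    have "ball x e \<inter> closure (- A) \<subseteq> closure (ball x e \<inter> - A)"
      by (rule open_Int_closure_subset) simp
    also have "\<dots> \<subseteq> closure (- B)"
      using that by (intro closure_mono) auto
    finally show ?thesis
      by auto
  qed
  show ?thesis
    using *[OF assms] *[OF assms[symmetric]] by auto
qed

lemma closed_complement_nonempty:
  fixes A :: "'a::euclidean_space set"
  assumes "bounded A"
  shows "closed_complement A \<noteq> {}"
proof -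
  have "A \<noteq> UNIV"
    using assms not_bounded_UNIV by blast
  then have "- A \<noteq> {}"
    by blast
  then show ?thesis
    using closure_subset[of "- A"] by (auto simp: closed_complement_def)
qed

lemma closed_closed_complement: "closed (closed_complement A)"
  by (simp add: closed_complement_def)

lemma total_variation_empty_le:
  fixes \<mu> :: "'a::topological_space set \<Rightarrow> real"
  assumes "\<mu> {} = 0"
  shows "total_variation \<mu> {} \<le> c"
  unfolding total_variation_def
proof (rule SUP_least)
  fix E :: "nat \<Rightarrow> 'a set"
  assume "E \<in> {E. range E \<subseteq> sets borel \<and> disjoint_family E \<and> (\<Union>n. E n) = {}}"
  then have "E n = {}" for n
    by auto
  then show "(\<Sum>n. ennreal \<bar>\<mu> (E n)\<bar>) \<le> c"
    using assms by simp
qed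

lemma abs_parallel_curvature:
  "\<bar>parallel_curvature k K \<epsilon> B\<bar> = \<bar>federer_curvature k (closed_complement (parallel_set K \<epsilon>)) B\<bar>"
  by (simp add: parallel_curvature_def abs_mult power_abs)

lemma parallel_curvature_subadditive:
  fixes K :: "'a::euclidean_space set"
  assumes K: "compact K" "0 < reach (closed_complement (parallel_set K \<epsilon>))" and k: "k \<le> DIM('a)"
    and I: "finite I" and A: "\<And>i. i \<in> I \<Longrightarrow> A i \<in> sets borel" "\<And>i. i \<in> I \<Longrightarrow> bounded (A i)"
    and disj: "disjoint_family_on A I"
  shows "total_variation (parallel_curvature k K \<epsilon>) (\<Union>i\<in>I. A i) \<le> (\<Sum>i\<in>I. total_variation (parallel_curvature k K \<epsilon>) (A i))"
proof (rule total_variation_subadditive[OF I refl A(1)])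
  fix E assume E: "E \<in> sets borel" "E \<subseteq> (\<Union>i\<in>I. A i)"
  let ?X = "closed_complement (parallel_set K \<epsilon>)"
  have "E = (\<Union>i\<in>I. E \<inter> A i)"
    using E(2) by auto
  then have "federer_curvature k ?X E = federer_curvature k ?X (\<Union>i\<in>I. E \<inter> A i)"
    by simp
  also have "\<dots> = (\<Sum>i\<in>I. federer_curvature k ?X (E \<inter> A i))"
  proof (rule federer_curvature_sum[OF closed_closed_complement _ K(2) k I])
    show "?X \<noteq> {}"
      by (intro closed_complement_nonempty bounded_parallel_set K)
    show "disjoint_family_on (\<lambda>i. E \<inter> A i) I"
      using disj by (auto simp: disjoint_family_on_def)
  qed (use E A in \<open>auto intro: bounded_subset\<close>)
  finally show "\<bar>parallel_curvature k K \<epsilon> E\<bar> \<le> (\<Sum>i\<in>I. \<bar>parallel_curvature k K \<epsilon> (E \<inter> A i)\<bar>)"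
    unfolding abs_parallel_curvature by (simp add: sum_abs)
qed

text \<open>Parallel sets that agree in a ball have closed complements that agree in the same ball,
  so locality of the curvatures of those complements applies; the sign disappears in the absolute
  value.\<close>

lemma total_variation_parallel_curvature_local:
  fixes K L :: "'a::euclidean_space set"
  assumes K: "compact K" "0 < reach (closed_complement (parallel_set K \<epsilon>))"
    and L: "compact L" "0 < reach (closed_complement (parallel_set L \<epsilon>))"
    and k: "k \<le> DIM('a)" and A: "bounded A"
    and loc: "\<And>x. x \<in> A \<Longrightarrow> \<exists>e>0. parallel_set K \<epsilon> \<inter> ball x e = parallel_set L \<epsilon> \<inter> ball x e"
  shows "total_variation (parallel_curvature k K \<epsilon>) A = total_variation (parallel_curvature k L \<epsilon>) A"
proof (rule total_variation_cong)
  fix E assume E: "E \<in> sets borel" "E \<subseteq> A"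
  have "federer_curvature k (closed_complement (parallel_set K \<epsilon>)) E = federer_curvature k (closed_complement (parallel_set L \<epsilon>)) E"
  proof (rule federer_curvature_local[OF closed_closed_complement _ K(2) closed_closed_complement _ L(2) k E(1)])
    show "closed_complement (parallel_set K \<epsilon>) \<noteq> {}" "closed_complement (parallel_set L \<epsilon>) \<noteq> {}"
      by (intro closed_complement_nonempty bounded_parallel_set K L)+
    show "bounded E"
      by (rule bounded_subset[OF A E(2)])
    show "\<exists>e>0. closed_complement (parallel_set K \<epsilon>) \<inter> ball x e = closed_complement (parallel_set L \<epsilon>) \<inter> ball x e" if "x \<in> E" for x
      using loc[of x] that E(2) closure_Compl_Int_ball_cong unfolding closed_complement_def by blast
  qed
  then show "\<bar>parallel_curvature k K \<epsilon> E\<bar> = \<bar>parallel_curvature k L \<epsilon> E\<bar>"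
    unfolding abs_parallel_curvature by simp
qed

lemma closed_complement_parallel_set_similarity:
  fixes g :: "'a::euclidean_space \<Rightarrow> 'a"
  assumes "similarity \<rho> g"
  shows "closed_complement (parallel_set (g ` K) (\<rho> * \<epsilon>)) = g ` closed_complement (parallel_set K \<epsilon>)"
  by (simp add: parallel_set_similarity[OF assms] closed_complement_similarity[OF assms])

lemma total_variation_parallel_curvature_similarity:
  fixes g :: "'a::euclidean_space \<Rightarrow> 'a"
  assumes g: "similarity \<rho> g" and K: "compact K" "0 < reach (closed_complement (parallel_set K \<epsilon>))"
    and k: "k \<le> DIM('a)" and A: "bounded A"
  shows "total_variation (parallel_curvature k (g ` K) (\<rho> * \<epsilon>)) (g ` A) \<le>
    ennreal (\<rho> ^ k) * total_variation (parallel_curvature k K \<epsilon>) A"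
proof (rule total_variation_similarity_le[OF g])
  show "0 \<le> \<rho> ^ k"
    using similarityD(1)[OF g] by simp
  fix E assume E: "E \<in> sets borel" "E \<subseteq> A"
  let ?X = "closed_complement (parallel_set K \<epsilon>)"
  have "?X \<noteq> {}"
    by (intro closed_complement_nonempty bounded_parallel_set K)
  then have "federer_curvature k (g ` ?X) (g ` E) = \<rho> ^ k * federer_curvature k ?X E"
    using bounded_subset[OF A E(2)]
    by (intro federer_curvature_similarity[OF g closed_closed_complement _ K(2) k E(1)])
  then show "\<bar>parallel_curvature k (g ` K) (\<rho> * \<epsilon>) (g ` E)\<bar> = \<rho> ^ k * \<bar>parallel_curvature k K \<epsilon> E\<bar>"
    unfolding abs_parallel_curvature closed_complement_parallel_set_similarity[OF g]
    using similarityD(1)[OF g] by (simp add: abs_mult)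
qed

text \<open>The longest common prefix is not itself in \<open>T\<close>, being then a prefix of,
  hence equal to, both given words. So every word of \<open>T\<close> continues after it, and by
  maximality not all with the same letter.\<close>

lemma antichain_branching:
  assumes T: "\<sigma> \<in> T" "\<tau> \<in> T" "\<sigma> \<noteq> \<tau>" and anti: "\<And>\<sigma> \<tau>. \<sigma> \<in> T \<Longrightarrow> \<tau> \<in> T \<Longrightarrow> prefix \<sigma> \<tau> \<Longrightarrow> \<sigma> = \<tau>"
  obtains \<omega> i u j v where "\<And>\<sigma>. \<sigma> \<in> T \<Longrightarrow> prefix \<omega> \<sigma>" "i \<noteq> j" "\<omega> @ i # u \<in> T" "\<omega> @ j # v \<in> T"
proof -
  define \<omega> where "\<omega> = Longest_common_prefix T"
  have pre: "prefix \<omega> \<sigma>" if "\<sigma> \<in> T" for \<sigma>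
    unfolding \<omega>_def by (rule Longest_common_prefix_prefix[OF that])
  have ext: "\<exists>i u. \<sigma> = \<omega> @ i # u" if \<sigma>: "\<sigma> \<in> T" for \<sigma>
  proof -
    obtain w where w: "\<sigma> = \<omega> @ w"
      using pre[OF \<sigma>] by (auto simp: prefix_def)
    have "w \<noteq> []"
    proof
      assume "w = []"
      then have "\<omega> \<in> T"
        using w \<sigma> by simp
      then have "\<omega> = \<sigma>'" if "\<sigma>' \<in> T" for \<sigma>'
        using anti[of \<omega> \<sigma>'] pre that by blast
      then show False
        using T by metis
    qed
    then show ?thesis
      using w by (cases w) auto
  qed
  obtain i u where i: "\<sigma> = \<omega> @ i # u"
    using ext[OF T(1)] by blast
  have "\<exists>\<tau>\<in>T. \<not> prefix (\<omega> @ [i]) \<tau>"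
  proof (rule ccontr)
    assume "\<not> ?thesis"
    then have "length (\<omega> @ [i]) \<le> length \<omega>"
      unfolding \<omega>_def using T(1) by (intro Longest_common_prefix_longest) auto
    then show False
      by simp
  qed
  then obtain \<tau>' where \<tau>': "\<tau>' \<in> T" "\<not> prefix (\<omega> @ [i]) \<tau>'"
    by blast
  obtain j v where j: "\<tau>' = \<omega> @ j # v"
    using ext[OF \<tau>'(1)] by blast
  have "i \<noteq> j"
    using \<tau>'(2) unfolding j by auto
  then show ?thesis
    using that[OF pre, of i j u v] T(1) \<tau>'(1) i j by simp
qed

section \<open>From first-level overlaps to cell boundaries\<close>

text \<open>Near a point of \<open>A\<close> that lies in the \<open>\<epsilon>\<close>-parallel sets of exactly the cells in \<open>T\<close>, the set
  \<open>F\<^sub>\<epsilon>\<close> coincides with the parallel set of the smallest cell \<open>S\<^sub>\<omega> F\<close> containing them all. There the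
  curvature is that of a scaled copy of \<open>F\<close> at a larger distance, and the point lies in two different first
  level cells of this copy.\<close>

lemma curvature_bound_same_cells:
  fixes F :: "'a::euclidean_space set"
  assumes ss: "self_similar_set N S r F" and k: "k \<le> DIM('a)" and R: "0 < R"
    and exc: "exceptional_set N r F R Null"
    and bound: "\<And>\<epsilon> i j. \<epsilon> \<in> {0<..<R} - Null \<Longrightarrow> i \<in> {1..N} \<Longrightarrow> j \<in> {1..N} \<Longrightarrow> i \<noteq> j \<Longrightarrow>
      parallel_curvature_var k F \<epsilon> (parallel_set (S i ` F) \<epsilon> \<inter> parallel_set (S j ` F) \<epsilon>) \<le> ennreal (c * \<epsilon> ^ k)"
    and \<epsilon>: "\<epsilon> \<in> {0<..<R} - Null" "\<And>\<omega>. \<omega> \<in> words N \<Longrightarrow> \<epsilon> \<noteq> R * word_ratio r \<omega>"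
    and T: "T \<subseteq> scale_words N r R \<epsilon>" "\<sigma> \<in> T" "\<tau> \<in> T" "\<sigma> \<noteq> \<tau>"
    and A: "\<And>x. x \<in> A \<Longrightarrow> {\<tau> \<in> scale_words N r R \<epsilon>. x \<in> parallel_set (word_map S \<tau> ` F) \<epsilon>} = T"
  shows "parallel_curvature_var k F \<epsilon> A \<le> ennreal (c * \<epsilon> ^ k)"
proof -
  have S: "similarities N S r" and F: "F \<noteq> {}" "compact F" "F = hutchinson N S F"
    using ss by (auto simp: self_similar_set_def)
  have sub: "hutchinson N S F \<subseteq> F"
    using F(3) by simp
  let ?W = "scale_words N r R \<epsilon>"
  let ?P = "\<lambda>\<tau>. parallel_set (word_map S \<tau> ` F) \<epsilon>"
  have \<epsilon>0: "0 < \<epsilon>" "\<epsilon> \<le> R" "\<epsilon> \<notin> Null"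
    using \<epsilon>(1) by auto
  have finW: "finite ?W"
    by (rule finite_scale_words[OF S R \<epsilon>0(1)])
  have compact_cell: "compact (word_map S \<omega> ` F)" if "\<omega> \<in> words N" for \<omega>
    by (intro compact_continuous_image continuous_on_similarity[OF similarity_word_map[OF S that]] F(2))
  have reach: "0 < reach (closed_complement (parallel_set F \<delta>))" if "0 < \<delta>" "\<delta> \<notin> Null" for \<delta>
    using exc that by (auto simp: exceptional_set_def irregular_values_def regular_distance_def)
  obtain \<omega> i u j v where br: "\<And>\<sigma>. \<sigma> \<in> T \<Longrightarrow> prefix \<omega> \<sigma>" "i \<noteq> j" "\<omega> @ i # u \<in> T" "\<omega> @ j # v \<in> T"
    using antichain_branching[OF T(2-4)] scale_words_antichain[OF S R] T(1) by (metis subsetD)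
  have iu: "\<omega> @ i # u \<in> ?W" and jv: "\<omega> @ j # v \<in> ?W"
    using br(3,4) T(1) by auto
  have w: "\<omega> \<in> words N" "i \<in> {1..N}" "j \<in> {1..N}" "u \<in> words N" "v \<in> words N"
    using scale_wordsD(1)[OF iu] scale_wordsD(1)[OF jv] by auto
  define \<rho> where "\<rho> = word_ratio r \<omega>"
  define g where "g = word_map S \<omega>"
  have g: "similarity \<rho> g"
    unfolding \<rho>_def g_def by (rule similarity_word_map[OF S w(1)])
  have \<rho>: "0 < \<rho>"
    by (rule similarityD(1)[OF g])
  define \<delta> where "\<delta> = \<epsilon> / \<rho>"
  have \<epsilon>\<delta>: "\<epsilon> = \<rho> * \<delta>"
    using \<rho> by (simp add: \<delta>_def)
  have \<delta>0: "0 < \<delta>"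
    using \<epsilon>0 \<rho> by (simp add: \<delta>_def)
  have "\<epsilon> \<le> R * \<rho>"
    unfolding \<rho>_def using scale_words_proper_prefix[OF S R iu] by simp
  \<comment> \<open>Equality would put the scaled distance at the endpoint \<open>R\<close>, outside
    the interval on which the bound is assumed.\<close>
  then have "\<epsilon> < R * \<rho>"
    using \<epsilon>(2)[OF w(1)] unfolding \<rho>_def by simp
  then have "\<delta> < R"
    using \<rho> by (simp add: \<delta>_def field_simps)
  \<comment> \<open>Stability of the null set under multiplication by ratios is used
    contrapositively: a bad \<open>\<delta>\<close> would make
    \<open>\<epsilon> = \<rho> * \<delta>\<close> bad.\<close>
  have "\<delta> \<notin> Null"
  proof
    assume "\<delta> \<in> Null"
    then have "\<rho> * \<delta> \<in> Null"
      using exc w(1) unfolding exceptional_set_def \<rho>_def by blast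
    then show False
      using \<epsilon>0(3) \<epsilon>\<delta> by simp
  qed
  with \<delta>0 \<open>\<delta> < R\<close> have \<delta>: "\<delta> \<in> {0<..<R} - Null"
    by simp
  have compact_Si: "compact (S l ` F)" if "l \<in> {1..N}" for l
    using compact_cell[of "[l]"] that by simp
  define D where "D = parallel_set (S i ` F) \<delta> \<inter> parallel_set (S j ` F) \<delta>"
  have D: "D \<in> sets borel" "bounded D"
    unfolding D_def using bounded_parallel_set[OF compact_Si[OF w(2)]]
    by (auto intro: borel_closed closed_Int closed_parallel_set bounded_subset)
  have cell: "?P (\<omega> @ l # x) \<subseteq> g ` parallel_set (S l ` F) \<delta>" if "l \<in> {1..N}" "x \<in> words N" for l x
  proof -
    have "word_map S (\<omega> @ l # x) ` F \<subseteq> g ` S l ` F"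
      using word_map_append_image_subset[OF sub that(2), of "\<omega> @ [l]"]
      by (simp add: word_map_append image_comp g_def)
    moreover have "compact (g ` S l ` F)" "compact (word_map S (\<omega> @ l # x) ` F)"
      using compact_cell[of "\<omega> @ [l]"] compact_cell[of "\<omega> @ l # x"] that w(1)
      by (simp_all add: word_map_append image_comp g_def)
    ultimately have "?P (\<omega> @ l # x) \<subseteq> parallel_set (g ` S l ` F) \<epsilon>"
      by (intro parallel_set_mono compact_imp_closed)
    then show ?thesis
      unfolding \<epsilon>\<delta> parallel_set_similarity[OF g] .
  qed
  have AD: "A \<subseteq> g ` D"
  proof
    fix x assume x: "x \<in> A"
    have "x \<in> ?P (\<omega> @ i # u)" "x \<in> ?P (\<omega> @ j # v)"
      using A[OF x] br(3,4) by auto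
    then have "x \<in> g ` parallel_set (S i ` F) \<delta> \<inter> g ` parallel_set (S j ` F) \<delta>"
      using cell w by blast
    then show "x \<in> g ` D"
      unfolding D_def using image_Int[OF bij_is_inj[OF bij_similarity[OF g]]] by blast
  qed
  have gF: "g ` F \<subseteq> F" "compact (g ` F)"
    unfolding g_def using word_map_image_subset[OF sub w(1)] compact_cell[OF w(1)] by auto
  have gD: "g ` D \<in> sets borel" "bounded (g ` D)"
    using borel_similarity_image[OF g D(1)] bounded_similarity_image[OF g D(2)] by auto
  have F_cells: "parallel_set F \<epsilon> = (\<Union>\<tau>\<in>?W. ?P \<tau>)"
  proof -
    have "F = (\<Union>\<tau>\<in>?W. word_map S \<tau> ` F)"
      by (rule scale_words_cover[OF S F(3) \<epsilon>0(1,2)])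
    then have "parallel_set F \<epsilon> = parallel_set (\<Union>\<tau>\<in>?W. word_map S \<tau> ` F) \<epsilon>"
      by (rule arg_cong)
    also have "\<dots> = (\<Union>\<tau>\<in>?W. ?P \<tau>)"
      by (intro parallel_set_UN finW compact_imp_closed compact_cell scale_wordsD(1))
    finally show ?thesis .
  qed
  have loc: "\<exists>e>0. parallel_set F \<epsilon> \<inter> ball x e = parallel_set (g ` F) \<epsilon> \<inter> ball x e" if x: "x \<in> A" for x
  proof -
    \<comment> \<open>The cells outside \<open>T\<close> are finite in number and their parallel
      sets are closed, so a whole ball around \<open>x\<close> misses them.\<close>
    have "closed (\<Union>\<tau>\<in>?W - T. ?P \<tau>)"
      using finW by (intro closed_UN closed_parallel_set ballI) auto
    moreover have "x \<notin> (\<Union>\<tau>\<in>?W - T. ?P \<tau>)"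
      using A[OF x] by auto
    ultimately obtain e where e: "0 < e" "ball x e \<inter> (\<Union>\<tau>\<in>?W - T. ?P \<tau>) = {}"
      using open_contains_ball[of "- (\<Union>\<tau>\<in>?W - T. ?P \<tau>)"] by (metis ComplI disjoint_eq_subset_Compl open_Compl)
    have "?P \<tau> \<subseteq> parallel_set (g ` F) \<epsilon>" if \<tau>: "\<tau> \<in> T" for \<tau>
    proof -
      obtain x where x: "\<tau> = \<omega> @ x"
        using br(1)[OF \<tau>] by (auto simp: prefix_def)
      have "\<tau> \<in> words N"
        using \<tau> T(1) scale_wordsD(1) by blast
      then show ?thesis
        using word_map_append_image_subset[OF sub, of x \<omega>] x gF(2)
        by (intro parallel_set_mono compact_imp_closed compact_cell) (simp_all add: g_def)
    qed
    moreover have "parallel_set (g ` F) \<epsilon> \<subseteq> parallel_set F \<epsilon>"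
      by (intro parallel_set_mono gF compact_imp_closed F)
    ultimately have "parallel_set F \<epsilon> \<inter> ball x e = parallel_set (g ` F) \<epsilon> \<inter> ball x e"
      using e(2) unfolding F_cells by blast
    then show ?thesis
      using e(1) by blast
  qed
  \<comment> \<open>Locality needs positive reach for both sets; for the small copy at \<epsilon> it
    is the reach for \<open>F\<close> at \<delta>, carried over by the similarity.\<close>
  have reach_g: "0 < reach (closed_complement (parallel_set (g ` F) \<epsilon>))"
    unfolding \<epsilon>\<delta> closed_complement_parallel_set_similarity[OF g]
    by (intro reach_pos_similarity[OF g] reach \<delta>0 \<open>\<delta> \<notin> Null\<close>)
  have "total_variation (parallel_curvature k F \<epsilon>) A = total_variation (parallel_curvature k (g ` F) \<epsilon>) A"
    by (rule total_variation_parallel_curvature_local[OF F(2) reach[OF \<epsilon>0(1,3)] gF(2) reach_g k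
          bounded_subset[OF gD(2) AD] loc])
  also have "\<dots> \<le> total_variation (parallel_curvature k (g ` F) \<epsilon>) (g ` D)"
    by (rule total_variation_mono[OF AD gD(1)])
  also have "\<dots> \<le> ennreal (\<rho> ^ k) * total_variation (parallel_curvature k F \<delta>) D"
    unfolding \<epsilon>\<delta>
    by (rule total_variation_parallel_curvature_similarity[OF g F(2) reach[OF \<delta>0 \<open>\<delta> \<notin> Null\<close>] k D(2)])
  also have "\<dots> \<le> ennreal (\<rho> ^ k) * ennreal (c * \<delta> ^ k)"
    using bound[OF \<delta> w(2,3) br(2)] unfolding parallel_curvature_var_def D_def by (rule mult_left_mono) simp
  also have "\<dots> = ennreal (c * \<epsilon> ^ k)"
    using \<rho> by (simp add: ennreal_mult'[symmetric] \<epsilon>\<delta> power_mult_distrib mult.left_commute)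
  finally show ?thesis
    unfolding parallel_curvature_var_def .
qed

theorem theorem5p1:
  fixes F U :: "'a::euclidean_space set"
    and S :: "nat \<Rightarrow> 'a \<Rightarrow> 'a" and r :: "nat \<Rightarrow> real"
    and N k :: nat and R :: real
  assumes "DIM('a) \<ge> 2" and "k \<le> DIM('a) - 2"
    and "self_similar_set N S r F"
    and "OSC N S" and "RC F"
    and "R > sqrt 2 * diameter F" and "sosc_set N S F U"
    and "SCBC k N S r F R"
  shows "CBC k N S r F U R"
proof -
  note ss = assms(3)
  have S: "similarities N S r" and F: "F \<noteq> {}" "compact F" "F = hutchinson N S F"
    using ss by (auto simp: self_similar_set_def)
  have k: "k \<le> DIM('a)"
    using assms(2) by simp
  have "0 \<le> sqrt 2 * diameter F"
    using diameter_ge_0[OF compact_imp_bounded[OF F(2)]] by simp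
  then have R: "0 < R"
    using assms(6) by linarith
  have U: "osc_set N S U"
    using assms(7) by (simp add: sosc_set_def)
  obtain c0 Null where exc: "exceptional_set N r F R Null"
    and bound0: "\<And>\<epsilon> i j. \<epsilon> \<in> {0<..<R} - Null \<Longrightarrow> i \<in> {1..N} \<Longrightarrow> j \<in> {1..N} \<Longrightarrow> i \<noteq> j \<Longrightarrow>
      parallel_curvature_var k F \<epsilon> (parallel_set (S i ` F) \<epsilon> \<inter> parallel_set (S j ` F) \<epsilon>) \<le> ennreal (c0 * \<epsilon> ^ k)"
    using assms(8) unfolding SCBC_def by metis
  \<comment> \<open>A negative constant acts as 0 under \<open>ennreal\<close>, but multiplying it
    by the number of groups would spoil the comparison with \<open>2 ^ M\<close>.\<close>
  define c where "c = max c0 0"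
  have c: "0 \<le> c"
    by (simp add: c_def)
  have bound: "parallel_curvature_var k F \<epsilon> (parallel_set (S i ` F) \<epsilon> \<inter> parallel_set (S j ` F) \<epsilon>) \<le> ennreal (c * \<epsilon> ^ k)"
    if "\<epsilon> \<in> {0<..<R} - Null" "i \<in> {1..N}" "j \<in> {1..N}" "i \<noteq> j" for \<epsilon> i j
  proof (rule order_trans[OF bound0[OF that]])
    show "ennreal (c0 * \<epsilon> ^ k) \<le> ennreal (c * \<epsilon> ^ k)"
      using that(1) by (intro ennreal_leI mult_right_mono) (auto simp: c_def)
  qed
  obtain M where M: "\<And>\<epsilon> \<sigma>. 0 < \<epsilon> \<Longrightarrow> \<sigma> \<in> scale_words N r R \<epsilon> \<Longrightarrow>
    card {\<tau> \<in> scale_words N r R \<epsilon>. parallel_set (word_map S \<tau> ` F) \<epsilon> \<inter> parallel_set (word_map S \<sigma> ` F) \<epsilon> \<noteq> {}} \<le> M"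
    using scale_words_neighbours_bounded[OF S F(2) U R] by blast
  have main: "parallel_curvature_var k F \<epsilon>
      (frontier (parallel_set (word_map S \<sigma> ` F) \<epsilon>) \<inter>
       frontier (\<Union>\<sigma>'\<in>scale_words N r R \<epsilon> - {\<sigma>}. parallel_set (word_map S \<sigma>' ` F) \<epsilon>)) \<le> ennreal (2 ^ M * c * \<epsilon> ^ k)"
    if \<epsilon>: "\<epsilon> \<in> {0<..<R} - Null" "\<And>\<omega>. \<omega> \<in> words N \<Longrightarrow> \<epsilon> \<noteq> R * word_ratio r \<omega>" and \<sigma>: "\<sigma> \<in> scale_words N r R \<epsilon>" for \<epsilon> \<sigma>
  proof -
    let ?W = "scale_words N r R \<epsilon>"
    let ?P = "\<lambda>\<tau>. parallel_set (word_map S \<tau> ` F) \<epsilon>"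
    let ?\<mu> = "parallel_curvature k F \<epsilon>"
    have \<epsilon>0: "0 < \<epsilon>" "\<epsilon> \<notin> Null"
      using \<epsilon>(1) by auto
    have finW: "finite ?W"
      by (rule finite_scale_words[OF S R \<epsilon>0(1)])
    have reach: "0 < reach (closed_complement (parallel_set F \<epsilon>))"
      using exc \<epsilon>0 by (auto simp: exceptional_set_def irregular_values_def regular_distance_def)
    define A where "A = frontier (?P \<sigma>) \<inter> frontier (\<Union>\<tau>\<in>?W - {\<sigma>}. ?P \<tau>)"
    have closedU: "closed (\<Union>\<tau>\<in>?W - {\<sigma>}. ?P \<tau>)"
      using finW by (intro closed_UN closed_parallel_set ballI) auto
    have A_sub: "A \<subseteq> ?P \<sigma>" "A \<subseteq> (\<Union>\<tau>\<in>?W - {\<sigma>}. ?P \<tau>)"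
      using frontier_subset_closed[OF closed_parallel_set] frontier_subset_closed[OF closedU] unfolding A_def by auto
    have "compact (word_map S \<sigma> ` F)"
      by (intro compact_continuous_image continuous_on_similarity[OF similarity_word_map[OF S scale_wordsD(1)[OF \<sigma>]]] F(2))
    then have A: "closed A" "bounded A"
      using bounded_subset[OF bounded_parallel_set A_sub(1)] by (auto simp: A_def)
    \<comment> \<open>All of \<open>A\<close> lies in the parallel cell of \<sigma>, so only cells
      meeting that one can occur in a group.\<close>
    define Nb where "Nb = {\<tau> \<in> ?W. ?P \<tau> \<inter> ?P \<sigma> \<noteq> {}}"
    have Nb: "finite Nb" "card Nb \<le> M" "Nb \<subseteq> ?W"
      using finW M[OF \<epsilon>0(1) \<sigma>] by (auto simp: Nb_def)
    \<comment> \<open>Written with differences of finite unions of open and of closed sets, so that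
      Borel measurability can be read off; \<open>C_iff\<close> gives the description as points with
      cell collection \<open>T\<close>.\<close>
    define C where "C T = A - (\<Union>\<tau>\<in>T. - ?P \<tau>) - (\<Union>\<tau>\<in>?W - T. ?P \<tau>)" for T
    have C_iff: "x \<in> C T \<longleftrightarrow> x \<in> A \<and> {\<tau> \<in> ?W. x \<in> ?P \<tau>} = T" if "T \<subseteq> ?W" for x T
      using that by (auto simp: C_def)
    have C_borel: "C T \<in> sets borel" if "T \<in> Pow Nb" for T
    proof -
      have "finite T"
        using that Nb(1) finite_subset by blast
      then show ?thesis
        unfolding C_def using finW A(1)
        by (intro sets.Diff sets.finite_UN borel_open borel_closed) (auto intro: closed_parallel_set)
    qed
    have C_bounded: "bounded (C T)" for T
      by (rule bounded_subset[OF A(2)]) (auto simp: C_def)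
    have C_disj: "disjoint_family_on C (Pow Nb)"
      unfolding disjoint_family_on_def using C_iff Nb(3) by (auto dest: subset_trans)
    have UC: "(\<Union>T\<in>Pow Nb. C T) = A"
    proof
      show "A \<subseteq> (\<Union>T\<in>Pow Nb. C T)"
      proof
        fix x assume x: "x \<in> A"
        have "{\<tau> \<in> ?W. x \<in> ?P \<tau>} \<subseteq> Nb"
          using A_sub(1) x by (auto simp: Nb_def)
        moreover have "x \<in> C {\<tau> \<in> ?W. x \<in> ?P \<tau>}"
          using x by (subst C_iff) auto
        ultimately show "x \<in> (\<Union>T\<in>Pow Nb. C T)"
          by blast
      qed
    qed (auto simp: C_def)
    have piece: "total_variation ?\<mu> (C T) \<le> ennreal (c * \<epsilon> ^ k)" if T: "T \<in> Pow Nb" for T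
    proof (cases "C T = {}")
      case True
      have "federer_curvature k (closed_complement (parallel_set F \<epsilon>)) {} = 0"
        using federer_curvature_Un[OF closed_closed_complement closed_complement_nonempty[OF bounded_parallel_set[OF F(2)]]
            reach k, of "{}" "{}"]
        by simp
      then have "?\<mu> {} = 0"
        by (simp add: parallel_curvature_def)
      then show ?thesis
        unfolding True by (rule total_variation_empty_le)
    next
      case False
      then obtain x where x: "x \<in> C T"
        by blast
      have TW: "T \<subseteq> ?W"
        using T Nb(3) by blast
      have xA: "x \<in> A" and xT: "{\<tau> \<in> ?W. x \<in> ?P \<tau>} = T"
        using x C_iff[OF TW] by auto
      have "\<sigma> \<in> T"
        using A_sub(1) xA \<sigma> xT by blast
      \<comment> \<open>Both frontiers are contained in closed sets: a point of \<open>A\<close>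
        lies in the cell of \<sigma> and in some other cell, which provides the two words needed for
        branching.\<close>
      moreover obtain \<tau> where "\<tau> \<in> T" "\<sigma> \<noteq> \<tau>"
        using A_sub(2) xA xT by blast
      ultimately have "parallel_curvature_var k F \<epsilon> (C T) \<le> ennreal (c * \<epsilon> ^ k)"
        using C_iff[OF TW] by (intro curvature_bound_same_cells[OF ss k R exc bound \<epsilon> TW]) auto
      then show ?thesis
        by (simp add: parallel_curvature_var_def)
    qed
    have "total_variation ?\<mu> A \<le> (\<Sum>T\<in>Pow Nb. total_variation ?\<mu> (C T))"
      using parallel_curvature_subadditive[OF F(2) reach k _ C_borel C_bounded C_disj] Nb(1) by (simp add: UC)
    also have "\<dots> \<le> (\<Sum>T\<in>Pow Nb. ennreal (c * \<epsilon> ^ k))"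
      by (intro sum_mono piece)
    also have "\<dots> = ennreal (real (card (Pow Nb)) * (c * \<epsilon> ^ k))"
      by (simp add: ennreal_mult' ennreal_of_nat_eq_real_of_nat)
    also have "\<dots> \<le> ennreal (2 ^ M * c * \<epsilon> ^ k)"
    proof (rule ennreal_leI)
      have "real (card (Pow Nb)) \<le> 2 ^ M"
        using Nb(1,2) by (simp add: card_Pow power_increasing)
      then have "real (card (Pow Nb)) * (c * \<epsilon> ^ k) \<le> 2 ^ M * (c * \<epsilon> ^ k)"
        using c \<epsilon>0 by (intro mult_right_mono) auto
      then show "real (card (Pow Nb)) * (c * \<epsilon> ^ k) \<le> 2 ^ M * c * \<epsilon> ^ k"
        by (simp add: mult.assoc)
    qed
    finally show ?thesis
      unfolding parallel_curvature_var_def A_def .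
  qed
  \<comment> \<open>These are the \<epsilon> for which rescaling by some word would give exactly
    \<open>R\<close>.\<close>
  have "countable ((\<lambda>\<omega>. R * word_ratio r \<omega>) ` words N)"
    by (intro countable_image countable_words)
  then have "(\<lambda>\<omega>. R * word_ratio r \<omega>) ` words N \<in> null_sets lebesgue"
    by (intro null_sets_completionI countable_imp_null_set_lborel)
  moreover have "Null \<in> null_sets lebesgue"
    using exc by (simp add: exceptional_set_def)
  ultimately have null: "Null \<union> (\<lambda>\<omega>. R * word_ratio r \<omega>) ` words N \<in> null_sets lebesgue"
    by (intro null_sets.Un)
  show ?thesis
    unfolding CBC_def
  proof (rule exI[of _ "2 ^ M * c"])
    show "AE \<epsilon> in lebesgue. \<epsilon> \<in> {0<..<R} \<longrightarrow>
        (\<forall>\<sigma>\<in>boundary_words N S r F U R \<epsilon>. parallel_curvature_var k F \<epsilon>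
          (frontier (parallel_set (word_map S \<sigma> ` F) \<epsilon>) \<inter>
           frontier (\<Union>\<sigma>'\<in>scale_words N r R \<epsilon> - {\<sigma>}. parallel_set (word_map S \<sigma>' ` F) \<epsilon>))
          \<le> ennreal (2 ^ M * c * \<epsilon> ^ k))"
      using AE_not_in[OF null]
    proof eventually_elim
      case (elim \<epsilon>)
      then show ?case
        by (intro impI ballI main) (auto simp: boundary_words_def)
    qed
  qed
qed

end
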